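(* Every basis of the class of Schauder equivalence relations has cardinality $2^{\omega}$.
   Context: $\mathbb{N}=\{0,1,2,\ldots\}$; Banach spaces are over $\mathbb{R}$. For a basic sequence $\{x_n\}$ in a Banach space $X$ (a Schauder basis, indexed by $\mathbb{N}$, of its closed linear span), $\mathrm{coef}(X,(x_n))$ is the set of all $a=(a_n)\in\mathbb{R}^{\mathbb{N}}$ such that $\sum_n a_nx_n$ converges in $X$, and $E(X,(x_n))$ is the (Borel) equivalence relation on $\mathbb{R}^{\mathbb{N}}$ given by $(x,y)\in E(X,(x_n)) \iff x-y\in \mathrm{coef}(X,(x_n))$. The Schauder equivalence relations are all the equivalence relations of the form $E(X,(x_n))$ with $X$ a Banach space and $\{x_n\}$ a basic sequence in $X$. For equivalence relations $E,F$ on Polish spaces $P,Q$, $E\leq_B F$ means that there is a Borel $\theta:P\to Q$ with $xEy\iff\theta(x)F\theta(y)$ for all $x,y\in P$. A subclass $\mathcal{B}$ of a class $\mathcal{C}$ of equivalence relations is a basis of $\mathcal{C}$ if for every $E\in\mathcal{C}$ there is $F\in\mathcal{B}$ with $F\leq_B E$. *)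

theory Defs
  imports "HOL-Analysis.Analysis" "HOL-Library.Function_Algebras"
begin

text \<open>
  \<^typ>\<open>nat \<Rightarrow> real\<close> as a real vector space with pointwise operations.  Its topology and Borel sets
  are those of the countable product (\<^theory>\<open>HOL-Analysis.Function_Topology\<close>,
  \<^theory>\<open>HOL-Analysis.Function_Metric\<close>), so it is the usual Polish space of real sequences.
\<close>

instantiation "fun" :: (type, real_vector) real_vector
begin

definition scaleR_fun :: "real \<Rightarrow> ('a \<Rightarrow> 'b) \<Rightarrow> 'a \<Rightarrow> 'b"
  where "scaleR_fun c f = (\<lambda>x. c *\<^sub>R f x)"

instance
  by standard (simp_all add: fun_eq_iff scaleR_fun_def scaleR_add_left scaleR_add_right)

end

lemma scaleR_fun_apply [simp]: "(c *\<^sub>R f) x = c *\<^sub>R f x"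
  by (simp add: scaleR_fun_def)


text \<open>
  Quantifying over Banach spaces rules out the type class \<^class>\<open>banach\<close>, so a Banach space is a linear
  subspace \<open>S\<close> of an ambient real vector space together with a complete norm \<open>N\<close> on \<open>S\<close>.
  The ambient space supplies only the vector space operations.
\<close>

definition norm_on :: "'v::real_vector set \<Rightarrow> ('v \<Rightarrow> real) \<Rightarrow> bool" where
  "norm_on S N \<longleftrightarrow>
     (\<forall>x\<in>S. 0 \<le> N x \<and> (N x = 0 \<longleftrightarrow> x = 0)) \<and>
     (\<forall>c. \<forall>x\<in>S. N (c *\<^sub>R x) = \<bar>c\<bar> * N x) \<and>
     (\<forall>x\<in>S. \<forall>y\<in>S. N (x + y) \<le> N x + N y)"

definition complete_norm_on :: "'v::real_vector set \<Rightarrow> ('v \<Rightarrow> real) \<Rightarrow> bool" where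
  "complete_norm_on S N \<longleftrightarrow>
     (\<forall>u::nat \<Rightarrow> 'v. range u \<subseteq> S \<longrightarrow>
        (\<forall>e>0. \<exists>k. \<forall>m\<ge>k. \<forall>n\<ge>k. N (u m - u n) < e) \<longrightarrow>
        (\<exists>y\<in>S. (\<lambda>n. N (u n - y)) \<longlonglongrightarrow> 0))"

definition banach_space_on :: "'v::real_vector set \<Rightarrow> ('v \<Rightarrow> real) \<Rightarrow> bool" where
  "banach_space_on S N \<longleftrightarrow> subspace S \<and> norm_on S N \<and> complete_norm_on S N"

definition series_converges_to ::
    "('v::real_vector \<Rightarrow> real) \<Rightarrow> (nat \<Rightarrow> 'v) \<Rightarrow> (nat \<Rightarrow> real) \<Rightarrow> 'v \<Rightarrow> bool" where
  "series_converges_to N x a y \<longleftrightarrow> (\<lambda>n. N ((\<Sum>i<n. a i *\<^sub>R x i) - y)) \<longlonglongrightarrow> 0"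

definition closed_span_on :: "'v::real_vector set \<Rightarrow> ('v \<Rightarrow> real) \<Rightarrow> 'v set \<Rightarrow> 'v set" where
  "closed_span_on S N A = {y \<in> S. \<forall>e>0. \<exists>z\<in>span A. N (z - y) < e}"

definition schauder_basis_on :: "'v::real_vector set \<Rightarrow> ('v \<Rightarrow> real) \<Rightarrow> (nat \<Rightarrow> 'v) \<Rightarrow> bool" where
  "schauder_basis_on S N x \<longleftrightarrow> range x \<subseteq> S \<and> (\<forall>y\<in>S. \<exists>!a. series_converges_to N x a y)"

definition basic_sequence_on :: "'v::real_vector set \<Rightarrow> ('v \<Rightarrow> real) \<Rightarrow> (nat \<Rightarrow> 'v) \<Rightarrow> bool" where
  "basic_sequence_on S N x \<longleftrightarrow>
     range x \<subseteq> S \<and> schauder_basis_on (closed_span_on S N (range x)) N x"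

definition coef :: "'v::real_vector set \<Rightarrow> ('v \<Rightarrow> real) \<Rightarrow> (nat \<Rightarrow> 'v) \<Rightarrow> (nat \<Rightarrow> real) set" where
  "coef S N x = {a. \<exists>y\<in>S. series_converges_to N x a y}"

definition schauder_rel ::
    "'v::real_vector set \<Rightarrow> ('v \<Rightarrow> real) \<Rightarrow> (nat \<Rightarrow> 'v) \<Rightarrow> ((nat \<Rightarrow> real) \<times> (nat \<Rightarrow> real)) set" where
  "schauder_rel S N x = {(u, v). u - v \<in> coef S N x}"

text \<open>
  Here the ambient vector space is fixed to \<^typ>\<open>nat \<Rightarrow> real\<close>.  This loses no relation:
  \<open>schauder_rel_in_schauder_relations\<close> below shows that the relation of a basic sequence in a Banach
  space inside an arbitrary vector space belongs to this set, and
  \<open>schauder_rel_banach_in_schauder_relations\<close> is the case of the Banach spaces in the sense of the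
  type class.
\<close>

definition schauder_relations :: "((nat \<Rightarrow> real) \<times> (nat \<Rightarrow> real)) set set" where
  "schauder_relations =
     {schauder_rel S N x | (S :: (nat \<Rightarrow> real) set) N x.
        banach_space_on S N \<and> basic_sequence_on S N x}"

definition borel_reducible ::
    "('a::polish_space \<times> 'a) set \<Rightarrow> ('b::polish_space \<times> 'b) set \<Rightarrow> bool" where
  "borel_reducible E F \<longleftrightarrow>
     (\<exists>\<theta> \<in> borel_measurable borel. \<forall>x y. (x, y) \<in> E \<longleftrightarrow> (\<theta> x, \<theta> y) \<in> F)"

definition reducibility_basis ::
    "('a::polish_space \<times> 'a) set set \<Rightarrow> ('a \<times> 'a) set set \<Rightarrow> bool" where
  "reducibility_basis \<B> \<C> \<longleftrightarrow> \<B> \<subseteq> \<C> \<and> (\<forall>E\<in>\<C>. \<exists>F\<in>\<B>. borel_reducible F E)"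


subsection \<open>Independence of the ambient vector space\<close>

lemma sum_fun_apply:
  fixes f :: "'i \<Rightarrow> 'a \<Rightarrow> 'b::comm_monoid_add"
  shows "(\<Sum>i\<in>A. f i) k = (\<Sum>i\<in>A. f i k)"
  by (induction A rule: infinite_finite_induct) auto

lemma norm_onD:
  assumes "norm_on S N" "x \<in> S"
  shows "0 \<le> N x" "N x = 0 \<longleftrightarrow> x = 0" "N (c *\<^sub>R x) = \<bar>c\<bar> * N x"
    "y \<in> S \<Longrightarrow> N (x + y) \<le> N x + N y"
  using assms unfolding norm_on_def by auto

lemma norm_on_uminus:
  assumes "norm_on S N" "x \<in> S"
  shows "N (- x) = N x"
proof -
  have "N ((-1) *\<^sub>R x) = \<bar>-1\<bar> * N x"
    using assms unfolding norm_on_def by blast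
  then show ?thesis by simp
qed

lemma norm_on_tendsto_add:
  assumes S: "subspace S" and N: "norm_on S N"
    and mem: "\<And>n. u n \<in> S" "\<And>n. v n \<in> S"
    and lim: "(\<lambda>n. N (u n)) \<longlonglongrightarrow> 0" "(\<lambda>n. N (v n)) \<longlonglongrightarrow> 0"
  shows "(\<lambda>n. N (u n + v n)) \<longlonglongrightarrow> 0"
proof (rule tendsto_sandwich[where f = "\<lambda>_. 0" and h = "\<lambda>n. N (u n) + N (v n)"])
  show "(\<lambda>n. N (u n) + N (v n)) \<longlonglongrightarrow> 0"
    using tendsto_add[OF lim] by simp
  show "\<forall>\<^sub>F n in sequentially. 0 \<le> N (u n + v n)"
    using N mem S unfolding norm_on_def by (simp add: subspace_add)
  show "\<forall>\<^sub>F n in sequentially. N (u n + v n) \<le> N (u n) + N (v n)"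
    using N mem unfolding norm_on_def by simp
qed auto

lemma norm_on_lim_unique:
  assumes S: "subspace S" and N: "norm_on S N"
    and mem: "\<And>n. u n \<in> S" "y \<in> S" "z \<in> S"
    and lim: "(\<lambda>n. N (u n - y)) \<longlonglongrightarrow> 0" "(\<lambda>n. N (u n - z)) \<longlonglongrightarrow> 0"
  shows "y = z"
proof -
  have "(\<lambda>n. N (- (u n - y))) \<longlonglongrightarrow> 0"
    using lim(1) norm_on_uminus[OF N] mem S by (simp add: subspace_diff del: minus_diff_eq)
  from norm_on_tendsto_add[OF S N _ _ this lim(2)]
  have "(\<lambda>n. N (- (u n - y) + (u n - z))) \<longlonglongrightarrow> 0"
    using mem S by (simp add: subspace_diff)
  then have "N (y - z) = 0" by (simp add: LIMSEQ_const_iff)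
  then show ?thesis
    using N mem S unfolding norm_on_def by (metis subspace_diff eq_iff_diff_eq_0)
qed

theorem schauder_rel_in_schauder_relations:
  fixes S :: "'v::real_vector set"
  assumes B: "banach_space_on S N" and x: "basic_sequence_on S N x"
  shows "schauder_rel S N x \<in> schauder_relations"
proof -
  have S: "subspace S" and N: "norm_on S N" and compl: "complete_norm_on S N"
    using B unfolding banach_space_on_def by auto
  define Y where "Y = closed_span_on S N (range x)"
  have xS: "x i \<in> S" for i using x unfolding basic_sequence_on_def by auto
  have uniq: "\<exists>!a. series_converges_to N x a y" if "y \<in> Y" for y
    using x that unfolding basic_sequence_on_def schauder_basis_on_def Y_def by auto
  define P where "P = (\<lambda>a n. \<Sum>i<n. a i *\<^sub>R x i)"
  have conv: "series_converges_to N x a y \<longleftrightarrow> (\<lambda>n. N (P a n - y)) \<longlonglongrightarrow> 0" for a y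
    unfolding series_converges_to_def P_def ..
  have PS: "P a n \<in> S" for a n
    unfolding P_def using S xS by (intro subspace_sum subspace_scale) auto
  have Pspan: "P a n \<in> span (range x)" for a n
    unfolding P_def by (intro span_sum span_scale span_base) auto
  define C where "C = coef S N x"
  define s where "s = (\<lambda>a. SOME y. y \<in> S \<and> series_converges_to N x a y)"
  have s: "s a \<in> S" "(\<lambda>n. N (P a n - s a)) \<longlonglongrightarrow> 0" if "a \<in> C" for a
  proof -
    have "\<exists>y. y \<in> S \<and> series_converges_to N x a y" using that unfolding C_def coef_def by auto
    from someI_ex[OF this] show "s a \<in> S" "(\<lambda>n. N (P a n - s a)) \<longlonglongrightarrow> 0"
      unfolding s_def conv by auto
  qed
  have s_eq: "a \<in> C" "s a = y" if "y \<in> S" "(\<lambda>n. N (P a n - y)) \<longlonglongrightarrow> 0" for a y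
  proof -
    show "a \<in> C" using that unfolding C_def coef_def conv by auto
    then show "s a = y" using norm_on_lim_unique[OF S N PS _ _ s(2) that(2)] s that by auto
  qed
  have Y_lim: "y \<in> Y" if "y \<in> S" "\<And>e. e > 0 \<Longrightarrow> \<exists>z\<in>span (range x). N (z - y) < e" for y
    using that unfolding Y_def closed_span_on_def by auto
  have sY: "s a \<in> Y" if a: "a \<in> C" for a
  proof (rule Y_lim)
    fix e :: real assume "e > 0"
    then have "\<forall>\<^sub>F n in sequentially. N (P a n - s a) < e"
      using order_tendstoD(2)[OF s(2)[OF a]] by auto
    then show "\<exists>z\<in>span (range x). N (z - s a) < e"
      using Pspan by (auto simp: eventually_sequentially)
  qed (use s a in auto)
  have inj: "a = b" if "a \<in> C" "b \<in> C" "s a = s b" for a b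
    using uniq[OF sY[OF that(1)]] s(2)[OF that(1)] s(2)[OF that(2)] that(3)
    unfolding conv by auto
  have surj: "\<exists>a\<in>C. s a = y" if y: "y \<in> Y" for y
  proof -
    have "y \<in> S" using y unfolding Y_def closed_span_on_def by auto
    moreover obtain a where "(\<lambda>n. N (P a n - y)) \<longlonglongrightarrow> 0"
      using uniq[OF y] unfolding conv by blast
    ultimately show ?thesis using s_eq by blast
  qed
  have P_add: "P (a + b) n = P a n + P b n" for a b n
    unfolding P_def by (simp add: scaleR_add_left sum.distrib)
  have P_scale: "P (c *\<^sub>R a) n = c *\<^sub>R P a n" for c a n
    unfolding P_def by (simp add: scaleR_right.sum)
  have N0: "N 0 = 0" using N S unfolding norm_on_def by (auto simp: subspace_0)
  have zero: "0 \<in> C" "s 0 = 0"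
    using s_eq[of 0 0] S N0 by (auto simp: P_def subspace_0)
  have add: "a + b \<in> C" "s (a + b) = s a + s b" if "a \<in> C" "b \<in> C" for a b
  proof -
    have "(\<lambda>n. N ((P a n - s a) + (P b n - s b))) \<longlonglongrightarrow> 0"
      using s that PS S by (intro norm_on_tendsto_add[OF S N]) (auto intro: subspace_diff)
    then have "(\<lambda>n. N (P (a + b) n - (s a + s b))) \<longlonglongrightarrow> 0"
      by (simp add: P_add algebra_simps)
    then show "a + b \<in> C" "s (a + b) = s a + s b"
      using s_eq[of "s a + s b" "a + b"] s that S by (auto intro: subspace_add)
  qed
  have scale: "c *\<^sub>R a \<in> C" "s (c *\<^sub>R a) = c *\<^sub>R s a" if "a \<in> C" for a c
  proof -
    have "N (c *\<^sub>R (P a n - s a)) = \<bar>c\<bar> * N (P a n - s a)" for n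
      by (rule norm_onD(3)[OF N subspace_diff[OF S PS s(1)[OF that]]])
    then have "(\<lambda>n. N (P (c *\<^sub>R a) n - c *\<^sub>R s a)) = (\<lambda>n. \<bar>c\<bar> * N (P a n - s a))"
      by (simp add: P_scale scaleR_diff_right)
    moreover have "(\<lambda>n. \<bar>c\<bar> * N (P a n - s a)) \<longlonglongrightarrow> 0"
      using tendsto_mult_left[OF s(2)[OF that], of "\<bar>c\<bar>"] by simp
    ultimately show "c *\<^sub>R a \<in> C" "s (c *\<^sub>R a) = c *\<^sub>R s a"
      using s_eq[of "c *\<^sub>R s a" "c *\<^sub>R a"] s that S by (auto intro: subspace_scale)
  qed
  have diff: "a - b \<in> C" "s (a - b) = s a - s b" if "a \<in> C" "b \<in> C" for a b
    using add[of a "(-1) *\<^sub>R b"] scale[of b "-1"] that by auto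
  have subC: "subspace C" using zero add scale by (intro subspaceI) auto
  define M where "M = (\<lambda>a. N (s a))"
  have normC: "norm_on C M"
    unfolding norm_on_def
  proof (intro conjI ballI allI)
    fix a assume a: "a \<in> C"
    note sa = s(1)[OF a]
    show "0 \<le> M a" using norm_onD(1)[OF N sa] unfolding M_def .
    have "N (s a) = 0 \<longleftrightarrow> s a = 0" by (rule norm_onD(2)[OF N sa])
    then show "M a = 0 \<longleftrightarrow> a = 0"
      using inj[OF a zero(1)] zero(2) unfolding M_def by metis
    show "M (c *\<^sub>R a) = \<bar>c\<bar> * M a" for c
      using norm_onD(3)[OF N sa] unfolding M_def scale(2)[OF a] .
    show "M (a + b) \<le> M a + M b" if "b \<in> C" for b
      using norm_onD(4)[OF N sa s(1)[OF that]] unfolding M_def add(2)[OF a that] .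
  qed
  have complC: "complete_norm_on C M"
    unfolding complete_norm_on_def
  proof (intro allI impI)
    fix u :: "nat \<Rightarrow> nat \<Rightarrow> real"
    assume u: "range u \<subseteq> C" and cauchy: "\<forall>e>0. \<exists>k. \<forall>m\<ge>k. \<forall>n\<ge>k. M (u m - u n) < e"
    have uC: "u n \<in> C" for n using u by auto
    have "\<forall>e>0. \<exists>k. \<forall>m\<ge>k. \<forall>n\<ge>k. N (s (u m) - s (u n)) < e"
      using cauchy diff(2)[OF uC uC] unfolding M_def by simp
    moreover have "range (\<lambda>n. s (u n)) \<subseteq> S" using s uC by auto
    ultimately have "\<exists>y\<in>S. (\<lambda>n. N (s (u n) - y)) \<longlonglongrightarrow> 0"
      using compl[unfolded complete_norm_on_def, rule_format, of "\<lambda>n. s (u n)"] by blast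
    then obtain y where y: "y \<in> S" "(\<lambda>n. N (s (u n) - y)) \<longlonglongrightarrow> 0" by blast
    have "y \<in> Y"
    proof (rule Y_lim[OF y(1)])
      fix e :: real assume e: "e > 0"
      then have "\<forall>\<^sub>F n in sequentially. N (s (u n) - y) < e / 2"
        using order_tendstoD(2)[OF y(2), of "e / 2"] by auto
      then obtain n where n: "N (s (u n) - y) < e / 2" by (auto simp: eventually_sequentially)
      obtain z where z: "z \<in> span (range x)" "N (z - s (u n)) < e / 2"
        using sY[OF uC[of n]] e unfolding Y_def closed_span_on_def
        by (auto dest!: spec[of _ "e / 2"])
      have "z \<in> S" using z(1) span_minimal[OF _ S] xS by blast
      then have "z - s (u n) \<in> S" "s (u n) - y \<in> S"
        using s(1)[OF uC] y(1) S by (auto intro: subspace_diff)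
      then have "N ((z - s (u n)) + (s (u n) - y)) \<le> N (z - s (u n)) + N (s (u n) - y)"
        by (rule norm_onD(4)[OF N])
      then show "\<exists>z\<in>span (range x). N (z - y) < e"
        using n z by (intro bexI[of _ z]) auto
    qed
    then obtain a where a: "a \<in> C" "s a = y" using surj by blast
    then have "(\<lambda>n. M (u n - a)) \<longlonglongrightarrow> 0"
      using y(2) diff(2)[OF uC a(1)] unfolding M_def by simp
    then show "\<exists>a\<in>C. (\<lambda>n. M (u n - a)) \<longlonglongrightarrow> 0" using a by blast
  qed
  define e :: "nat \<Rightarrow> nat \<Rightarrow> real" where "e = (\<lambda>i j. if i = j then 1 else 0)"
  have fin: "(\<Sum>i<n. b i *\<^sub>R e i) = (\<lambda>j. if j < n then b j else 0)" for b n
  proof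
    fix j
    have "(\<Sum>i<n. b i *\<^sub>R e i) j = (\<Sum>i<n. if i = j then b i else 0)"
      unfolding sum_fun_apply e_def by (intro sum.cong) auto
    then show "(\<Sum>i<n. b i *\<^sub>R e i) j = (if j < n then b j else 0)" by simp
  qed
  have finC: "(\<Sum>i<n. b i *\<^sub>R e i) \<in> C" "s (\<Sum>i<n. b i *\<^sub>R e i) = P b n" for b n
  proof -
    have "P (\<Sum>i<n. b i *\<^sub>R e i) m = P b n" if "m \<ge> n" for m
      unfolding P_def fin using that
      by (intro sum.mono_neutral_cong_right) auto
    then have "\<forall>\<^sub>F m in sequentially. N (P (\<Sum>i<n. b i *\<^sub>R e i) m - P b n) = 0"
      unfolding eventually_sequentially using N0 by (intro exI[of _ n]) simp
    then have "(\<lambda>m. N (P (\<Sum>i<n. b i *\<^sub>R e i) m - P b n)) \<longlonglongrightarrow> 0"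
      by (rule tendsto_eventually)
    from s_eq[OF PS this]
    show "(\<Sum>i<n. b i *\<^sub>R e i) \<in> C" "s (\<Sum>i<n. b i *\<^sub>R e i) = P b n" by auto
  qed
  have conv_e: "series_converges_to M e b a \<longleftrightarrow> (\<lambda>n. N (P b n - s a)) \<longlonglongrightarrow> 0" if "a \<in> C" for a b
    unfolding series_converges_to_def M_def using diff(2)[OF finC(1) that] finC(2) by simp
  have conv_e': "series_converges_to M e b a \<longleftrightarrow> b = a" if "a \<in> C" for a b
    unfolding conv_e[OF that] using s[OF that] s_eq[of "s a" b] inj[of b a] that by metis
  have eC: "e i \<in> C" for i
  proof -
    have "e i = (\<Sum>k<Suc i. e i k *\<^sub>R e k)" unfolding fin by (auto simp: e_def fun_eq_iff)
    then show ?thesis using finC(1)[of "e i" "Suc i"] by metis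
  qed
  have cl: "closed_span_on C M (range e) = C"
  proof -
    have "\<exists>z\<in>span (range e). M (z - a) < r" if "a \<in> C" "r > 0" for a r
    proof -
      have "series_converges_to M e a a" using conv_e'[OF that(1)] by simp
      then have "\<forall>\<^sub>F n in sequentially. M ((\<Sum>i<n. a i *\<^sub>R e i) - a) < r"
        unfolding series_converges_to_def using order_tendstoD(2) that(2) by blast
      then obtain n where "M ((\<Sum>i<n. a i *\<^sub>R e i) - a) < r"
        by (auto simp: eventually_sequentially)
      moreover have "(\<Sum>i<n. a i *\<^sub>R e i) \<in> span (range e)"
        by (intro span_sum span_scale span_base) auto
      ultimately show ?thesis by blast
    qed
    then show ?thesis unfolding closed_span_on_def by auto
  qed
  have "basic_sequence_on C M e"
    unfolding basic_sequence_on_def schauder_basis_on_def cl using eC conv_e' by auto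
  moreover have "banach_space_on C M"
    unfolding banach_space_on_def using subC normC complC by auto
  moreover have "coef C M e = C" unfolding coef_def using conv_e' by auto
  then have "schauder_rel C M e = schauder_rel S N x" unfolding schauder_rel_def C_def by simp
  ultimately show ?thesis unfolding schauder_relations_def by blast
qed

lemma banach_space_on_norm: "banach_space_on (UNIV :: 'a::banach set) norm"
proof -
  have "complete_norm_on (UNIV :: 'a set) norm"
    unfolding complete_norm_on_def
  proof (intro allI impI)
    fix u :: "nat \<Rightarrow> 'a"
    assume "\<forall>e>0. \<exists>k. \<forall>m\<ge>k. \<forall>n\<ge>k. norm (u m - u n) < e"
    then have "Cauchy u" by (intro CauchyI) blast
    then obtain y where "u \<longlonglongrightarrow> y" by (auto simp: Cauchy_convergent_iff convergent_def)
    then show "\<exists>y\<in>UNIV. (\<lambda>n. norm (u n - y)) \<longlonglongrightarrow> 0"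
      by (metis LIM_zero tendsto_norm_zero UNIV_I)
  qed
  then show ?thesis
    unfolding banach_space_on_def norm_on_def by (auto simp: norm_triangle_ineq)
qed

corollary schauder_rel_banach_in_schauder_relations:
  fixes x :: "nat \<Rightarrow> 'a::banach"
  assumes "\<And>y. y \<in> closure (span (range x)) \<Longrightarrow> \<exists>!a. (\<lambda>n. a n *\<^sub>R x n) sums y"
  shows "{(u, v). summable (\<lambda>n. (u n - v n) *\<^sub>R x n)} \<in> schauder_relations"
proof -
  have conv: "series_converges_to norm x a y \<longleftrightarrow> (\<lambda>n. a n *\<^sub>R x n) sums y" for a y
    unfolding series_converges_to_def sums_def
    using LIM_zero_iff tendsto_norm_zero_iff by fastforce
  have cl: "closed_span_on UNIV norm (range x) = closure (span (range x))"
    by (auto simp: closed_span_on_def closure_approachable dist_norm)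
  have "basic_sequence_on UNIV norm x"
    unfolding basic_sequence_on_def schauder_basis_on_def cl conv
    using assms closure_subset[of "span (range x)"] span_superset[of "range x"] by auto
  moreover have "schauder_rel UNIV norm x = {(u, v). summable (\<lambda>n. (u n - v n) *\<^sub>R x n)}"
    unfolding schauder_rel_def coef_def conv summable_def by simp
  ultimately show ?thesis
    using schauder_rel_in_schauder_relations[OF banach_space_on_norm] by metis
qed

end

theory Submission
  imports Defs
begin

text \<open>
  For \<open>0 < \<theta> \<le> 1\<close> let \<open>T\<^sub>\<theta>\<close> be the Tsirelson-type space whose norming functionals are the unit vectors
  and the sums \<open>\<theta> (g\<^sub>1 + \<dots> + g\<^sub>d)\<close> of functionals with successive supports, the first of which does
  not begin before \<open>d\<close>, and let \<open>E\<^sub>\<theta>\<close> be the Schauder relation of its unit vector basis.  The theorem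
  follows from two facts.  There are at most continuum many Schauder relations, because such a relation
  is determined by the norms of the finite rational combinations of its basic sequence
  (\<open>schauder_relations_lepoll\<close>).  And for \<open>a \<noteq> b\<close> no Schauder relation is reducible both to
  \<open>E\<^sub>a\<close> and to \<open>E\<^sub>b\<close> (\<open>tsirelson_rels_incompatible\<close>); so the members that a basis has to contain
  below the relations \<open>E\<^sub>\<theta>\<close>, \<open>1/2 \<le> \<theta> < 1\<close>, are pairwise different.

  Let the relation of a sequence \<open>x\<close> in a Banach space \<open>X\<close> be reducible to \<open>E\<^sub>a\<close> and to \<open>E\<^sub>b\<close>, where
  \<open>b < a\<close>.  A Borel map is continuous on a comeager set, and a stabilisation argument yields a
  subsequence \<open>y\<close> of \<open>x\<close>, rescaled to norm 2, along which both reductions act coordinatewise: the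
  \<open>j\<close>-th coordinate, a dyadic rational with denominator \<open>2\<^sup>j\<close> in the unit interval, is sent to a vector
  supported in the \<open>j\<close>-th of a sequence of consecutive intervals, and the intervals are the same for
  both reductions (\<open>localisation\<close>).  By gliding humps such a reduction is uniformly continuous far out,
  and so is its inverse (\<open>gliding_hump\<close>).

  Cutting a segment into small pieces makes uniform continuity linear at bounded distances.  In one
  direction this bounds the image of a vector of norm at most 2.  It also pins down the curve that a
  single coordinate traces: the step from 0 to \<open>2\<^sup>-\<^sup>e\<close> in a coordinate beyond some index depending on
  \<open>e\<close> is sent to a vector of norm at most \<open>C 2\<^sup>-\<^sup>e\<close>, as otherwise \<open>2\<^sup>e\<close> bad coordinates, each
  moved by \<open>2\<^sup>-\<^sup>e\<close>, would contradict the lower \<open>\<ell>\<^sub>1\<close> estimate of the Tsirelson norm (\<open>jump_upper\<close>).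
  In the other direction some step of this length is sent to a vector of norm at least \<open>\<delta> 2\<^sup>-\<^sup>e\<close>
  (\<open>partial_jump_lower\<close>).

  The two norms are separated by averages of averages, repeated \<open>j\<close> times (\<open>special_averages\<close>).  On
  them every normalised block sequence has norm at least \<open>a\<^sup>j\<close> in \<open>T\<^sub>a\<close> and at most a constant times
  \<open>b\<^sup>j\<close> in \<open>T\<^sub>b\<close>.  Multiply such an average by a number \<open>2\<^sup>\<kappa>\<close> of the order of \<open>a\<^sup>-\<^sup>j\<close>.  Seen through
  \<open>T\<^sub>a\<close> some partial sum of the resulting vector of \<open>X\<close> has norm greater than 2, and seen through
  \<open>T\<^sub>b\<close>, where the image has norm of the order of \<open>(b / a)\<^sup>j\<close>, all of them have norm at most 1 once \<open>j\<close> is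
  large (\<open>no_two_local_reductions\<close>).
\<close>

section \<open>Tsirelson norms\<close>

text \<open>
  The unit vector basis will be unconditional, so it suffices to have the nonnegative functionals and
  to test them on absolute values.  The premise \<open>d \<le> p 0\<close> is Schreier admissibility: \<open>p 0\<close> is a lower
  bound of the supports of the \<open>d\<close> functionals that are added.
\<close>
inductive_set norming_set :: "real \<Rightarrow> (nat \<Rightarrow> real) set" for \<theta> where
  unit: "(\<lambda>k. if k = n then 1 else 0) \<in> norming_set \<theta>"
| node: "(\<lambda>k. \<theta> * (\<Sum>i<d. g i k)) \<in> norming_set \<theta>"
    if "\<forall>i<d. g i \<in> norming_set \<theta>"
      "\<forall>i<d. \<forall>k. g i k \<noteq> 0 \<longrightarrow> p i \<le> k \<and> k < p (Suc i)"
      "\<forall>i<d. p i \<le> p (Suc i)" "d \<le> p 0"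

definition pairing :: "(nat \<Rightarrow> real) \<Rightarrow> (nat \<Rightarrow> real) \<Rightarrow> nat set \<Rightarrow> real" where
  "pairing f w A = (\<Sum>k\<in>A. f k * \<bar>w k\<bar>)"

text \<open>
  The norm of the restriction of \<open>w\<close> to \<open>A\<close>.  For finite \<open>A\<close> it is finite for every sequence \<open>w\<close>, so
  membership in the space can be expressed by the norms of sections.
\<close>
definition tnorm :: "real \<Rightarrow> (nat \<Rightarrow> real) \<Rightarrow> nat set \<Rightarrow> real" where
  "tnorm \<theta> w A = (SUP f\<in>norming_set \<theta>. pairing f w A)"

lemma interval_index_unique:
  fixes p :: "nat \<Rightarrow> nat"
  assumes "\<forall>i<d. p i \<le> p (Suc i)" "i < d" "j < d"
    "p i \<le> k" "k < p (Suc i)" "p j \<le> k" "k < p (Suc j)"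
  shows "i = j"
proof -
  have mono: "p a \<le> p b" if "a \<le> b" "b \<le> d" for a b
    using that(1,2)
  proof (induction b rule: dec_induct)
    case (step n)
    then show ?case using assms(1) by (meson Suc_le_lessD le_trans less_imp_le_nat)
  qed simp
  show ?thesis
    using mono[of "Suc i" j] mono[of "Suc j" i] assms by (metis Suc_leI leD less_imp_le_nat linorder_neqE_nat order_le_less_trans)
qed

lemma Least_interval_index:
  fixes s :: "nat \<Rightarrow> nat"
  assumes s: "strict_mono s" and i: "s k \<le> i" "i < s (Suc k)"
  shows "(LEAST k. i < s (Suc k)) = k"
proof (rule Least_equality)
  fix k' assume "i < s (Suc k')"
  then have "s k < s (Suc k')" using i by simp
  then show "k \<le> k'" using strict_mono_less[OF s] by simp
qed (rule i)

lemma sum_disjoint_supports: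
  fixes g :: "nat \<Rightarrow> nat \<Rightarrow> real"
  assumes "\<forall>i<d. \<forall>k. g i k \<noteq> 0 \<longrightarrow> p i \<le> k \<and> k < p (Suc i)" "\<forall>i<d. p i \<le> p (Suc i)"
  obtains "(\<Sum>i<d. g i k) = 0" | j where "j < d" "(\<Sum>i<d. g i k) = g j k"
proof (cases "\<exists>j<d. g j k \<noteq> 0")
  case True
  then obtain j where j: "j < d" "g j k \<noteq> 0" by blast
  have "g i k = 0" if "i < d" "i \<noteq> j" for i
    using interval_index_unique[OF assms(2) that(1) j(1), of k] assms(1) that j by blast
  then have "(\<Sum>i<d. g i k) = (\<Sum>i<d. if i = j then g j k else 0)"
    by (intro sum.cong) auto
  then show ?thesis using j that(2) by simp
next
  case False
  then show ?thesis using that(1) by (simp add: sum.neutral)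
qed

lemma pairing_eq_0: "(\<And>k. k \<in> A \<Longrightarrow> f k = 0) \<Longrightarrow> pairing f w A = 0"
  unfolding pairing_def by simp

lemma pairing_node: "pairing (\<lambda>k. \<theta> * (\<Sum>i<d. g i k)) w A = \<theta> * (\<Sum>i<d. pairing (g i) w A)"
  unfolding pairing_def by (simp add: sum_distrib_left sum_distrib_right mult.assoc) (rule sum.swap)

locale tsirelson =
  fixes \<theta> :: real
  assumes theta_pos: "0 < \<theta>" and theta_le: "\<theta> \<le> 1"
begin

lemma functional_range: "f \<in> norming_set \<theta> \<Longrightarrow> 0 \<le> f k \<and> f k \<le> 1"
proof (induction rule: norming_set.induct)
  case (node d g p)
  show ?case
    by (rule sum_disjoint_supports[OF node(2,3), of k])
      (use node theta_pos theta_le in \<open>auto intro: mult_le_one\<close>)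
qed auto

text \<open>
  A functional that almost norms \<open>w\<close> on a block may thus be taken to vanish outside that block, which
  makes functionals for successive blocks combinable.
\<close>
lemma functional_restrict:
  "f \<in> norming_set \<theta> \<Longrightarrow> (\<lambda>k. if k \<in> E then f k else 0) \<in> norming_set \<theta>"
proof (induction rule: norming_set.induct)
  case (unit n)
  have "(\<lambda>k. \<theta> * (\<Sum>i<(0::nat). (\<lambda>_ _. 0) i k)) \<in> norming_set \<theta>"
    by (rule norming_set.node[where p="\<lambda>_. 0"]) auto
  then have z: "(\<lambda>k. 0) \<in> norming_set \<theta>" by simp
  show ?case
  proof (cases "n \<in> E")
    case True
    then have "(\<lambda>k. if k \<in> E then if k = n then 1 else 0 else 0) = (\<lambda>k. if k = n then 1 else (0::real))" by auto
    then show ?thesis using norming_set.unit by simp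
  next
    case False
    then have "(\<lambda>k. if k \<in> E then if k = n then 1 else 0 else 0) = (\<lambda>k. (0::real))" by auto
    then show ?thesis using z by simp
  qed
next
  case (node d g p)
  have "(\<lambda>k. \<theta> * (\<Sum>i<d. (\<lambda>i k. if k \<in> E then g i k else 0) i k)) \<in> norming_set \<theta>"
    by (rule norming_set.node[where p=p]) (use node in auto)
  also have "(\<lambda>k. \<theta> * (\<Sum>i<d. (\<lambda>i k. if k \<in> E then g i k else 0) i k))
    = (\<lambda>k. if k \<in> E then \<theta> * (\<Sum>i<d. g i k) else 0)" by auto
  finally show ?case .
qed

lemma pairing_nonneg: "f \<in> norming_set \<theta> \<Longrightarrow> 0 \<le> pairing f w A"
  unfolding pairing_def using functional_range by (intro sum_nonneg) auto

lemma pairing_le_sum: "f \<in> norming_set \<theta> \<Longrightarrow> pairing f w A \<le> (\<Sum>k\<in>A. \<bar>w k\<bar>)"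
  unfolding pairing_def using functional_range by (intro sum_mono) (simp add: mult_left_le_one_le)

lemma pairing_le_tnorm: "f \<in> norming_set \<theta> \<Longrightarrow> pairing f w A \<le> tnorm \<theta> w A"
  unfolding tnorm_def by (intro cSUP_upper bdd_aboveI2[where M="\<Sum>k\<in>A. \<bar>w k\<bar>"] pairing_le_sum)

lemma tnorm_least:
  "(\<And>f. f \<in> norming_set \<theta> \<Longrightarrow> pairing f w A \<le> c) \<Longrightarrow> tnorm \<theta> w A \<le> c"
  unfolding tnorm_def using norming_set.unit by (intro cSUP_least) auto

lemma tnorm_nonneg: "0 \<le> tnorm \<theta> w A"
  using pairing_nonneg[OF norming_set.unit] pairing_le_tnorm[OF norming_set.unit]
  by (rule order_trans)

lemma tnorm_mono:
  assumes "finite B" "A \<subseteq> B" "\<And>k. k \<in> A \<Longrightarrow> \<bar>u k\<bar> \<le> \<bar>w k\<bar>"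
  shows "tnorm \<theta> u A \<le> tnorm \<theta> w B"
proof (rule tnorm_least)
  fix f assume f: "f \<in> norming_set \<theta>"
  have "pairing f u A \<le> pairing f w A"
    unfolding pairing_def using assms functional_range[OF f] by (intro sum_mono mult_left_mono) auto
  also have "\<dots> \<le> pairing f w B"
    unfolding pairing_def using assms functional_range[OF f] by (intro sum_mono2) auto
  also have "\<dots> \<le> tnorm \<theta> w B" by (rule pairing_le_tnorm[OF f])
  finally show "pairing f u A \<le> tnorm \<theta> w B" .
qed

lemma tnorm_cong: "(\<And>k. k \<in> A \<Longrightarrow> \<bar>u k\<bar> = \<bar>w k\<bar>) \<Longrightarrow> tnorm \<theta> u A = tnorm \<theta> w A"
  unfolding tnorm_def pairing_def by simp

lemma tnorm_triangle:
  assumes "\<And>k. k \<in> A \<Longrightarrow> \<bar>w k\<bar> \<le> \<bar>u k\<bar> + \<bar>v k\<bar>"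
  shows "tnorm \<theta> w A \<le> tnorm \<theta> u A + tnorm \<theta> v A"
proof (rule tnorm_least)
  fix f assume f: "f \<in> norming_set \<theta>"
  have "pairing f w A \<le> (\<Sum>k\<in>A. f k * (\<bar>u k\<bar> + \<bar>v k\<bar>))"
    unfolding pairing_def using assms functional_range[OF f] by (intro sum_mono mult_left_mono) auto
  also have "\<dots> = pairing f u A + pairing f v A"
    unfolding pairing_def by (simp add: sum.distrib distrib_left)
  also have "\<dots> \<le> tnorm \<theta> u A + tnorm \<theta> v A" by (intro add_mono pairing_le_tnorm f)
  finally show "pairing f w A \<le> tnorm \<theta> u A + tnorm \<theta> v A" .
qed

lemma tnorm_scale: "tnorm \<theta> (\<lambda>k. c * w k) A = \<bar>c\<bar> * tnorm \<theta> w A"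
proof (cases "c = 0")
  case True
  have "tnorm \<theta> (\<lambda>k. 0) A = 0"
    using tnorm_least[of "\<lambda>k. 0" A 0] tnorm_nonneg[of "\<lambda>k. 0" A] by (force simp: pairing_def)
  then show ?thesis using True by simp
next
  case False
  have le: "tnorm \<theta> (\<lambda>k. c * w k) A \<le> \<bar>c\<bar> * tnorm \<theta> w A" for c w
  proof (rule tnorm_least)
    fix f assume f: "f \<in> norming_set \<theta>"
    have "pairing f (\<lambda>k. c * w k) A = \<bar>c\<bar> * pairing f w A"
      unfolding pairing_def by (simp add: sum_distrib_left abs_mult mult_ac)
    then show "pairing f (\<lambda>k. c * w k) A \<le> \<bar>c\<bar> * tnorm \<theta> w A"
      using pairing_le_tnorm[OF f] by (simp add: mult_left_mono)
  qed
  have "tnorm \<theta> w A = tnorm \<theta> (\<lambda>k. (1/c) * (c * w k)) A" using False by simp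
  also have "\<dots> \<le> \<bar>1/c\<bar> * tnorm \<theta> (\<lambda>k. c * w k) A" by (rule le)
  finally have "\<bar>c\<bar> * tnorm \<theta> w A \<le> tnorm \<theta> (\<lambda>k. c * w k) A"
    using False by (simp add: field_simps)
  then show ?thesis using le[of c w] by simp
qed

lemma tnorm_zero: "(\<And>k. k \<in> A \<Longrightarrow> w k = 0) \<Longrightarrow> tnorm \<theta> w A = 0"
  using tnorm_cong[of A w "\<lambda>k. 0 * w k"] tnorm_scale[of 0 w A] by simp

lemma pairing_UN_le:
  assumes "finite I" "\<And>i. i \<in> I \<Longrightarrow> finite (A i)" and f: "f \<in> norming_set \<theta>"
  shows "pairing f w (\<Union>i\<in>I. A i) \<le> (\<Sum>i\<in>I. pairing f w (A i))"
  using assms(1,2)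
proof (induction I rule: finite_induct)
  case (insert i I)
  have "0 \<le> (\<Sum>k\<in>A i \<inter> (\<Union>i\<in>I. A i). f k * \<bar>w k\<bar>)"
    using functional_range[OF f] by (intro sum_nonneg) auto
  then have "pairing f w (A i \<union> (\<Union>i\<in>I. A i)) \<le> pairing f w (A i) + pairing f w (\<Union>i\<in>I. A i)"
    unfolding pairing_def using insert by (subst sum_Un) auto
  then show ?case using insert by simp
qed (simp add: pairing_def)

lemma tnorm_UN:
  assumes "finite I" "\<And>i. i \<in> I \<Longrightarrow> finite (A i)"
  shows "tnorm \<theta> w (\<Union>i\<in>I. A i) \<le> (\<Sum>i\<in>I. tnorm \<theta> w (A i))"
proof (rule tnorm_least)
  fix f assume f: "f \<in> norming_set \<theta>"
  have "pairing f w (\<Union>i\<in>I. A i) \<le> (\<Sum>i\<in>I. pairing f w (A i))"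
    using assms f by (rule pairing_UN_le)
  also have "\<dots> \<le> (\<Sum>i\<in>I. tnorm \<theta> w (A i))" by (intro sum_mono pairing_le_tnorm f)
  finally show "pairing f w (\<Union>i\<in>I. A i) \<le> (\<Sum>i\<in>I. tnorm \<theta> w (A i))" .
qed

lemma tnorm_Un:
  assumes "finite A" "finite B"
  shows "tnorm \<theta> w (A \<union> B) \<le> tnorm \<theta> w A + tnorm \<theta> w B"
  using tnorm_UN[of "{0,1::nat}" "\<lambda>i. if i = 0 then A else B" w] assms by (simp add: Un_commute split: if_splits)

lemma abs_le_tnorm: "finite A \<Longrightarrow> k \<in> A \<Longrightarrow> \<bar>w k\<bar> \<le> tnorm \<theta> w A"
proof -
  assume k: "finite A" "k \<in> A"
  have "pairing (\<lambda>j. if j = k then 1 else 0) w A = (\<Sum>j\<in>A. if j = k then \<bar>w k\<bar> else 0)"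
    unfolding pairing_def by (intro sum.cong) auto
  also have "\<dots> = \<bar>w k\<bar>" using k by simp
  finally show ?thesis using pairing_le_tnorm[OF norming_set.unit] by metis
qed

text \<open>
  The lower \<open>\<ell>\<^sub>1\<close> estimate: almost norming functionals for \<open>d\<close> successive pieces add up to a single
  admissible functional as soon as the pieces start at or after \<open>d\<close>.
\<close>
lemma tnorm_lower:
  assumes p: "\<forall>i<d. p i \<le> p (Suc i)" "d \<le> p 0"
    and A: "\<And>i. i < d \<Longrightarrow> A i \<subseteq> {p i..<p (Suc i)}"
  shows "\<theta> * (\<Sum>i<d. tnorm \<theta> w (A i)) \<le> tnorm \<theta> w (\<Union>i<d. A i)"
proof -
  have finA: "finite (A i)" if "i < d" for i using A[OF that] finite_subset by blast
  have "\<theta> * (\<Sum>i<d. tnorm \<theta> w (A i) - \<epsilon>) \<le> tnorm \<theta> w (\<Union>i<d. A i)" if e: "\<epsilon> > 0" for \<epsilon>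
  proof -
    have "\<exists>f\<in>norming_set \<theta>. tnorm \<theta> w (A i) - \<epsilon> < pairing f w (A i)" for i
      using tnorm_least[of w "A i" "tnorm \<theta> w (A i) - \<epsilon>"] e by (meson leD leI diff_less_eq less_add_same_cancel1 )
    then obtain f where f: "\<And>i. f i \<in> norming_set \<theta>"
      "\<And>i. tnorm \<theta> w (A i) - \<epsilon> < pairing (f i) w (A i)" by metis
    define g where "g i = (\<lambda>k. if k \<in> A i then f i k else 0)" for i
    have gk: "(\<lambda>k. \<theta> * (\<Sum>i<d. g i k)) \<in> norming_set \<theta>"
      by (rule norming_set.node[where p=p])
        (use p A in \<open>auto simp: g_def functional_restrict[OF f(1)] subset_eq split: if_splits\<close>)
    have gp: "pairing (g i) w (\<Union>i<d. A i) = pairing (f i) w (A i)" if "i < d" for i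
      unfolding pairing_def g_def using that finA by (intro sum.mono_neutral_cong_right) auto
    have "\<theta> * (\<Sum>i<d. tnorm \<theta> w (A i) - \<epsilon>) \<le> \<theta> * (\<Sum>i<d. pairing (g i) w (\<Union>i<d. A i))"
      using f(2) theta_pos by (intro mult_left_mono sum_mono) (auto simp: gp less_imp_le)
    also have "\<dots> = pairing (\<lambda>k. \<theta> * (\<Sum>i<d. g i k)) w (\<Union>i<d. A i)"
      by (rule pairing_node[symmetric])
    also have "\<dots> \<le> tnorm \<theta> w (\<Union>i<d. A i)" by (rule pairing_le_tnorm[OF gk])
    finally show ?thesis .
  qed
  then have *: "\<theta> * (\<Sum>i<d. tnorm \<theta> w (A i)) - \<theta> * d * \<epsilon> \<le> tnorm \<theta> w (\<Union>i<d. A i)" if "\<epsilon> > 0" for \<epsilon>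
    using that by (simp add: sum_subtractf algebra_simps)
  show ?thesis
  proof (rule field_le_epsilon)
    fix e :: real assume e: "e > 0"
    \<comment> \<open>adding 1 in the denominator covers the case \<open>d = 0\<close>\<close>
    have "\<theta> * d * (e / (\<theta> * d + 1)) \<le> e"
      using e theta_pos by (simp add: field_simps pos_divide_le_eq add_pos_nonneg)
    then show "\<theta> * (\<Sum>i<d. tnorm \<theta> w (A i)) \<le> tnorm \<theta> w (\<Union>i<d. A i) + e"
      using *[of "e / (\<theta> * d + 1)"] e theta_pos by (simp add: add_nonneg_pos)
  qed
qed

text \<open>
  \<open>\<theta>\<close> times the sum of an admissible family belongs to the norming set, so a family costs at most a
  factor \<open>1 / \<theta>\<close> over a single functional.
\<close>
lemma pairing_family_le:
  assumes "\<forall>i<d. g i \<in> norming_set \<theta>"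
      "\<forall>i<d. \<forall>k. g i k \<noteq> 0 \<longrightarrow> p i \<le> k \<and> k < p (Suc i)"
      "\<forall>i<d. p i \<le> p (Suc i)" "d \<le> p 0"
  shows "(\<Sum>i<d. pairing (g i) w A) \<le> tnorm \<theta> w A / \<theta>"
proof -
  have "\<theta> * (\<Sum>i<d. pairing (g i) w A) = pairing (\<lambda>k. \<theta> * (\<Sum>i<d. g i k)) w A"
    by (rule pairing_node[symmetric])
  also have "\<dots> \<le> tnorm \<theta> w A" by (rule pairing_le_tnorm[OF norming_set.node[OF assms]])
  finally show ?thesis using theta_pos by (simp add: field_simps)
qed

text \<open>
  Convergence of the series of \<open>w k\<close> times the \<open>k\<close>-th unit vector.  As the norm is monotone in
  the section, the Cauchy condition may fix the lower end of the sections.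
\<close>
definition conv :: "(nat \<Rightarrow> real) \<Rightarrow> bool" where
  "conv w \<longleftrightarrow> (\<forall>\<epsilon>>0. \<exists>M. \<forall>m. tnorm \<theta> w {M..<m} \<le> \<epsilon>)"

lemma conv_linear:
  assumes "conv u" "conv v" "\<And>k. \<bar>w k\<bar> \<le> \<bar>u k\<bar> + \<bar>v k\<bar>"
  shows "conv w"
  unfolding conv_def
proof (intro allI impI)
  fix \<epsilon> :: real assume e: "\<epsilon> > 0"
  obtain M1 where M1: "\<And>m. tnorm \<theta> u {M1..<m} \<le> \<epsilon>/2"
    using assms(1) e unfolding conv_def by (meson half_gt_zero)
  obtain M2 where M2: "\<And>m. tnorm \<theta> v {M2..<m} \<le> \<epsilon>/2"
    using assms(2) e unfolding conv_def by (meson half_gt_zero)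
  have "tnorm \<theta> w {max M1 M2..<m} \<le> \<epsilon>" for m
  proof -
    have "tnorm \<theta> w {max M1 M2..<m} \<le> tnorm \<theta> u {max M1 M2..<m} + tnorm \<theta> v {max M1 M2..<m}"
      by (intro tnorm_triangle assms(3))
    also have "\<dots> \<le> tnorm \<theta> u {M1..<m} + tnorm \<theta> v {M2..<m}"
      by (intro add_mono tnorm_mono) auto
    finally show ?thesis using M1[of m] M2[of m] by linarith
  qed
  then show "\<exists>M. \<forall>m. tnorm \<theta> w {M..<m} \<le> \<epsilon>" by blast
qed

end

section \<open>Schauder relations and their number\<close>

definition tsirelson_rel :: "real \<Rightarrow> ((nat \<Rightarrow> real) \<times> (nat \<Rightarrow> real)) set" where
  "tsirelson_rel \<theta> = {(u, v). tsirelson.conv \<theta> (u - v)}"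

context tsirelson
begin

text \<open>
  Meaningful on convergent sequences only, where the sections are bounded.
\<close>
definition tnorm_inf :: "(nat \<Rightarrow> real) \<Rightarrow> real" where
  "tnorm_inf w = (SUP m. tnorm \<theta> w {..<m})"

lemma conv_bounded:
  assumes "conv w"
  shows "bdd_above (range (\<lambda>m. tnorm \<theta> w {..<m}))"
proof -
  obtain M where M: "\<And>m. tnorm \<theta> w {M..<m} \<le> 1"
    using assms unfolding conv_def by (meson zero_less_one)
  have "tnorm \<theta> w {..<m} \<le> tnorm \<theta> w {..<M} + 1" for m
  proof -
    have "tnorm \<theta> w {..<m} \<le> tnorm \<theta> w ({..<M} \<union> {M..<m})"
      by (intro tnorm_mono) auto
    also have "\<dots> \<le> tnorm \<theta> w {..<M} + tnorm \<theta> w {M..<m}" by (rule tnorm_Un) auto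
    finally show ?thesis using M[of m] by linarith
  qed
  then show ?thesis by (rule bdd_aboveI2)
qed

lemma tnorm_le_inf: "conv w \<Longrightarrow> finite A \<Longrightarrow> tnorm \<theta> w A \<le> tnorm_inf w"
proof -
  assume w: "conv w" and A: "finite A"
  obtain m where m: "A \<subseteq> {..<m}" using A by (auto simp: finite_nat_iff_bounded)
  have "tnorm \<theta> w A \<le> tnorm \<theta> w {..<m}" by (rule tnorm_mono[OF _ m]) auto
  also have "\<dots> \<le> tnorm_inf w"
    unfolding tnorm_inf_def by (rule cSUP_upper[OF UNIV_I conv_bounded[OF w]])
  finally show ?thesis .
qed

lemma tnorm_inf_least: "(\<And>m. tnorm \<theta> w {..<m} \<le> c) \<Longrightarrow> tnorm_inf w \<le> c"
  unfolding tnorm_inf_def by (rule cSUP_least) simp_all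

lemma conv_finite:
  assumes "\<And>k. k \<ge> n \<Longrightarrow> w k = 0"
  shows "conv w"
  unfolding conv_def
proof (intro allI impI exI)
  fix \<epsilon> :: real and m assume "\<epsilon> > 0"
  then show "tnorm \<theta> w {n..<m} \<le> \<epsilon>" using tnorm_zero[of "{n..<m}" w] assms by simp
qed

lemma conv_scale: "conv w \<Longrightarrow> conv (c *\<^sub>R w)"
  unfolding conv_def
proof (intro allI impI)
  fix \<epsilon> :: real assume w: "\<forall>\<epsilon>>0. \<exists>M. \<forall>m. tnorm \<theta> w {M..<m} \<le> \<epsilon>" and e: "\<epsilon> > 0"
  have "\<epsilon> / (\<bar>c\<bar> + 1) > 0" using e by (simp add: add_nonneg_pos)
  then obtain M where M: "\<And>m. tnorm \<theta> w {M..<m} \<le> \<epsilon> / (\<bar>c\<bar> + 1)" using w by blast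
  have "tnorm \<theta> (c *\<^sub>R w) {M..<m} \<le> \<epsilon>" for m
  proof -
    have "tnorm \<theta> (c *\<^sub>R w) {M..<m} = \<bar>c\<bar> * tnorm \<theta> w {M..<m}"
      using tnorm_scale[of c w] by (simp add: scaleR_fun_def)
    also have "\<dots> \<le> (\<bar>c\<bar> + 1) * (\<epsilon> / (\<bar>c\<bar> + 1))"
      using M[of m] tnorm_nonneg by (intro mult_mono) auto
    finally show ?thesis by (simp add: add_nonneg_eq_0_iff split: if_splits)
  qed
  then show "\<exists>M. \<forall>m. tnorm \<theta> (c *\<^sub>R w) {M..<m} \<le> \<epsilon>" by blast
qed

lemma conv_add: "conv u \<Longrightarrow> conv v \<Longrightarrow> conv (u + v)"
  by (erule conv_linear) (auto intro: abs_triangle_ineq)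

lemma conv_diff: "conv u \<Longrightarrow> conv v \<Longrightarrow> conv (u - v)"
  by (erule conv_linear) (auto intro: abs_triangle_ineq4)

lemma subspace_conv: "subspace (Collect conv)"
  using conv_finite[of 0 0] conv_add conv_scale by (intro subspaceI) auto

lemma norm_on_conv: "norm_on (Collect conv) tnorm_inf"
  unfolding norm_on_def
proof (intro conjI ballI allI)
  fix w assume "w \<in> Collect conv"
  then have w: "conv w" by simp
  show ge: "0 \<le> tnorm_inf w" using tnorm_le_inf[OF w, of "{}"] tnorm_nonneg order_trans by blast
  show "tnorm_inf w = 0 \<longleftrightarrow> w = 0"
  proof
    assume "tnorm_inf w = 0"
    then have "\<bar>w k\<bar> \<le> 0" for k
      using tnorm_le_inf[OF w, of "{k}"] abs_le_tnorm[of "{k}" k w] by simp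
    then show "w = 0" by (auto simp: fun_eq_iff)
  next
    assume "w = 0"
    then have "tnorm_inf w \<le> 0" by (intro tnorm_inf_least) (simp add: tnorm_zero)
    then show "tnorm_inf w = 0" using ge by simp
  qed
  show "tnorm_inf (c *\<^sub>R w) = \<bar>c\<bar> * tnorm_inf w" for c
  proof -
    have le: "tnorm_inf (c *\<^sub>R w) \<le> \<bar>c\<bar> * tnorm_inf w" if "conv w" for c w
    proof (rule tnorm_inf_least)
      fix m
      have "tnorm \<theta> (c *\<^sub>R w) {..<m} = \<bar>c\<bar> * tnorm \<theta> w {..<m}"
        using tnorm_scale[of c w] by (simp add: scaleR_fun_def)
      also have "\<dots> \<le> \<bar>c\<bar> * tnorm_inf w"
        by (intro mult_left_mono tnorm_le_inf that) auto
      finally show "tnorm \<theta> (c *\<^sub>R w) {..<m} \<le> \<bar>c\<bar> * tnorm_inf w" .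
    qed
    show ?thesis
    proof (cases "c = 0")
      case True
      have "0 \<le> tnorm_inf (c *\<^sub>R w)"
        using tnorm_le_inf[OF conv_scale[OF w], of "{}"] tnorm_nonneg order_trans by blast
      then show ?thesis using le[OF w, of c] True by simp
    next
      case False
      then have "tnorm_inf w = tnorm_inf ((1 / c) *\<^sub>R (c *\<^sub>R w))" by simp
      also have "\<dots> \<le> \<bar>1 / c\<bar> * tnorm_inf (c *\<^sub>R w)" by (rule le[OF conv_scale[OF w]])
      finally have "\<bar>c\<bar> * tnorm_inf w \<le> tnorm_inf (c *\<^sub>R w)"
        using False by (simp add: field_simps)
      then show ?thesis using le[OF w, of c] by simp
    qed
  qed
  show "tnorm_inf (w + v) \<le> tnorm_inf w + tnorm_inf v" if "v \<in> Collect conv" for v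
  proof (rule tnorm_inf_least)
    fix m
    have "tnorm \<theta> (w + v) {..<m} \<le> tnorm \<theta> w {..<m} + tnorm \<theta> v {..<m}"
      by (rule tnorm_triangle) (simp add: abs_triangle_ineq)
    also have "\<dots> \<le> tnorm_inf w + tnorm_inf v"
      using that w by (intro add_mono tnorm_le_inf) auto
    finally show "tnorm \<theta> (w + v) {..<m} \<le> tnorm_inf w + tnorm_inf v" .
  qed
qed

text \<open>
  Lower semicontinuity under coordinatewise convergence, which holds since each functional is
  continuous in the finitely many coordinates of \<open>A\<close>.
\<close>
lemma tnorm_le_limit:
  assumes lim: "\<And>k. k \<in> A \<Longrightarrow> (\<lambda>n. u n k) \<longlonglongrightarrow> w k"
    and le: "\<And>n. n \<ge> n0 \<Longrightarrow> tnorm \<theta> (u n) A \<le> c"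
  shows "tnorm \<theta> w A \<le> c"
proof (rule tnorm_least)
  fix f assume f: "f \<in> norming_set \<theta>"
  have "(\<lambda>n. pairing f (u n) A) \<longlonglongrightarrow> pairing f w A"
    unfolding pairing_def by (intro tendsto_intros lim)
  moreover have "\<exists>N. \<forall>n\<ge>N. pairing f (u n) A \<le> c"
    by (intro exI[of _ n0] allI impI order_trans[OF pairing_le_tnorm[OF f] le])
  ultimately show "pairing f w A \<le> c" by (rule LIMSEQ_le_const2)
qed

text \<open>
  A Cauchy sequence converges in every coordinate, since coordinates are bounded by the norm, and lower
  semicontinuity of the norm of sections turns the coordinatewise limit into a limit in norm.
\<close>
lemma complete_norm_on_conv: "complete_norm_on (Collect conv) tnorm_inf"
  unfolding complete_norm_on_def
proof (intro allI impI)
  fix u :: "nat \<Rightarrow> nat \<Rightarrow> real"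
  assume u: "range u \<subseteq> Collect conv"
    and cauchy: "\<forall>e>0. \<exists>k. \<forall>m\<ge>k. \<forall>n\<ge>k. tnorm_inf (u m - u n) < e"
  have uc: "conv (u n)" for n using u by auto
  have dc: "conv (u m - u n)" for m n by (intro conv_diff uc)
  have "Cauchy (\<lambda>n. u n k)" for k
  proof (rule CauchyI)
    fix e :: real assume "0 < e"
    then obtain K where K: "\<forall>m\<ge>K. \<forall>n\<ge>K. tnorm_inf (u m - u n) < e" using cauchy by blast
    have "norm (u m k - u n k) \<le> tnorm_inf (u m - u n)" for m n
      using order_trans[OF abs_le_tnorm[of "{k}" k "u m - u n"] tnorm_le_inf[OF dc, of "{k}"]]
      by simp
    then show "\<exists>M. \<forall>m\<ge>M. \<forall>n\<ge>M. norm (u m k - u n k) < e"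
      using K order_le_less_trans by blast
  qed
  then have "\<forall>k. \<exists>l. (\<lambda>n. u n k) \<longlonglongrightarrow> l"
    unfolding Cauchy_convergent_iff convergent_def by blast
  from choice[OF this] obtain y where y: "\<And>k. (\<lambda>n. u n k) \<longlonglongrightarrow> y k" by blast
  have close: "\<exists>K. \<forall>n\<ge>K. \<forall>A. finite A \<longrightarrow> tnorm \<theta> (u n - y) A \<le> e" if e: "e > 0" for e
  proof -
    obtain K where K: "\<And>m n. m \<ge> K \<Longrightarrow> n \<ge> K \<Longrightarrow> tnorm_inf (u m - u n) < e"
      using cauchy e by meson
    have "tnorm \<theta> (u n - y) A \<le> e" if n: "n \<ge> K" and A: "finite A" for n A
    proof (rule tnorm_le_limit)
      show "(\<lambda>m. (u n - u m) k) \<longlonglongrightarrow> (u n - y) k" for k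
        by (simp) (intro tendsto_intros y)
      show "tnorm \<theta> (u n - u m) A \<le> e" if "m \<ge> K" for m
        using order_trans[OF tnorm_le_inf[OF dc A] less_imp_le[OF K[OF n that]]] .
    qed
    then show ?thesis by blast
  qed
  have "conv y"
    unfolding conv_def
  proof (intro allI impI)
    fix e :: real assume e: "e > 0"
    obtain n where n: "\<And>A. finite A \<Longrightarrow> tnorm \<theta> (u n - y) A \<le> e/2"
      using close[of "e/2"] e by fastforce
    obtain M where M: "\<And>m. tnorm \<theta> (u n) {M..<m} \<le> e/2"
      using uc[of n] e unfolding conv_def by (meson half_gt_zero)
    have "tnorm \<theta> y {M..<m} \<le> e" for m
    proof -
      have "tnorm \<theta> y {M..<m} \<le> tnorm \<theta> (u n - y) {M..<m} + tnorm \<theta> (u n) {M..<m}"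
        by (rule tnorm_triangle) auto
      then show ?thesis using n[of "{M..<m}"] M[of m] by simp
    qed
    then show "\<exists>M. \<forall>m. tnorm \<theta> y {M..<m} \<le> e" by blast
  qed
  moreover have "(\<lambda>n. tnorm_inf (u n - y)) \<longlonglongrightarrow> 0"
  proof (rule LIMSEQ_I)
    fix r :: real assume r: "r > 0"
    obtain K where K: "\<forall>n\<ge>K. \<forall>A. finite A \<longrightarrow> tnorm \<theta> (u n - y) A \<le> r/2"
      using close[of "r/2"] r by auto
    have "norm (tnorm_inf (u n - y) - 0) < r" if "n \<ge> K" for n
    proof -
      have "tnorm_inf (u n - y) \<le> r/2" using K that by (intro tnorm_inf_least) auto
      moreover have "0 \<le> tnorm_inf (u n - y)"
        using norm_onD(1)[OF norm_on_conv] conv_diff[OF uc \<open>conv y\<close>] by simp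
      ultimately show ?thesis using r by simp
    qed
    then show "\<exists>no. \<forall>n\<ge>no. norm (tnorm_inf (u n - y) - 0) < r" by blast
  qed
  ultimately show "\<exists>y\<in>Collect conv. (\<lambda>n. tnorm_inf (u n - y)) \<longlonglongrightarrow> 0" by blast
qed

definition unit_vector :: "nat \<Rightarrow> nat \<Rightarrow> real" where
  "unit_vector i = (\<lambda>k. if i = k then 1 else 0)"

lemma sum_unit_vectors: "(\<Sum>i<n. a i *\<^sub>R unit_vector i) = (\<lambda>k. if k < n then a k else 0)"
proof
  fix k
  have "(\<Sum>i<n. a i *\<^sub>R unit_vector i) k = (\<Sum>i<n. if i = k then a i else 0)"
    unfolding sum_fun_apply unit_vector_def by (intro sum.cong) auto
  then show "(\<Sum>i<n. a i *\<^sub>R unit_vector i) k = (if k < n then a k else 0)" by simp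
qed

lemma series_converges_unit_vectors:
  assumes "conv y"
  shows "series_converges_to tnorm_inf unit_vector a y \<longleftrightarrow> a = y"
proof
  assume lim: "series_converges_to tnorm_inf unit_vector a y"
  show "a = y"
  proof
    fix k
    have "\<bar>a k - y k\<bar> \<le> tnorm_inf ((\<Sum>i<n. a i *\<^sub>R unit_vector i) - y)" if "n > k" for n
    proof -
      have c: "conv ((\<Sum>i<n. a i *\<^sub>R unit_vector i) - y)"
        unfolding sum_unit_vectors by (intro conv_diff assms conv_finite[of n]) auto
      show ?thesis
        using order_trans[OF abs_le_tnorm[of "{k}" k] tnorm_le_inf[OF c, of "{k}"]] that
        by (simp add: sum_unit_vectors)
    qed
    then have "\<bar>a k - y k\<bar> \<le> 0"
      using lim unfolding series_converges_to_def
      by (intro LIMSEQ_le_const) (auto intro!: exI[of _ "Suc k"])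
    then show "a k = y k" by simp
  qed
next
  assume a: "a = y"
  show "series_converges_to tnorm_inf unit_vector a y"
    unfolding series_converges_to_def
  proof (rule LIMSEQ_I)
    fix r :: real assume r: "r > 0"
    obtain M where M: "\<And>m. tnorm \<theta> y {M..<m} \<le> r/2"
      using assms r unfolding conv_def by (meson half_gt_zero)
    have "norm (tnorm_inf ((\<Sum>i<n. a i *\<^sub>R unit_vector i) - y) - 0) < r" if n: "n \<ge> M" for n
    proof -
      let ?w = "(\<Sum>i<n. a i *\<^sub>R unit_vector i) - y"
      have c: "conv ?w"
        unfolding sum_unit_vectors by (intro conv_diff assms conv_finite[of n]) auto
      have "tnorm_inf ?w \<le> r/2"
      proof (rule tnorm_inf_least)
        fix m
        have "tnorm \<theta> ?w {..<m} \<le> tnorm \<theta> ?w ({..<n} \<union> {n..<m})"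
          by (rule tnorm_mono) auto
        also have "\<dots> \<le> tnorm \<theta> ?w {..<n} + tnorm \<theta> ?w {n..<m}" by (rule tnorm_Un) auto
        also have "tnorm \<theta> ?w {..<n} = 0" by (rule tnorm_zero) (simp add: sum_unit_vectors a)
        also have "tnorm \<theta> ?w {n..<m} \<le> tnorm \<theta> y {M..<m}"
          using n by (intro tnorm_mono) (auto simp: sum_unit_vectors)
        finally show "tnorm \<theta> ?w {..<m} \<le> r/2" using M[of m] by linarith
      qed
      moreover have "0 \<le> tnorm_inf ?w" using norm_onD(1)[OF norm_on_conv] c by simp
      ultimately show ?thesis using r by simp
    qed
    then show "\<exists>no. \<forall>n\<ge>no. norm (tnorm_inf ((\<Sum>i<n. a i *\<^sub>R unit_vector i) - y) - 0) < r" by blast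
  qed
qed

lemma tsirelson_rel_in_schauder_relations: "tsirelson_rel \<theta> \<in> schauder_relations"
proof -
  have "banach_space_on (Collect conv) tnorm_inf"
    unfolding banach_space_on_def
    using subspace_conv norm_on_conv complete_norm_on_conv by blast
  moreover have "basic_sequence_on (Collect conv) tnorm_inf unit_vector"
    unfolding basic_sequence_on_def schauder_basis_on_def
  proof (intro conjI ballI)
    have c: "conv (unit_vector i)" for i
      by (rule conv_finite[of "Suc i"]) (simp add: unit_vector_def)
    then show "range unit_vector \<subseteq> Collect conv" by auto
    have "\<exists>z\<in>span (range unit_vector). tnorm_inf (z - unit_vector i) < e" if "e > 0" for e i
      using span_base[of "unit_vector i" "range unit_vector"] that
        norm_onD(2)[OF norm_on_conv subspace_0[OF subspace_conv]]
      by (intro bexI[of _ "unit_vector i"]) auto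
    then show "range unit_vector \<subseteq> closed_span_on (Collect conv) tnorm_inf (range unit_vector)"
      unfolding closed_span_on_def using c by auto
    show "\<exists>!a. series_converges_to tnorm_inf unit_vector a y"
      if "y \<in> closed_span_on (Collect conv) tnorm_inf (range unit_vector)" for y
      using that series_converges_unit_vectors unfolding closed_span_on_def by auto
  qed
  moreover have "coef (Collect conv) tnorm_inf unit_vector = Collect conv"
    unfolding coef_def using series_converges_unit_vectors by auto
  then have "schauder_rel (Collect conv) tnorm_inf unit_vector = tsirelson_rel \<theta>"
    unfolding schauder_rel_def tsirelson_rel_def by simp
  ultimately show ?thesis unfolding schauder_relations_def by blast
qed

end

text \<open>
  Completeness replaces the limit by a condition on the norms of finite sums, and these are determined
  by countably many real numbers.
\<close>
lemma coef_iff_cauchy: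
  assumes B: "banach_space_on S N" and xS: "range x \<subseteq> S"
  shows "a \<in> coef S N x \<longleftrightarrow>
    (\<forall>\<epsilon>>0. \<exists>M. \<forall>n m. M \<le> n \<longrightarrow> n \<le> m \<longrightarrow> N (\<Sum>i\<in>{n..<m}. a i *\<^sub>R x i) \<le> \<epsilon>)"
    (is "_ \<longleftrightarrow> ?R")
proof -
  have S: "subspace S" and N: "norm_on S N" and compl: "complete_norm_on S N"
    using B unfolding banach_space_on_def by auto
  define P where "P n = (\<Sum>i<n. a i *\<^sub>R x i)" for n
  have PS: "P n \<in> S" for n
    unfolding P_def using S xS by (intro subspace_sum subspace_scale) auto
  have sec: "(\<Sum>i\<in>{n..<m}. a i *\<^sub>R x i) = P m - P n" if "n \<le> m" for n m
    unfolding P_def using that by (simp add: sum_diff_nat_ivl lessThan_atLeast0 )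
  have dist: "N (P m - P n) \<le> N (P m - y) + N (P n - y)" if "y \<in> S" for m n y
  proof -
    have "N ((P m - y) + (- (P n - y))) \<le> N (P m - y) + N (- (P n - y))"
      using that PS S by (intro norm_onD(4)[OF N]) (auto intro: subspace_diff subspace_neg simp del: minus_diff_eq)
    then show ?thesis using norm_on_uminus[OF N subspace_diff[OF S PS that], of n] by simp
  qed
  show ?thesis
  proof
    assume "a \<in> coef S N x"
    then obtain y where y: "y \<in> S" "(\<lambda>n. N (P n - y)) \<longlonglongrightarrow> 0"
      unfolding coef_def series_converges_to_def P_def by auto
    show ?R
    proof (intro allI impI)
      fix e :: real assume e: "e > 0"
      obtain M where M: "\<And>n. n \<ge> M \<Longrightarrow> norm (N (P n - y) - 0) < e/2"
        using LIMSEQ_D[OF y(2), of "e/2"] e by auto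
      have "N (\<Sum>i\<in>{n..<m}. a i *\<^sub>R x i) \<le> e" if "M \<le> n" "n \<le> m" for n m
        using sec[OF that(2)] dist[OF y(1), of m n] M[of n] M[of m] that by auto
      then show "\<exists>M. \<forall>n m. M \<le> n \<longrightarrow> n \<le> m \<longrightarrow> N (\<Sum>i\<in>{n..<m}. a i *\<^sub>R x i) \<le> e" by blast
    qed
  next
    assume R: ?R
    have "\<forall>e>0. \<exists>k. \<forall>m\<ge>k. \<forall>n\<ge>k. N (P m - P n) < e"
    proof (intro allI impI)
      fix e :: real assume e: "e > 0"
      obtain M where M: "\<And>n m. M \<le> n \<Longrightarrow> n \<le> m \<Longrightarrow> N (P m - P n) \<le> e/2"
        using R e sec by (metis half_gt_zero)
      have sym: "N (P m - P n) = N (P n - P m)" for m n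
        using norm_on_uminus[OF N subspace_diff[OF S PS PS], of m n] by simp
      have "N (P m - P n) \<le> e/2" if "M \<le> m" "M \<le> n" for m n
        using M[of n m] M[of m n] sym[of m n] that by (cases "n \<le> m") auto
      then show "\<exists>k. \<forall>m\<ge>k. \<forall>n\<ge>k. N (P m - P n) < e"
        using e by (intro exI[of _ M]) fastforce
    qed
    then have "\<exists>y\<in>S. (\<lambda>n. N (P n - y)) \<longlonglongrightarrow> 0"
      using compl[unfolded complete_norm_on_def, rule_format, of P] PS by blast
    then show "a \<in> coef S N x"
      unfolding coef_def series_converges_to_def P_def by auto
  qed
qed

lemma norm_on_sum_le:
  assumes S: "subspace S" and N: "norm_on S N" and "finite I" "\<And>i. i \<in> I \<Longrightarrow> v i \<in> S"
  shows "N (\<Sum>i\<in>I. v i) \<le> (\<Sum>i\<in>I. N (v i))"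
  using assms(3,4)
proof (induction I rule: finite_induct)
  case empty
  then show ?case using norm_onD(2)[OF N subspace_0[OF S]] by simp
next
  case (insert i I)
  then show ?case
    using norm_onD(4)[OF N, of "v i" "\<Sum>i\<in>I. v i"] subspace_sum[OF S, of I v] by auto
qed

text \<open>
  Real norms are recorded by their comparisons with rational numbers, so that countably many yes-or-no
  questions determine a relation.
\<close>
definition rational_norm_code :: "('v::real_vector \<Rightarrow> real) \<Rightarrow> (nat \<Rightarrow> 'v) \<Rightarrow> nat set" where
  "rational_norm_code N x =
    {to_nat (qs :: rat list, r :: rat) | qs r. N (\<Sum>i<length qs. of_rat (qs ! i) *\<^sub>R x i) < of_rat r}"

text \<open>
  The code determines the norms of rational combinations, and these determine the norms of real ones
  because the norm is Lipschitz in the coefficients.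
\<close>
lemma norm_eq_of_rational_norm_code_eq:
  assumes "rational_norm_code N x = rational_norm_code N' x'"
    and S: "subspace S" and N: "norm_on S N" and x: "range x \<subseteq> S"
    and S': "subspace S'" and N': "norm_on S' N'" and x': "range x' \<subseteq> S'"
  shows "N (\<Sum>i<n. a i *\<^sub>R x i) = N' (\<Sum>i<n. a i *\<^sub>R x' i)"
proof -
  have *: "N' (\<Sum>i<n. a i *\<^sub>R x' i) \<le> N (\<Sum>i<n. a i *\<^sub>R x i)"
    if code: "rational_norm_code N x = rational_norm_code N' x'"
    and S: "subspace S" and N: "norm_on S N" and x: "range x \<subseteq> S"
    and S': "subspace S'" and N': "norm_on S' N'" and x': "range x' \<subseteq> S'"
    for S :: "'v::real_vector set" and N x and S' :: "'w::real_vector set" and N' x'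
  proof (rule field_le_epsilon)
    fix e :: real assume e: "e > 0"
    define C where "C = (\<Sum>i<n. N (x i)) + (\<Sum>i<n. N' (x' i)) + 1"
    have xn: "x i \<in> S" "N (x i) \<ge> 0" for i using x norm_onD(1)[OF N] by auto
    have xn': "x' i \<in> S'" "N' (x' i) \<ge> 0" for i using x' norm_onD(1)[OF N'] by auto
    have C: "C > 0" unfolding C_def using xn xn' by (simp add: sum_nonneg add_nonneg_pos)
    define \<delta> where "\<delta> = e / (3 * C)"
    have d: "\<delta> > 0" unfolding \<delta>_def using e C by simp
    have "\<exists>q. \<bar>a i - of_rat q\<bar> < \<delta>" for i
    proof -
      obtain q where "a i - \<delta> < of_rat q" "of_rat q < a i + \<delta>" using of_rat_dense[of "a i - \<delta>" "a i + \<delta>"] d by auto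
      then show ?thesis by (intro exI[of _ q]) auto
    qed
    then obtain q where q: "\<And>i. \<bar>a i - of_rat (q i)\<bar> < \<delta>" by metis
    have near: "N (\<Sum>i<n. b i *\<^sub>R x i) \<le> \<delta> * (\<Sum>i<n. N (x i))"
      if "subspace S" "norm_on S N" "\<And>i. x i \<in> S" "\<And>i. \<bar>b i\<bar> \<le> \<delta>"
      for b and S :: "'u::real_vector set" and N x
    proof -
      have "N (\<Sum>i<n. b i *\<^sub>R x i) \<le> (\<Sum>i<n. N (b i *\<^sub>R x i))"
        using that by (intro norm_on_sum_le) (auto intro: subspace_scale)
      also have "\<dots> \<le> (\<Sum>i<n. \<delta> * N (x i))"
        using that norm_onD[OF that(2) that(3)] by (intro sum_mono) (auto intro: mult_right_mono)
      finally show ?thesis by (simp add: sum_distrib_left)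
    qed
    let ?q = "\<lambda>i. of_rat (q i) :: real"
    have "N (\<Sum>i<n. ?q i *\<^sub>R x i) = N ((\<Sum>i<n. a i *\<^sub>R x i) + (\<Sum>i<n. (?q i - a i) *\<^sub>R x i))"
      by (simp add: sum.distrib[symmetric] scaleR_add_left[symmetric])
    also have "\<dots> \<le> N (\<Sum>i<n. a i *\<^sub>R x i) + N (\<Sum>i<n. (?q i - a i) *\<^sub>R x i)"
      using xn S by (intro norm_onD(4)[OF N] subspace_sum subspace_scale) auto
    also have "N (\<Sum>i<n. (?q i - a i) *\<^sub>R x i) \<le> \<delta> * (\<Sum>i<n. N (x i))"
      using q xn by (intro near[OF S N]) (auto simp: abs_minus_commute less_imp_le)
    also have "\<dots> \<le> \<delta> * C" unfolding C_def using d xn' by (intro mult_left_mono) (auto simp: sum_nonneg)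
    finally have 1: "N (\<Sum>i<n. ?q i *\<^sub>R x i) < N (\<Sum>i<n. a i *\<^sub>R x i) + 2 * \<delta> * C"
      using mult_pos_pos[OF d C] by linarith
    obtain r where r: "N (\<Sum>i<n. ?q i *\<^sub>R x i) < of_rat r" "of_rat r < N (\<Sum>i<n. a i *\<^sub>R x i) + 2 * \<delta> * C"
      using of_rat_dense[OF 1] by blast
    define qs where "qs = map q [0..<n]"
    have qs: "(\<Sum>i<length qs. of_rat (qs ! i) *\<^sub>R z i) = (\<Sum>i<n. ?q i *\<^sub>R z i)" for z :: "nat \<Rightarrow> 'u::real_vector"
      unfolding qs_def by simp
    have "to_nat (qs, r) \<in> rational_norm_code N x"
      unfolding rational_norm_code_def using r(1) qs[of x] by auto
    then have "to_nat (qs, r) \<in> rational_norm_code N' x'" using code by simp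
    then have 2: "N' (\<Sum>i<n. ?q i *\<^sub>R x' i) < of_rat r"
      unfolding rational_norm_code_def using qs[of x'] by auto
    have "N' (\<Sum>i<n. a i *\<^sub>R x' i) = N' ((\<Sum>i<n. ?q i *\<^sub>R x' i) + (\<Sum>i<n. (a i - ?q i) *\<^sub>R x' i))"
      by (simp add: sum.distrib[symmetric] scaleR_add_left[symmetric])
    also have "\<dots> \<le> N' (\<Sum>i<n. ?q i *\<^sub>R x' i) + N' (\<Sum>i<n. (a i - ?q i) *\<^sub>R x' i)"
      using xn' S' by (intro norm_onD(4)[OF N'] subspace_sum subspace_scale) auto
    also have "N' (\<Sum>i<n. (a i - ?q i) *\<^sub>R x' i) \<le> \<delta> * (\<Sum>i<n. N' (x' i))"
      using q xn' by (intro near[OF S' N']) (auto simp: less_imp_le)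
    also have "\<dots> \<le> \<delta> * C" unfolding C_def using d xn by (intro mult_left_mono) (auto simp: sum_nonneg)
    finally have "N' (\<Sum>i<n. a i *\<^sub>R x' i) \<le> N (\<Sum>i<n. a i *\<^sub>R x i) + 3 * \<delta> * C"
      using 2 r(2) by (simp add: algebra_simps)
    also have "3 * \<delta> * C = e" unfolding \<delta>_def using C by simp
    finally show "N' (\<Sum>i<n. a i *\<^sub>R x' i) \<le> N (\<Sum>i<n. a i *\<^sub>R x i) + e" .
  qed
  show ?thesis
    using *[OF assms] *[OF assms(1)[symmetric] assms(5-7) assms(2-4)] by simp
qed

text \<open>
  A choice of a basic sequence for each relation makes the code of that sequence an injective
  invariant: the coefficients of convergent series depend only on the norms of sections.
\<close>
lemma schauder_relations_lepoll: "schauder_relations \<lesssim> (UNIV :: nat set set)"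
proof -
  define good where "good S N x \<longleftrightarrow> banach_space_on S N \<and> basic_sequence_on S N x"
    for S :: "(nat \<Rightarrow> real) set" and N x
  define sp where "sp E = (SOME (S, N, x). good S N x \<and> E = schauder_rel S N x)" for E
  define code where "code E = (case sp E of (S, N, x) \<Rightarrow> rational_norm_code N x)" for E
  have sp: "\<exists>S N x. sp E = (S, N, x) \<and> good S N x \<and> E = schauder_rel S N x"
    if "E \<in> schauder_relations" for E
  proof -
    have "\<exists>t. case t of (S, N, x) \<Rightarrow> good S N x \<and> E = schauder_rel S N x"
      using that unfolding schauder_relations_def good_def by auto
    from someI_ex[OF this] show ?thesis unfolding sp_def[symmetric] by (auto split: prod.splits)
  qed
  have "inj_on code schauder_relations"
  proof (rule inj_onI)
    fix E F assume E: "E \<in> schauder_relations" and F: "F \<in> schauder_relations" and eq: "code E = code F"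
    obtain S N x where 1: "sp E = (S, N, x)" "good S N x" "E = schauder_rel S N x" using sp[OF E] by blast
    obtain S' N' x' where 2: "sp F = (S', N', x')" "good S' N' x'" "F = schauder_rel S' N' x'" using sp[OF F] by blast
    have x: "banach_space_on S N" "range x \<subseteq> S"
      using 1(2) unfolding good_def basic_sequence_on_def by auto
    have x': "banach_space_on S' N'" "range x' \<subseteq> S'"
      using 2(2) unfolding good_def basic_sequence_on_def by auto
    have c: "rational_norm_code N x = rational_norm_code N' x'"
      using eq unfolding code_def 1(1) 2(1) by simp
    have "N (\<Sum>i<m. b i *\<^sub>R x i) = N' (\<Sum>i<m. b i *\<^sub>R x' i)" for m b
      by (rule norm_eq_of_rational_norm_code_eq[OF c _ _ x(2) _ _ x'(2)])
        (use x x' in \<open>auto simp: banach_space_on_def\<close>)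
    moreover have "(\<Sum>i\<in>{n..<m}. b i *\<^sub>R z i) = (\<Sum>i<m. (if n \<le> i then b i else 0) *\<^sub>R z i)"
      for n m b and z :: "nat \<Rightarrow> nat \<Rightarrow> real"
      by (intro sum.mono_neutral_cong_left) auto
    ultimately have "N (\<Sum>i\<in>{n..<m}. b i *\<^sub>R x i) = N' (\<Sum>i\<in>{n..<m}. b i *\<^sub>R x' i)" for n m b
      by simp
    then have "coef S N x = coef S' N' x'"
      unfolding set_eq_iff coef_iff_cauchy[OF x] coef_iff_cauchy[OF x'] by simp
    then show "E = F" unfolding 1(3) 2(3) schauder_rel_def by simp
  qed
  then show ?thesis unfolding lepoll_def by blast
qed

section \<open>Repeated averages\<close>

definition blocks :: "(nat \<Rightarrow> nat) \<Rightarrow> nat set \<Rightarrow> nat set" where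
  "blocks M A = (\<Union>n\<in>A. {M n..<M (Suc n)})"

text \<open>
  The hypotheses under which the functionals \<open>g 0, \<dots>, g (d - 1)\<close> may be added up.
\<close>
definition functional_family ::
    "real \<Rightarrow> nat \<Rightarrow> (nat \<Rightarrow> nat \<Rightarrow> real) \<Rightarrow> (nat \<Rightarrow> nat) \<Rightarrow> bool" where
  "functional_family \<theta> d g p \<longleftrightarrow>
     (\<forall>i<d. g i \<in> norming_set \<theta>) \<and>
     (\<forall>i<d. \<forall>k. g i k \<noteq> 0 \<longrightarrow> p i \<le> k \<and> k < p (Suc i)) \<and>
     (\<forall>i<d. p i \<le> p (Suc i)) \<and> d \<le> p 0"

text \<open>
  The weights \<open>1 / 2 ^ e n\<close> on the indices \<open>n \<in> A\<close> describe an average of block vectors, the \<open>n\<close>-th block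
  being the interval from \<open>M n\<close> to \<open>M (Suc n)\<close>.  The estimates are required for every vector \<open>w\<close> whose
  blocks have norms of the size of the weights, so they apply to an arbitrary block sequence.
\<close>
definition lower_average ::
    "real \<Rightarrow> (nat \<Rightarrow> nat) \<Rightarrow> real \<Rightarrow> nat set \<Rightarrow> (nat \<Rightarrow> nat) \<Rightarrow> bool" where
  "lower_average \<theta> M c A e \<longleftrightarrow>
     (\<forall>w \<delta>. 0 \<le> \<delta> \<longrightarrow> (\<forall>n\<in>A. \<delta> / 2 ^ e n \<le> tnorm \<theta> w {M n..<M (Suc n)}) \<longrightarrow>
        c * \<delta> \<le> tnorm \<theta> w (blocks M A))"

text \<open>
  \<open>s\<close> is the total weight, which bounds the norm by the triangle inequality.  The point is the factor
  \<open>t\<close> in the bound for families: if the averages are long compared with \<open>D\<close>, it can be made small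
  even for a whole family of functionals, and only this form can be iterated.
\<close>
definition upper_average ::
    "real \<Rightarrow> (nat \<Rightarrow> nat) \<Rightarrow> nat \<Rightarrow> real \<Rightarrow> real \<Rightarrow> nat set \<Rightarrow> (nat \<Rightarrow> nat) \<Rightarrow> bool" where
  "upper_average \<theta> M D s t A e \<longleftrightarrow>
     (\<forall>w C. 0 \<le> C \<longrightarrow> (\<forall>n\<in>A. tnorm \<theta> w {M n..<M (Suc n)} \<le> C / 2 ^ e n) \<longrightarrow>
        tnorm \<theta> w (blocks M A) \<le> s * C \<and>
        (\<forall>d g p. functional_family \<theta> d g p \<longrightarrow> d \<le> D \<longrightarrow>
           (\<Sum>l<d. pairing (g l) w (blocks M A)) \<le> s * t * C))"

lemma blocks_UN: "blocks M (\<Union>i\<in>I. A i) = (\<Union>i\<in>I. blocks M (A i))"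
  unfolding blocks_def by blast

lemma finite_blocks: "finite A \<Longrightarrow> finite (blocks M A)"
  unfolding blocks_def by auto

lemma blocks_subset_interval:
  assumes "strict_mono M" "A \<subseteq> {n..<m}"
  shows "blocks M A \<subseteq> {M n..<M m}"
proof
  fix k assume "k \<in> blocks M A"
  then obtain i where i: "n \<le> i" "Suc i \<le> m" "M i \<le> k" "k < M (Suc i)"
    using assms(2) unfolding blocks_def by force
  show "k \<in> {M n..<M m}"
    using i strict_mono_less_eq[OF assms(1), of n i] strict_mono_less_eq[OF assms(1), of "Suc i" m]
    by simp
qed

text \<open>
  Call \<open>i\<close> exceptional if the interval of \<open>A i\<close> is the first one that some \<open>g l\<close> meets.  There are at most
  \<open>d\<close> exceptional indices, and for these only the bound \<open>v\<close> is used.  For any other \<open>i\<close> at most one \<open>g l\<close>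
  meets the interval of \<open>A i\<close>: of two, the one with the later support would have met an earlier interval,
  so the other one would end before the interval of \<open>A i\<close>.  This \<open>g l\<close> has already met an earlier
  interval.  Hence it is not a unit vector but \<open>\<theta>\<close> times the sum of an admissible family, and the number of members of the family is
  bounded by the first point of its support and so by \<open>R i\<close>.  As \<open>A i\<close> was chosen to be good for
  families of that length, a factor \<open>\<theta>\<close> is gained.
\<close>
lemma (in tsirelson) family_on_averages:
  fixes r d D :: nat
  assumes fam: "functional_family \<theta> d g p" and R: "mono R"
    and A: "\<And>i. i < r \<Longrightarrow> finite (A i) \<and> A i \<subseteq> {R i..<R (Suc i)}"
    and v: "\<And>i d g p. i < r \<Longrightarrow> functional_family \<theta> d g p \<Longrightarrow> d \<le> max D (R i) \<Longrightarrow>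
              (\<Sum>l<d. pairing (g l) w (A i)) \<le> v"
    and v0: "0 \<le> v" and d: "d \<le> D"
  shows "(\<Sum>l<d. pairing (g l) w (\<Union>i<r. A i)) \<le> (d + \<theta> * r) * v"
proof -
  have g: "g l \<in> norming_set \<theta>" if "l < d" for l
    using fam that unfolding functional_family_def by blast
  have supp: "p l \<le> k" "k < p (Suc l)" if "l < d" "g l k \<noteq> 0" for l k
    using fam that unfolding functional_family_def by blast+
  have pmono: "p l \<le> p l'" if "l \<le> l'" "l' \<le> d" for l l'
    using that
  proof (induction l' rule: dec_induct)
    case (step n)
    then have "p n \<le> p (Suc n)" using fam unfolding functional_family_def by simp
    then show ?case using step by simp
  qed simp
  define meets where "meets l i \<longleftrightarrow> (\<exists>k\<in>{R i..<R (Suc i)}. g l k \<noteq> 0)" for l i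
  \<comment> \<open>the exceptional indices; a \<open>g l\<close> that meets no interval only adds a harmless index\<close>
  define X where "X = (\<lambda>l. LEAST i. meets l i) ` {..<d}"
  have X: "finite X" "card X \<le> d" unfolding X_def using card_image_le[of "{..<d}"] by auto
  define T where "T i = (\<Sum>l<d. pairing (g l) w (A i))" for i
  have zero: "pairing (g l) w (A i) = 0" if "i < r" "\<not> meets l i" for l i
    by (rule pairing_eq_0) (use A[OF that(1)] that(2) meets_def in blast)
  have T1: "T i \<le> v" if "i < r" for i
    unfolding T_def by (rule v[OF that fam]) (use d in simp)
  have T2: "T i \<le> \<theta> * v" if i: "i < r" "i \<notin> X" for i
  proof (cases "\<exists>l<d. meets l i")
    case False
    then have "T i = 0" unfolding T_def using zero[OF i(1)] by (intro sum.neutral) auto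
    then show ?thesis using v0 theta_pos by simp
  next
    case True
    then obtain l where l: "l < d" "meets l i" by blast
    have earlier: "\<exists>k<R i. g l' k \<noteq> 0" if l': "l' < d" "meets l' i" for l'
    proof -
      define m where "m = (LEAST i. meets l' i)"
      have "m \<in> X" using l' unfolding X_def m_def by blast
      moreover have "m \<le> i" using l'(2) unfolding m_def by (rule Least_le)
      ultimately have "m < i" using i(2) by (metis le_neq_implies_less)
      then have "R (Suc m) \<le> R i" using R by (simp add: monoD)
      moreover have "meets l' m" using l'(2) unfolding m_def by (rule LeastI)
      ultimately show ?thesis unfolding meets_def by (meson atLeastLessThan_iff less_le_trans)
    qed
    have only: "l1 = l2" if "l1 < d" "meets l1 i" "l2 < d" "meets l2 i" for l1 l2
    proof -
      have "\<not> l1 < l2" if l: "l1 < d" "meets l1 i" "l2 < d" "meets l2 i" for l1 l2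
      proof
        assume less: "l1 < l2"
        obtain k where k: "k < R i" "g l2 k \<noteq> 0" using earlier l by blast
        obtain k' where k': "R i \<le> k'" "g l1 k' \<noteq> 0" using l unfolding meets_def by auto
        have "p l2 \<le> k" "k' < p (Suc l1)" using supp k k' l by blast+
        then show False using pmono[of "Suc l1" l2] less l k k' by linarith
      qed
      then show ?thesis using that by (meson linorder_neqE_nat)
    qed
    have "T i = (\<Sum>l'<d. if l' = l then pairing (g l) w (A i) else 0)"
      unfolding T_def using only l zero[OF i(1)] by (intro sum.cong) auto
    then have Ti: "T i = pairing (g l) w (A i)" using l by simp
    obtain k where k: "k < R i" "g l k \<noteq> 0" using earlier l by blast
    obtain k' where k': "R i \<le> k'" "g l k' \<noteq> 0" using l unfolding meets_def by auto
    from g[OF l(1)] show ?thesis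
    proof cases
      case (unit n)
      then show ?thesis using k k' by (auto split: if_splits)
    next
      case (node d' g' p')
      have fam': "functional_family \<theta> d' g' p'"
        unfolding functional_family_def using node by blast
      have pm': "p' 0 \<le> p' m" if "m < d'" for m
        using that
      proof (induction m)
        case (Suc m)
        then show ?case using node(4) by (meson Suc_lessD le_trans)
      qed simp
      have "\<exists>m<d'. g' m k \<noteq> 0"
        using k(2) node(1) by (auto intro: ccontr simp: sum.neutral)
      then have "p' 0 \<le> k" using node pm' by (meson le_trans)
      then have "d' \<le> max D (R i)" using node k(1) by simp
      then have "(\<Sum>m<d'. pairing (g' m) w (A i)) \<le> v" by (rule v[OF i(1) fam'])
      then show ?thesis
        unfolding Ti node(1) pairing_node using theta_pos by simp
    qed
  qed
  have "(\<Sum>l<d. pairing (g l) w (\<Union>i<r. A i)) \<le> (\<Sum>l<d. \<Sum>i<r. pairing (g l) w (A i))"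
    using A g by (intro sum_mono pairing_UN_le) auto
  also have "\<dots> = (\<Sum>i<r. T i)" unfolding T_def by (rule sum.swap)
  also have "\<dots> \<le> (\<Sum>i<r. (if i \<in> X then v else 0) + \<theta> * v)"
    using T1 T2 v0 theta_pos by (intro sum_mono) (auto simp: add_increasing2)
  also have "\<dots> = card ({..<r} \<inter> X) * v + r * (\<theta> * v)"
    by (simp add: sum.distrib sum.If_cases)
  also have "\<dots> \<le> d * v + r * (\<theta> * v)"
    using X card_mono[OF X(1), of "{..<r} \<inter> X"] v0 by (intro add_right_mono mult_right_mono) auto
  finally show ?thesis by (simp add: algebra_simps)
qed

text \<open>
  Induction on the number of averagings.  A single block is good for every family, with the constant
  \<open>1 / b\<close>.  For the induction step an average of \<open>r = 2\<^sup>\<rho>\<close> successive copies is taken, where \<open>r\<close> is so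
  large that the at most \<open>D\<close> exceptional copies of \<open>family_on_averages\<close> do not matter, and where each copy
  is good for families as long as the beginning of its support.  The lower estimate survives because the
  first copy is placed beyond \<open>r\<close>.

  \<open>Nf\<close> lets a user demand that an index be large in terms of its weight.  This is possible since the
  weight of an index is known before the index is chosen.
\<close>
lemma special_averages:
  assumes a: "tsirelson a" and b: "tsirelson b" and M: "strict_mono M"
    and "0 < \<epsilon>" "j = 0 \<longrightarrow> \<kappa> \<le> e0"
  shows "\<exists>A e. finite A \<and> A \<noteq> {} \<and> (\<forall>n\<in>A. R \<le> n \<and> \<kappa> \<le> e n \<and> Nf (e n) \<le> n) \<and>
    lower_average a M (a ^ j / 2 ^ e0) A e \<and>
    upper_average b M D (1 / 2 ^ e0) (b ^ j / b + \<epsilon>) A e"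
  using assms(4,5)
proof (induction j arbitrary: e0 D R \<epsilon>)
  case 0
  interpret a: tsirelson a by (rule a)
  interpret b: tsirelson b by (rule b)
  define n where "n = max R (Nf e0)"
  have "lower_average a M (a ^ 0 / 2 ^ e0) {n} (\<lambda>_. e0)"
    unfolding lower_average_def blocks_def by simp
  moreover have "upper_average b M D (1 / 2 ^ e0) (b ^ 0 / b + \<epsilon>) {n} (\<lambda>_. e0)"
    unfolding upper_average_def
  proof (intro allI impI conjI)
    fix w C assume C: "0 \<le> C" and *: "\<forall>n\<in>{n}. tnorm b w {M n..<M (Suc n)} \<le> C / 2 ^ e0"
    then show le: "tnorm b w (blocks M {n}) \<le> 1 / 2 ^ e0 * C" unfolding blocks_def by simp
    fix d g p assume "functional_family b d g p"
    then have "(\<Sum>l<d. pairing (g l) w (blocks M {n})) \<le> tnorm b w (blocks M {n}) / b"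
      unfolding functional_family_def by (intro b.pairing_family_le[where p=p]) blast+
    also have "\<dots> \<le> (1 / 2 ^ e0 * C) / b"
      using le b.theta_pos by (intro divide_right_mono) auto
    also have "\<dots> \<le> 1 / 2 ^ e0 * (b ^ 0 / b + \<epsilon>) * C"
    proof -
      have "1 / 2 ^ e0 * C * (1 / b) \<le> 1 / 2 ^ e0 * C * (1 / b + \<epsilon>)"
        using C \<open>0 < \<epsilon>\<close> by (intro mult_left_mono) auto
      then show ?thesis by (simp add: mult_ac)
    qed
    finally show "(\<Sum>l<d. pairing (g l) w (blocks M {n})) \<le> 1 / 2 ^ e0 * (b ^ 0 / b + \<epsilon>) * C" .
  qed
  ultimately show ?case
    using 0 by (intro exI[of _ "{n}"] exI[of _ "\<lambda>_. e0"]) (simp add: n_def)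
next
  case (Suc j)
  interpret a: tsirelson a by (rule a)
  interpret b: tsirelson b by (rule b)
  define t where "t = b ^ j / b + \<epsilon> / 2"
  have t: "0 < t" unfolding t_def using b.theta_pos Suc.prems by (simp add: add_pos_pos)
  \<comment> \<open>this makes the share \<open>D / r\<close> of the exceptional copies, times \<open>t\<close>, at most \<open>\<epsilon> / 2\<close>\<close>
  obtain \<rho>0 where \<rho>0: "2 * D * t / \<epsilon> < 2 ^ \<rho>0"
    using real_arch_pow[of 2 "2 * D * t / \<epsilon>"] by auto
  define \<rho> where "\<rho> = max \<kappa> \<rho>0"
  define r :: nat where "r = 2 ^ \<rho>"
  have "(2::real) ^ \<rho>0 \<le> 2 ^ \<rho>" unfolding \<rho>_def by (intro power_increasing) auto
  from less_le_trans[OF \<rho>0 this] have "2 * D * t / \<epsilon> \<le> r" unfolding r_def by (simp add: less_imp_le)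
  then have r: "D * t \<le> \<epsilon> / 2 * r"
    using Suc.prems by (simp add: field_simps)
  have pw: "real r * (1 / 2 ^ (e0 + \<rho>)) = 1 / 2 ^ e0"
    unfolding r_def by (simp add: power_add)
  define good where "good D R Ae \<longleftrightarrow> (case Ae of (A, e) \<Rightarrow>
    finite A \<and> A \<noteq> {} \<and> (\<forall>n\<in>A. R \<le> n \<and> \<kappa> \<le> e n \<and> Nf (e n) \<le> n) \<and>
    lower_average a M (a ^ j / 2 ^ (e0 + \<rho>)) A e \<and>
    upper_average b M D (1 / 2 ^ (e0 + \<rho>)) t A e)" for D R Ae
  have "\<exists>Ae. good D R Ae" for D R
    unfolding good_def t_def split_paired_Ex prod.case
    by (rule Suc.IH) (use Suc.prems in \<open>auto simp: \<rho>_def\<close>)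
  then obtain F where F: "\<And>D R. good D R (F D R)" by metis
  define Af where "Af D R = fst (F D R)" for D R
  define ef where "ef D R = snd (F D R)" for D R
  have IH: "finite (Af D R)" "Af D R \<noteq> {}"
      "\<And>n. n \<in> Af D R \<Longrightarrow> R \<le> n \<and> \<kappa> \<le> ef D R n \<and> Nf (ef D R n) \<le> n"
      "lower_average a M (a ^ j / 2 ^ (e0 + \<rho>)) (Af D R) (ef D R)"
      "upper_average b M D (1 / 2 ^ (e0 + \<rho>)) t (Af D R) (ef D R)" for D R
    using F[of D R] unfolding good_def Af_def ef_def case_prod_unfold by blast+
  \<comment> \<open>the \<open>i\<close>-th copy lies in the blocks from \<open>Rs i\<close> on, before \<open>Rs (Suc i)\<close>, and is good for families of length \<open>M (Rs i)\<close>\<close>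
  define Dm where "Dm n = max D (M n)" for n
  define Rs where "Rs = rec_nat (max R r) (\<lambda>_ n. Suc (Max (Af (Dm n) n)))"
  have Rs: "Rs 0 = max R r" "\<And>i. Rs (Suc i) = Suc (Max (Af (Dm (Rs i)) (Rs i)))"
    unfolding Rs_def by simp_all
  define A where "A i = Af (Dm (Rs i)) (Rs i)" for i
  define E where "E i = ef (Dm (Rs i)) (Rs i)" for i
  have low: "lower_average a M (a ^ j / 2 ^ (e0 + \<rho>)) (A i) (E i)"
    and up: "upper_average b M (Dm (Rs i)) (1 / 2 ^ (e0 + \<rho>)) t (A i) (E i)" for i
    unfolding A_def E_def by (rule IH)+
  have finA: "finite (A i)" and neA: "A i \<noteq> {}" for i unfolding A_def using IH by auto
  have An: "Rs i \<le> n" "n < Rs (Suc i)" if "n \<in> A i" for i n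
    using that IH(3) Rs(2) Max_ge[OF finA] unfolding A_def by (auto simp: less_Suc_eq_le)
  have Rs_less: "Rs i < Rs (Suc i)" for i using neA An by (meson all_not_in_conv le_less_trans)
  then have Rs_sm: "strict_mono Rs" by (rule strict_mono_Suc_iff[THEN iffD2, rule_format])
  define idx where "idx n = (LEAST i. n < Rs (Suc i))" for n
  have idx: "idx n = i" if "n \<in> A i" for i n
    unfolding idx_def using An[OF that] by (rule Least_interval_index[OF Rs_sm])
  define e where "e n = E (idx n) n" for n
  have eE: "e n = E i n" if "n \<in> A i" for i n unfolding e_def idx[OF that] ..
  let ?A = "\<Union>i<r. A i"
  have bl: "blocks M ?A = (\<Union>i<r. blocks M (A i))" by (rule blocks_UN)
  have bsub: "blocks M (A i) \<subseteq> {M (Rs i)..<M (Rs (Suc i))}" for i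
    by (rule blocks_subset_interval[OF M]) (use An in auto)
  have lower: "lower_average a M (a ^ Suc j / 2 ^ e0) ?A e"
    unfolding lower_average_def
  proof (intro allI impI)
    fix w and \<delta> :: real assume d: "0 \<le> \<delta>" and w: "\<forall>n\<in>?A. \<delta> / 2 ^ e n \<le> tnorm a w {M n..<M (Suc n)}"
    have "a ^ j / 2 ^ (e0 + \<rho>) * \<delta> \<le> tnorm a w (blocks M (A i))" if "i < r" for i
      using low[of i] d w eE that unfolding lower_average_def by auto
    then have "(\<Sum>i<r. a ^ j / 2 ^ (e0 + \<rho>) * \<delta>) \<le> (\<Sum>i<r. tnorm a w (blocks M (A i)))"
      by (intro sum_mono) auto
    also have "(\<Sum>i<r. a ^ j / 2 ^ (e0 + \<rho>) * \<delta>) = a ^ j * \<delta> * (real r * (1 / 2 ^ (e0 + \<rho>)))" by simp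
    also have "\<dots> = a ^ j * \<delta> / 2 ^ e0" unfolding pw by simp
    finally have "a * (a ^ j * \<delta> / 2 ^ e0) \<le> a * (\<Sum>i<r. tnorm a w (blocks M (A i)))"
      using a.theta_pos by (intro mult_left_mono) auto
    also have "\<dots> \<le> tnorm a w (\<Union>i<r. blocks M (A i))"
    proof (rule a.tnorm_lower[where p="\<lambda>i. M (Rs i)"])
      show "\<forall>i<r. M (Rs i) \<le> M (Rs (Suc i))"
        using Rs_less strict_mono_less_eq[OF M] by (auto simp: less_imp_le)
      show "r \<le> M (Rs 0)" using strict_mono_imp_increasing[OF M, of "Rs 0"] Rs(1) by simp
    qed (rule bsub)
    finally show "a ^ Suc j / 2 ^ e0 * \<delta> \<le> tnorm a w (blocks M ?A)" unfolding bl by simp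
  qed
  have upper: "upper_average b M D (1 / 2 ^ e0) (b ^ Suc j / b + \<epsilon>) ?A e"
    unfolding upper_average_def
  proof (intro allI impI)
    fix w C assume C: "0 \<le> C" and w: "\<forall>n\<in>?A. tnorm b w {M n..<M (Suc n)} \<le> C / 2 ^ e n"
    have *: "tnorm b w (blocks M (A i)) \<le> 1 / 2 ^ (e0 + \<rho>) * C \<and>
       (\<forall>d g p. functional_family b d g p \<longrightarrow> d \<le> max D (M (Rs i)) \<longrightarrow>
           (\<Sum>l<d. pairing (g l) w (blocks M (A i))) \<le> 1 / 2 ^ (e0 + \<rho>) * t * C)" if i: "i < r" for i
    proof -
      have "\<forall>n\<in>A i. tnorm b w {M n..<M (Suc n)} \<le> C / 2 ^ E i n" using w eE i by auto
      then show ?thesis using up[of i] C unfolding upper_average_def Dm_def by blast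
    qed
    have "tnorm b w (blocks M ?A) \<le> (\<Sum>i<r. tnorm b w (blocks M (A i)))"
      unfolding bl by (rule b.tnorm_UN) (auto intro: finite_blocks finA)
    also have "\<dots> \<le> (\<Sum>i<r. 1 / 2 ^ (e0 + \<rho>) * C)" using * by (intro sum_mono) auto
    also have "\<dots> = (real r * (1 / 2 ^ (e0 + \<rho>))) * C" by simp
    finally have 1: "tnorm b w (blocks M ?A) \<le> 1 / 2 ^ e0 * C" unfolding pw .
    have 2: "(\<Sum>l<d. pairing (g l) w (blocks M ?A)) \<le> 1 / 2 ^ e0 * (b ^ Suc j / b + \<epsilon>) * C"
      if fam: "functional_family b d g p" and d: "d \<le> D" for d g p
    proof -
      let ?v = "1 / 2 ^ (e0 + \<rho>) * t * C"
      have v0: "0 \<le> ?v" using t C by simp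
      have "(\<Sum>l<d. pairing (g l) w (\<Union>i<r. blocks M (A i))) \<le> (d + b * r) * ?v"
      proof (rule b.family_on_averages[OF fam, where R="\<lambda>i. M (Rs i)"])
        show "mono (\<lambda>i. M (Rs i))"
          using strict_mono_mono[OF strict_mono_o[OF M Rs_sm]] by (simp add: comp_def)
        show "finite (blocks M (A i)) \<and> blocks M (A i) \<subseteq> {M (Rs i)..<M (Rs (Suc i))}" for i
          using bsub finite_blocks finA by blast
      qed (use * v0 d in auto)
      also have "\<dots> \<le> (D + b * r) * ?v" using d v0 by (intro mult_right_mono) auto
      also have "\<dots> = (D * t + b * r * t) * (C / 2 ^ (e0 + \<rho>))" by (simp add: algebra_simps add_divide_distrib)
      also have "\<dots> \<le> (\<epsilon> / 2 * r + b * r * t) * (C / 2 ^ (e0 + \<rho>))"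
        using r C by (intro mult_right_mono) auto
      also have "\<dots> = (\<epsilon> / 2 + b * t) * C * (real r * (1 / 2 ^ (e0 + \<rho>)))" by (simp add: algebra_simps add_divide_distrib)
      also have "\<dots> = (\<epsilon> / 2 + b * t) * C * (1 / 2 ^ e0)" unfolding pw ..
      also have "\<dots> \<le> (b ^ Suc j / b + \<epsilon>) * C * (1 / 2 ^ e0)"
      proof (intro mult_right_mono)
        have "b * (\<epsilon> / 2) \<le> \<epsilon> / 2" using b.theta_le Suc.prems by simp
        then show "\<epsilon> / 2 + b * t \<le> b ^ Suc j / b + \<epsilon>"
          unfolding t_def by (simp add: distrib_left)
      qed (use C in auto)
      finally show ?thesis unfolding bl by (simp add: mult_ac)
    qed
    show "tnorm b w (blocks M ?A) \<le> 1 / 2 ^ e0 * C \<and>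
        (\<forall>d g p. functional_family b d g p \<longrightarrow> d \<le> D \<longrightarrow>
           (\<Sum>l<d. pairing (g l) w (blocks M ?A)) \<le> 1 / 2 ^ e0 * (b ^ Suc j / b + \<epsilon>) * C)"
      using 1 2 by blast
  qed
  have "R \<le> n \<and> \<kappa> \<le> e n \<and> Nf (e n) \<le> n" if n: "n \<in> ?A" for n
  proof -
    obtain i where i: "n \<in> A i" using n by blast
    have "Rs 0 \<le> Rs i" using strict_mono_less_eq[OF Rs_sm] by simp
    then show ?thesis using i IH(3)[of n "Dm (Rs i)" "Rs i"] eE[OF i] Rs(1)
      unfolding A_def E_def by simp
  qed
  moreover have "?A \<noteq> {}" using neA[of 0] unfolding r_def by (auto intro!: bexI[of _ 0])
  moreover have "finite ?A" using finA by blast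
  ultimately show ?case using lower upper by (intro exI[of _ ?A] exI[of _ e]) blast
qed

text \<open>
  The case of total weight 1, with the upper estimate specialised to a single functional.
\<close>
lemma special_average_exists:
  assumes a: "tsirelson a" and b: "tsirelson b" and M: "strict_mono M" and "0 < j"
  shows "\<exists>A e. finite A \<and> A \<noteq> {} \<and> (\<forall>n\<in>A. R \<le> n \<and> \<kappa> \<le> e n \<and> Nf (e n) \<le> n) \<and>
    lower_average a M (a ^ j) A e \<and>
    (\<forall>w C. 0 \<le> C \<longrightarrow> (\<forall>n\<in>A. tnorm b w {M n..<M (Suc n)} \<le> C / 2 ^ e n) \<longrightarrow>
      tnorm b w (blocks M A) \<le> 2 * b ^ j / b * C)"
proof -
  interpret b: tsirelson b by (rule b)
  have eps: "0 < b ^ j / b" using b.theta_pos by simp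
  obtain A e where A: "finite A" "A \<noteq> {}" "\<forall>n\<in>A. max 1 R \<le> n \<and> \<kappa> \<le> e n \<and> Nf (e n) \<le> n"
    "lower_average a M (a ^ j / 2 ^ 0) A e"
    "upper_average b M 1 (1 / 2 ^ 0) (b ^ j / b + b ^ j / b) A e"
    using special_averages[OF a b M eps, of j \<kappa> 0 "max 1 R" Nf 1] \<open>0 < j\<close> by blast
  have "tnorm b w (blocks M A) \<le> 2 * b ^ j / b * C"
    if C: "0 \<le> C" and w: "\<forall>n\<in>A. tnorm b w {M n..<M (Suc n)} \<le> C / 2 ^ e n" for w C
  proof (rule b.tnorm_least)
    fix f assume f: "f \<in> norming_set b"
    have fin: "finite (blocks M A)" by (rule finite_blocks[OF A(1)])
    have ge1: "1 \<le> k" if "k \<in> blocks M A" for k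
      using that A(3) strict_mono_imp_increasing[OF M] unfolding blocks_def by (fastforce intro: order_trans)
    define g where "g = (\<lambda>k. if k \<in> blocks M A then f k else 0)"
    have fam: "functional_family b 1 (\<lambda>_. g) (\<lambda>i. if i = 0 then 1 else Suc (Max (blocks M A)))"
      unfolding functional_family_def
      using b.functional_restrict[OF f, of "blocks M A"] ge1 Max_ge[OF fin]
      by (auto simp: g_def less_Suc_eq_le split: if_splits)
    have "\<forall>d g p. functional_family b d g p \<longrightarrow> d \<le> 1 \<longrightarrow>
        (\<Sum>l<d. pairing (g l) w (blocks M A)) \<le> 1 / 2 ^ 0 * (b ^ j / b + b ^ j / b) * C"
      using A(5) C w unfolding upper_average_def by blast
    from this[rule_format, OF fam]
    have "pairing g w (blocks M A) \<le> 1 / 2 ^ 0 * (b ^ j / b + b ^ j / b) * C" by simp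
    moreover have "pairing g w (blocks M A) = pairing f w (blocks M A)"
      unfolding g_def pairing_def by simp
    ultimately show "pairing f w (blocks M A) \<le> 2 * b ^ j / b * C" by (simp add: algebra_simps)
  qed
  then show ?thesis using A(1-4) by (intro exI[of _ A] exI[of _ e]) auto
qed

section \<open>Gliding humps\<close>

text \<open>
  The element \<open>a\<close> of the grid stands for the sequence of dyadic rationals \<open>a n / 2 ^ n\<close> in the unit
  interval.
\<close>
definition grid :: "(nat \<Rightarrow> nat) set" where
  "grid = {a. \<forall>n. a n \<le> 2 ^ n}"

text \<open>
  The properties shared by the two ways in which the distance of \<open>a\<close> and \<open>b\<close> on an interval of indices
  is measured: in the source space, and in the target space through a coordinatewise map.
\<close>
definition interval_gauge :: "((nat \<Rightarrow> nat) \<Rightarrow> (nat \<Rightarrow> nat) \<Rightarrow> nat \<Rightarrow> nat \<Rightarrow> real) \<Rightarrow> bool" where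
  "interval_gauge p \<longleftrightarrow>
     (\<forall>a b a' b' n m. (\<forall>i\<in>{n..<m}. a i = a' i \<and> b i = b' i) \<longrightarrow> p a b n m = p a' b' n m) \<and>
     (\<forall>a b n n' m' m. n \<le> n' \<longrightarrow> m' \<le> m \<longrightarrow> p a b n' m' \<le> p a b n m) \<and>
     (\<forall>a b n m r. n \<le> m \<longrightarrow> m \<le> r \<longrightarrow> p a b n r \<le> p a b n m + p a b m r) \<and>
     (\<forall>a b n m. (\<forall>i\<in>{n..<m}. a i = b i) \<longrightarrow> p a b n m = 0)"

definition gauge_vanishes ::
    "((nat \<Rightarrow> nat) \<Rightarrow> (nat \<Rightarrow> nat) \<Rightarrow> nat \<Rightarrow> nat \<Rightarrow> real) \<Rightarrow> (nat \<Rightarrow> nat) \<Rightarrow> (nat \<Rightarrow> nat) \<Rightarrow> bool" where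
  "gauge_vanishes p a b \<longleftrightarrow> (\<forall>\<epsilon>>0. \<exists>n. \<forall>m. p a b n m \<le> \<epsilon>)"

lemma interval_gaugeD:
  assumes "interval_gauge p"
  shows "\<And>a b a' b' n m. (\<And>i. n \<le> i \<Longrightarrow> i < m \<Longrightarrow> a i = a' i \<and> b i = b' i) \<Longrightarrow> p a b n m = p a' b' n m"
    and "\<And>a b n n' m' m. n \<le> n' \<Longrightarrow> m' \<le> m \<Longrightarrow> p a b n' m' \<le> p a b n m"
    and "\<And>a b n m r. n \<le> m \<Longrightarrow> m \<le> r \<Longrightarrow> p a b n r \<le> p a b n m + p a b m r"
    and "\<And>a b n m. (\<And>i. n \<le> i \<Longrightarrow> i < m \<Longrightarrow> a i = b i) \<Longrightarrow> p a b n m = 0"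
  using assms unfolding interval_gauge_def by (simp_all add: Ball_def)

text \<open>
  If the conclusion fails, there are pairs, living on intervals further and further out, whose
  \<open>p\<close>-distances are summable while their \<open>q\<close>-distances exceed 1.  Gluing all of them together gives a
  single pair that violates the hypothesis.
\<close>
lemma gliding_hump:
  assumes p: "interval_gauge p" and q: "interval_gauge q"
    and imp: "\<And>a b. a \<in> grid \<Longrightarrow> b \<in> grid \<Longrightarrow> gauge_vanishes p a b \<Longrightarrow> gauge_vanishes q a b"
  shows "\<exists>\<delta>>0. \<exists>N. \<forall>a\<in>grid. \<forall>b\<in>grid. \<forall>n m. N \<le> n \<longrightarrow> p a b n m < \<delta> \<longrightarrow> q a b n m \<le> 1"
proof (rule ccontr)
  assume no: "\<not> ?thesis"
  have neg: "\<exists>a b n m. a \<in> grid \<and> b \<in> grid \<and> N \<le> n \<and> p a b n m < \<delta> \<and> 1 < q a b n m"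
    if d: "0 < \<delta>" for \<delta> N
  proof (rule ccontr)
    assume "\<not> ?thesis"
    then have "\<forall>a\<in>grid. \<forall>b\<in>grid. \<forall>n m. N \<le> n \<longrightarrow> p a b n m < \<delta> \<longrightarrow> q a b n m \<le> 1"
      by (meson not_le_imp_less)
    then show False using no d by metis
  qed
  define wit where "wit k N w \<longleftrightarrow> (case w of (a, b, n, m) \<Rightarrow>
     a \<in> grid \<and> b \<in> grid \<and> N \<le> n \<and> p a b n m < (1/2) ^ k \<and> 1 < q a b n m)" for k N :: nat and w
  have "\<exists>w. wit k N w" for k N
    unfolding wit_def split_paired_Ex prod.case by (rule neg) simp
  then obtain W where W: "\<And>k N. wit k N (W k N)" by metis
  define fa where "fa k N = fst (W k N)" for k N
  define fb where "fb k N = fst (snd (W k N))" for k N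
  define fn where "fn k N = fst (snd (snd (W k N)))" for k N
  define fm where "fm k N = snd (snd (snd (W k N)))" for k N
  have F: "fa k N \<in> grid" "fb k N \<in> grid" "N \<le> fn k N"
    "p (fa k N) (fb k N) (fn k N) (fm k N) < (1/2) ^ k"
    "1 < q (fa k N) (fb k N) (fn k N) (fm k N)" for k N
    using W[of k N] unfolding wit_def fa_def fb_def fn_def fm_def case_prod_unfold by blast+
  have lt: "fn k N < fm k N" for k N
    using F(5)[of k N] interval_gaugeD(4)[OF q, of "fn k N" "fm k N"] by (cases "fn k N < fm k N") auto
  define s where "s = rec_nat 0 (\<lambda>k N. fm k N)"
  have s: "s (Suc k) = fm k (s k)" for k unfolding s_def by simp
  define A where "A k = fa k (s k)" for k
  define B where "B k = fb k (s k)" for k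
  define n where "n k = fn k (s k)" for k
  have AB: "A k \<in> grid" "B k \<in> grid" "s k \<le> n k" "n k < s (Suc k)"
    "p (A k) (B k) (n k) (s (Suc k)) < (1/2) ^ k" "1 < q (A k) (B k) (n k) (s (Suc k))" for k
    unfolding A_def B_def n_def s using F lt by auto
  have sm: "strict_mono s"
    by (rule strict_mono_Suc_iff[THEN iffD2]) (use AB(3,4) le_less_trans in blast)
  define idx where "idx i = (LEAST k. i < s (Suc k))" for i
  note idx = Least_interval_index[OF sm, folded idx_def]
  define a where "a i = (if n (idx i) \<le> i then A (idx i) i else 0)" for i
  define b where "b i = (if n (idx i) \<le> i then B (idx i) i else 0)" for i
  have grid: "a \<in> grid" "b \<in> grid"
    using AB(1,2) unfolding grid_def a_def b_def by auto
  have eqs: "a i = A k i \<and> b i = B k i" if "n k \<le> i" "i < s (Suc k)" for i k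
    using idx[of k i] that AB(3)[of k] unfolding a_def b_def by simp
  have eq0: "a i = b i" if "s k \<le> i" "i < n k" for i k
    using idx[of k i] that AB(4)[of k] unfolding a_def b_def by simp
  have step: "p a b (s k) (s (Suc k)) \<le> (1/2) ^ k" for k
  proof -
    have "p a b (s k) (s (Suc k)) \<le> p a b (s k) (n k) + p a b (n k) (s (Suc k))"
      using AB(3,4)[of k] by (intro interval_gaugeD(3)[OF p]) auto
    also have "p a b (s k) (n k) = 0" by (rule interval_gaugeD(4)[OF p eq0])
    also have "p a b (n k) (s (Suc k)) = p (A k) (B k) (n k) (s (Suc k))"
      by (rule interval_gaugeD(1)[OF p eqs])
    finally show ?thesis using AB(5)[of k] by simp
  qed
  have tail: "p a b (s k) (s (k + l)) \<le> 2 * (1/2) ^ k - 2 * (1/2) ^ (k + l)" for k l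
  proof (induction l)
    case 0
    show ?case using interval_gaugeD(4)[OF p, of "s k" "s k" a b] by simp
  next
    case (Suc l)
    have "p a b (s k) (s (k + Suc l)) \<le> p a b (s k) (s (k + l)) + p a b (s (k + l)) (s (Suc (k + l)))"
      using strict_mono_less_eq[OF sm] by (simp add: interval_gaugeD(3)[OF p])
    then show ?case using Suc step[of "k + l"] by simp
  qed
  have "gauge_vanishes p a b"
    unfolding gauge_vanishes_def
  proof (intro allI impI)
    fix \<epsilon> :: real assume e: "\<epsilon> > 0"
    obtain k where k: "(1/2::real) ^ k < \<epsilon> / 2"
      using real_arch_pow_inv[of "\<epsilon> / 2" "1/2"] e by auto
    have "p a b (s k) m \<le> \<epsilon>" for m
    proof -
      have "m \<le> s (k + m)"
        using strict_mono_imp_increasing[OF sm, of "k + m"] by simp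
      then have "p a b (s k) m \<le> p a b (s k) (s (k + m))"
        by (intro interval_gaugeD(2)[OF p]) auto
      also have "\<dots> \<le> 2 * (1/2) ^ k" using tail[of k m] zero_le_power[of "1/2::real" "k + m"] by linarith
      finally show ?thesis using k by simp
    qed
    then show "\<exists>n. \<forall>m. p a b n m \<le> \<epsilon>" by blast
  qed
  then have "gauge_vanishes q a b" by (rule imp[OF grid])
  then obtain M where M: "\<And>m. q a b M m \<le> 1/2"
    unfolding gauge_vanishes_def by (meson half_gt_zero zero_less_one)
  have "M \<le> n M" using strict_mono_imp_increasing[OF sm, of M] AB(3)[of M] by simp
  then have "q a b (n M) (s (Suc M)) \<le> 1/2"
    using interval_gaugeD(2)[OF q, of M "n M"] M[of "s (Suc M)"] by (meson order_refl order_trans)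
  moreover have "q a b (n M) (s (Suc M)) = q (A M) (B M) (n M) (s (Suc M))"
    by (rule interval_gaugeD(1)[OF q eqs])
  ultimately show False using AB(6)[of M] by simp
qed

text \<open>
  The maximum over all subintervals makes the norm monotone in the interval.  It replaces the norm of
  the space by one for which partial sums are contractions.
\<close>
definition max_section ::
    "('v::real_vector \<Rightarrow> real) \<Rightarrow> (nat \<Rightarrow> 'v) \<Rightarrow> (nat \<Rightarrow> real) \<Rightarrow> nat \<Rightarrow> nat \<Rightarrow> real" where
  "max_section N y d n m =
     Max (insert 0 ((\<lambda>(r, s). N (\<Sum>i\<in>{r..<s}. d i *\<^sub>R y i)) ` ({n..m} \<times> {n..m})))"

definition grid_diff :: "(nat \<Rightarrow> nat) \<Rightarrow> (nat \<Rightarrow> nat) \<Rightarrow> nat \<Rightarrow> real" where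
  "grid_diff a b i = (real (a i) - real (b i)) / 2 ^ i"

lemma max_section_finite:
  "finite (insert 0 ((\<lambda>(r, s). N (\<Sum>i\<in>{r..<s}. d i *\<^sub>R y i)) ` ({n..m} \<times> {n..m::nat})))"
  by auto

lemma max_section_ge:
  "n \<le> r \<Longrightarrow> r \<le> m \<Longrightarrow> n \<le> s \<Longrightarrow> s \<le> m \<Longrightarrow> N (\<Sum>i\<in>{r..<s}. d i *\<^sub>R y i) \<le> max_section N y d n m"
  unfolding max_section_def by (intro Max_ge max_section_finite) force

lemma max_section_nonneg: "0 \<le> max_section N y d n m"
  unfolding max_section_def by (intro Max_ge max_section_finite) simp

lemma max_section_le:
  assumes "0 \<le> c" "\<And>r s. n \<le> r \<Longrightarrow> r \<le> m \<Longrightarrow> n \<le> s \<Longrightarrow> s \<le> m \<Longrightarrow> N (\<Sum>i\<in>{r..<s}. d i *\<^sub>R y i) \<le> c"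
  shows "max_section N y d n m \<le> c"
  unfolding max_section_def using assms by (intro Max.boundedI max_section_finite) auto

lemma max_section_cong:
  assumes "\<And>i. n \<le> i \<Longrightarrow> i < m \<Longrightarrow> d i = d' i"
  shows "max_section N y d n m = max_section N y d' n m"
proof -
  have "(\<Sum>i\<in>{r..<s}. d i *\<^sub>R y i) = (\<Sum>i\<in>{r..<s}. d' i *\<^sub>R y i)" if "r \<in> {n..m}" "s \<in> {n..m}" for r s
    using that assms by (intro sum.cong) auto
  then show ?thesis unfolding max_section_def by (intro arg_cong[where f=Max] arg_cong[where f="insert 0"] image_cong) auto
qed

locale normed_sequence =
  fixes S :: "'v::real_vector set" and N :: "'v \<Rightarrow> real" and y :: "nat \<Rightarrow> 'v"
  assumes S: "subspace S" and N: "norm_on S N" and y: "\<And>i. y i \<in> S" and norm_y: "\<And>i. N (y i) = 2"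
begin

abbreviation source_gauge :: "(nat \<Rightarrow> nat) \<Rightarrow> (nat \<Rightarrow> nat) \<Rightarrow> nat \<Rightarrow> nat \<Rightarrow> real" where
  "source_gauge a b \<equiv> max_section N y (grid_diff a b)"

lemma section_in: "(\<Sum>i\<in>A. d i *\<^sub>R y i) \<in> S"
  using S y by (intro subspace_sum subspace_scale) auto

lemma norm_0: "N 0 = 0"
  using norm_onD(2)[OF N subspace_0[OF S]] by simp

lemma max_section_scale:
  assumes "0 \<le> c"
  shows "max_section N y (\<lambda>i. c * d i) n m \<le> c * max_section N y d n m"
proof (rule max_section_le)
  fix r s assume rs: "n \<le> r" "r \<le> m" "n \<le> s" "s \<le> m"
  have "N (\<Sum>i\<in>{r..<s}. (c * d i) *\<^sub>R y i) = N (c *\<^sub>R (\<Sum>i\<in>{r..<s}. d i *\<^sub>R y i))"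
    by (simp add: scaleR_right.sum)
  also have "\<dots> = \<bar>c\<bar> * N (\<Sum>i\<in>{r..<s}. d i *\<^sub>R y i)" by (rule norm_onD(3)[OF N section_in])
  also have "\<dots> \<le> c * max_section N y d n m"
    using assms max_section_ge[OF rs] by (simp add: mult_left_mono[OF max_section_ge[OF rs]])
  finally show "N (\<Sum>i\<in>{r..<s}. (c * d i) *\<^sub>R y i) \<le> c * max_section N y d n m" .
qed (intro mult_nonneg_nonneg assms max_section_nonneg)

lemma max_section_le_sum: "max_section N y d n m \<le> (\<Sum>i\<in>{n..<m}. 2 * \<bar>d i\<bar>)"
proof (rule max_section_le)
  fix r s assume rs: "n \<le> r" "r \<le> m" "n \<le> s" "s \<le> m"
  have "N (\<Sum>i\<in>{r..<s}. d i *\<^sub>R y i) \<le> (\<Sum>i\<in>{r..<s}. N (d i *\<^sub>R y i))"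
    using y S by (intro norm_on_sum_le[OF S N]) (auto intro: subspace_scale)
  also have "\<dots> = (\<Sum>i\<in>{r..<s}. 2 * \<bar>d i\<bar>)"
    using norm_onD(3)[OF N y] norm_y by (simp add: mult.commute)
  also have "\<dots> \<le> (\<Sum>i\<in>{n..<m}. 2 * \<bar>d i\<bar>)" using rs by (intro sum_mono2) auto
  finally show "N (\<Sum>i\<in>{r..<s}. d i *\<^sub>R y i) \<le> (\<Sum>i\<in>{n..<m}. 2 * \<bar>d i\<bar>)" .
qed (simp add: sum_nonneg)

lemma interval_gauge_max_section:
  "interval_gauge source_gauge"
  unfolding interval_gauge_def
proof (intro conjI allI impI)
  fix a b a' b' :: "nat \<Rightarrow> nat" and n m :: nat
  assume "\<forall>i\<in>{n..<m}. a i = a' i \<and> b i = b' i"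
  then show "source_gauge a b n m = source_gauge a' b' n m"
    by (intro max_section_cong) (auto simp: grid_diff_def)
next
  fix a b :: "nat \<Rightarrow> nat" and n n' m' m :: nat
  assume "n \<le> n'" "m' \<le> m"
  then show "source_gauge a b n' m' \<le> source_gauge a b n m"
    by (intro max_section_le max_section_nonneg max_section_ge) auto
next
  fix a b :: "nat \<Rightarrow> nat" and n m r :: nat
  assume nmr: "n \<le> m" "m \<le> r"
  let ?p = "source_gauge a b" and ?f = "\<lambda>i. grid_diff a b i *\<^sub>R y i"
  show "?p n r \<le> ?p n m + ?p m r"
  proof (rule max_section_le)
    fix t s assume ts: "n \<le> t" "t \<le> r" "n \<le> s" "s \<le> r"
    have nn: "0 \<le> ?p n m" "0 \<le> ?p m r" by (rule max_section_nonneg)+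
    consider "s \<le> t" | "s \<le> m" "t \<le> s" | "m \<le> t" "t \<le> s" | "t < m" "m < s" by linarith
    then show "N (\<Sum>i\<in>{t..<s}. ?f i) \<le> ?p n m + ?p m r"
    proof cases
      case 1
      then show ?thesis using norm_0 nn by simp
    next
      case 2
      then have "N (\<Sum>i\<in>{t..<s}. ?f i) \<le> ?p n m" using ts by (intro max_section_ge) auto
      then show ?thesis using nn by simp
    next
      case 3
      then have "N (\<Sum>i\<in>{t..<s}. ?f i) \<le> ?p m r" using ts by (intro max_section_ge) auto
      then show ?thesis using nn by simp
    next
      case 4
      then have "(\<Sum>i\<in>{t..<s}. ?f i) = (\<Sum>i\<in>{t..<m}. ?f i) + (\<Sum>i\<in>{m..<s}. ?f i)"
        by (intro sum.atLeastLessThan_concat[symmetric]) auto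
      then have "N (\<Sum>i\<in>{t..<s}. ?f i) \<le> N (\<Sum>i\<in>{t..<m}. ?f i) + N (\<Sum>i\<in>{m..<s}. ?f i)"
        using norm_onD(4)[OF N section_in section_in] by simp
      also have "\<dots> \<le> ?p n m + ?p m r" using 4 ts nmr by (intro add_mono max_section_ge) auto
      finally show ?thesis .
    qed
  qed (simp add: max_section_nonneg)
next
  fix a b :: "nat \<Rightarrow> nat" and n m :: nat
  assume "\<forall>i\<in>{n..<m}. a i = b i"
  then have "source_gauge a b n m = max_section N y (\<lambda>_. 0) n m"
    by (intro max_section_cong) (auto simp: grid_diff_def)
  also have "\<dots> = 0" using max_section_le_sum[of "\<lambda>_. 0" n m] max_section_nonneg[of N y "\<lambda>_. 0" n m] by simp
  finally show "source_gauge a b n m = 0" .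
qed

lemma gauge_vanishes_max_section:
  "gauge_vanishes source_gauge a b \<longleftrightarrow>
    (\<forall>\<epsilon>>0. \<exists>M. \<forall>n m. M \<le> n \<longrightarrow> n \<le> m \<longrightarrow> N (\<Sum>i\<in>{n..<m}. grid_diff a b i *\<^sub>R y i) \<le> \<epsilon>)"
proof -
  have "(\<forall>m. source_gauge a b M m \<le> \<epsilon>) \<longleftrightarrow>
     (\<forall>n m. M \<le> n \<longrightarrow> n \<le> m \<longrightarrow> N (\<Sum>i\<in>{n..<m}. grid_diff a b i *\<^sub>R y i) \<le> \<epsilon>)" if "\<epsilon> > 0" for M \<epsilon>
  proof (intro iffI allI impI)
    fix n m assume *: "\<forall>m. source_gauge a b M m \<le> \<epsilon>" "M \<le> n" "n \<le> m"
    have "N (\<Sum>i\<in>{n..<m}. grid_diff a b i *\<^sub>R y i) \<le> source_gauge a b M m"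
      using * by (intro max_section_ge) auto
    then show "N (\<Sum>i\<in>{n..<m}. grid_diff a b i *\<^sub>R y i) \<le> \<epsilon>" using * order_trans by blast
  next
    fix m assume *: "\<forall>n m. M \<le> n \<longrightarrow> n \<le> m \<longrightarrow> N (\<Sum>i\<in>{n..<m}. grid_diff a b i *\<^sub>R y i) \<le> \<epsilon>"
    show "source_gauge a b M m \<le> \<epsilon>"
    proof (rule max_section_le)
      fix r s assume "M \<le> r" "r \<le> m" "M \<le> s" "s \<le> m"
      then show "N (\<Sum>i\<in>{r..<s}. grid_diff a b i *\<^sub>R y i) \<le> \<epsilon>"
        using * norm_0 that by (cases "r \<le> s") auto
    qed (use that in simp)
  qed
  then show ?thesis unfolding gauge_vanishes_def by (simp cong: imp_cong)
qed

end

section \<open>Incompatibility of local reductions\<close>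

lemma block_index:
  fixes M :: "nat \<Rightarrow> nat"
  assumes M: "strict_mono M" and k: "M n \<le> k" "k < M m"
  shows "\<exists>j. n \<le> j \<and> j < m \<and> M j \<le> k \<and> k < M (Suc j)"
proof -
  define j where "j = (LEAST j. k < M (Suc j))"
  have "k < M (Suc m)" using k strict_mono_less[OF M, of m "Suc m"] by simp
  then have j1: "k < M (Suc j)" unfolding j_def by (rule LeastI)
  have j2: "M j \<le> k" if "0 < j"
  proof -
    have "\<not> k < M (Suc (j - 1))" using that unfolding j_def by (intro not_less_Least) simp
    then show ?thesis using that by simp
  qed
  have n: "n \<le> j"
  proof -
    have "M n < M (Suc j)" using k j1 by simp
    then show ?thesis using strict_mono_less[OF M] by simp
  qed
  have j3: "M j \<le> k" using j2 n k by (cases "j = 0") auto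
  then have "M j < M m" using k by simp
  then have "j < m" using strict_mono_less[OF M] by simp
  then show ?thesis using n j1 j3 by blast
qed

text \<open>
  A reduction of the relation of \<open>y\<close> to that of the Tsirelson space which acts coordinatewise: the
  \<open>j\<close>-th coordinate of the source determines the image on the \<open>j\<close>-th block.
\<close>
locale local_reduction = normed_sequence S N y + tsirelson \<theta>
  for S :: "'v::real_vector set" and N y and \<theta> :: real +
  fixes M :: "nat \<Rightarrow> nat" and h :: "(nat \<Rightarrow> nat) \<Rightarrow> nat \<Rightarrow> real"
  assumes M: "strict_mono M"
    and local: "\<And>a b j k. a j = b j \<Longrightarrow> M j \<le> k \<Longrightarrow> k < M (Suc j) \<Longrightarrow> h a k = h b k"
    and reduction: "\<And>a b. a \<in> grid \<Longrightarrow> b \<in> grid \<Longrightarrow>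
      gauge_vanishes source_gauge a b \<longleftrightarrow> conv (\<lambda>k. h a k - h b k)"
begin

definition image_gauge :: "(nat \<Rightarrow> nat) \<Rightarrow> (nat \<Rightarrow> nat) \<Rightarrow> nat \<Rightarrow> nat \<Rightarrow> real" where
  "image_gauge a b n m = tnorm \<theta> (\<lambda>k. h a k - h b k) {M n..<M m}"

lemma M_le: "n \<le> m \<Longrightarrow> M n \<le> M m"
  using strict_mono_less_eq[OF M] by simp

lemma local_interval:
  assumes "\<And>i. n \<le> i \<Longrightarrow> i < m \<Longrightarrow> a i = a' i" "k \<in> {M n..<M m}"
  shows "h a k = h a' k"
proof -
  obtain j where "n \<le> j" "j < m" "M j \<le> k" "k < M (Suc j)"
    using block_index[OF M, of n k m] assms(2) by auto
  then show ?thesis using assms(1) local by blast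
qed

lemma interval_gauge_image: "interval_gauge image_gauge"
  unfolding interval_gauge_def
proof (intro conjI allI impI)
  fix a b a' b' :: "nat \<Rightarrow> nat" and n m :: nat
  assume "\<forall>i\<in>{n..<m}. a i = a' i \<and> b i = b' i"
  then show "image_gauge a b n m = image_gauge a' b' n m"
    unfolding image_gauge_def using local_interval[of n m a a'] local_interval[of n m b b']
    by (intro tnorm_cong) auto
next
  fix a b :: "nat \<Rightarrow> nat" and n n' m' m :: nat
  assume "n \<le> n'" "m' \<le> m"
  then show "image_gauge a b n' m' \<le> image_gauge a b n m"
    unfolding image_gauge_def using M_le by (intro tnorm_mono) (auto intro: order_trans less_le_trans)
next
  fix a b :: "nat \<Rightarrow> nat" and n m r :: nat
  assume "n \<le> m" "m \<le> r"
  then have "{M n..<M r} = {M n..<M m} \<union> {M m..<M r}" using M_le by (simp add: ivl_disj_un)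
  then show "image_gauge a b n r \<le> image_gauge a b n m + image_gauge a b m r"
    unfolding image_gauge_def using tnorm_Un by simp
next
  fix a b :: "nat \<Rightarrow> nat" and n m :: nat
  assume "\<forall>i\<in>{n..<m}. a i = b i"
  then show "image_gauge a b n m = 0"
    unfolding image_gauge_def using local_interval[of n m a b] by (intro tnorm_zero) auto
qed

lemma gauge_vanishes_image: "gauge_vanishes image_gauge a b \<longleftrightarrow> conv (\<lambda>k. h a k - h b k)"
proof
  assume L: "gauge_vanishes image_gauge a b"
  show "conv (\<lambda>k. h a k - h b k)"
    unfolding conv_def
  proof (intro allI impI)
    fix \<epsilon> :: real assume "\<epsilon> > 0"
    then obtain n where n: "\<And>m. image_gauge a b n m \<le> \<epsilon>" using L unfolding gauge_vanishes_def by blast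
    have "tnorm \<theta> (\<lambda>k. h a k - h b k) {M n..<m} \<le> image_gauge a b n m" for m
      unfolding image_gauge_def using strict_mono_imp_increasing[OF M, of m]
      by (intro tnorm_mono) auto
    then show "\<exists>n. \<forall>m. tnorm \<theta> (\<lambda>k. h a k - h b k) {n..<m} \<le> \<epsilon>" using n order_trans by blast
  qed
next
  assume R: "conv (\<lambda>k. h a k - h b k)"
  show "gauge_vanishes image_gauge a b"
    unfolding gauge_vanishes_def
  proof (intro allI impI)
    fix \<epsilon> :: real assume "\<epsilon> > 0"
    then obtain n where n: "\<And>m. tnorm \<theta> (\<lambda>k. h a k - h b k) {n..<m} \<le> \<epsilon>"
      using R unfolding conv_def by blast
    have "image_gauge a b n m \<le> tnorm \<theta> (\<lambda>k. h a k - h b k) {n..<M m}" for m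
      unfolding image_gauge_def using strict_mono_imp_increasing[OF M, of n]
      by (intro tnorm_mono) auto
    then show "\<exists>n. \<forall>m. image_gauge a b n m \<le> \<epsilon>" using n order_trans by blast
  qed
qed

lemma small_image_small_source:
  "\<exists>\<delta>>0. \<exists>n0. \<forall>a\<in>grid. \<forall>b\<in>grid. \<forall>n m. n0 \<le> n \<longrightarrow>
     image_gauge a b n m < \<delta> \<longrightarrow> source_gauge a b n m \<le> 1"
  by (rule gliding_hump[OF interval_gauge_image interval_gauge_max_section])
    (simp add: reduction gauge_vanishes_image)

text \<open>
  By gliding humps a short vector of the source moves the image by at most 1.  A vector of length 2
  is the sum of \<open>2 ^ \<mu>\<close> equal short ones, and the divisibility hypothesis keeps the intermediate points
  on the grid.
\<close>
lemma bounded_source_bounded_image: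
  "\<exists>C>0. \<exists>\<mu> n0. \<forall>a\<in>grid. \<forall>b\<in>grid. \<forall>n m. n0 \<le> n \<longrightarrow>
     (\<forall>i. n \<le> i \<longrightarrow> i < m \<longrightarrow> (b i \<le> a i \<and> 2 ^ \<mu> dvd a i - b i)) \<longrightarrow>
     source_gauge a b n m \<le> 2 \<longrightarrow> image_gauge a b n m \<le> C"
proof -
  have "\<exists>\<delta>>0. \<exists>n0. \<forall>a\<in>grid. \<forall>b\<in>grid. \<forall>n m. n0 \<le> n \<longrightarrow>
     source_gauge a b n m < \<delta> \<longrightarrow> image_gauge a b n m \<le> 1"
    by (rule gliding_hump[OF interval_gauge_max_section interval_gauge_image])
      (simp add: reduction gauge_vanishes_image)
  then obtain \<delta> n0 where d: "\<delta> > 0" and small: "\<And>a b n m. a \<in> grid \<Longrightarrow> b \<in> grid \<Longrightarrow> n0 \<le> n \<Longrightarrow>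
     source_gauge a b n m < \<delta> \<Longrightarrow> image_gauge a b n m \<le> 1" by blast
  obtain \<mu> where mu: "(1/2::real) ^ \<mu> < \<delta> / 2"
    using real_arch_pow_inv[of "\<delta> / 2" "1/2"] d by auto
  have "image_gauge a b n m \<le> 2 ^ \<mu>"
    if a: "a \<in> grid" and b: "b \<in> grid" and n: "n0 \<le> n"
      and ba: "\<And>i. n \<le> i \<Longrightarrow> i < m \<Longrightarrow> b i \<le> a i \<and> 2 ^ \<mu> dvd a i - b i"
      and two: "source_gauge a b n m \<le> 2" for a b n m
  proof -
    define c where "c t i = b i + t * ((a i - b i) div 2 ^ \<mu>)" for t i
    have c_grid: "c t \<in> grid" if "t \<le> 2 ^ \<mu>" for t
      unfolding grid_def
    proof (intro CollectI allI)
      fix i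
      have "t * ((a i - b i) div 2 ^ \<mu>) \<le> 2 ^ \<mu> * ((a i - b i) div 2 ^ \<mu>)" using that by simp
      also have "\<dots> \<le> a i - b i" by simp
      finally have "c t i \<le> max (a i) (b i)" unfolding c_def by simp
      then show "c t i \<le> 2 ^ i" using a b unfolding grid_def by (simp add: le_max_iff_disj) (meson le_trans)
    qed
    have cdiff: "grid_diff (c (Suc t)) (c t) i = (1/2) ^ \<mu> * grid_diff a b i"
      if i: "n \<le> i" "i < m" for t i
    proof -
      obtain q where q: "a i - b i = 2 ^ \<mu> * q" using ba[OF i] by blast
      then have "real (a i) - real (b i) = 2 ^ \<mu> * real q"
        using ba[OF i] by (metis of_nat_diff of_nat_mult of_nat_numeral of_nat_power)
      then show ?thesis unfolding grid_diff_def c_def q by (simp add: power_one_over)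
    qed
    have step: "image_gauge (c (Suc t)) (c t) n m \<le> 1" if t: "t < 2 ^ \<mu>" for t
    proof (rule small[OF c_grid c_grid n])
      have "source_gauge (c (Suc t)) (c t) n m
          = max_section N y (\<lambda>i. (1/2) ^ \<mu> * grid_diff a b i) n m"
        by (rule max_section_cong) (rule cdiff)
      also have "\<dots> \<le> (1/2) ^ \<mu> * source_gauge a b n m"
        by (rule max_section_scale) simp
      also have "\<dots> \<le> (1/2) ^ \<mu> * 2" using two by (intro mult_left_mono) auto
      finally show "source_gauge (c (Suc t)) (c t) n m < \<delta>" using mu by simp
    qed (use t in auto)
    have sum: "image_gauge (c t) b n m \<le> t" if "t \<le> 2 ^ \<mu>" for t
      using that
    proof (induction t)
      case 0
      have "c 0 = b" unfolding c_def by simp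
      then show ?case using interval_gaugeD(4)[OF interval_gauge_image, of n m b b] by simp
    next
      case (Suc t)
      have "image_gauge (c (Suc t)) b n m \<le> image_gauge (c (Suc t)) (c t) n m + image_gauge (c t) b n m"
        unfolding image_gauge_def by (rule tnorm_triangle) auto
      then show ?case using step[of t] Suc by simp
    qed
    have "image_gauge a b n m = image_gauge (c (2 ^ \<mu>)) b n m"
    proof (rule interval_gaugeD(1)[OF interval_gauge_image])
      fix i assume "n \<le> i" "i < m"
      then show "a i = c (2 ^ \<mu>) i \<and> b i = b i" using ba[of i] unfolding c_def by simp
    qed
    then show ?thesis using sum[of "2 ^ \<mu>"] by simp
  qed
  then show ?thesis by (intro exI[of _ "2 ^ \<mu>"] conjI exI[of _ \<mu>] exI[of _ n0]) auto
qed

definition single :: "nat \<Rightarrow> nat \<Rightarrow> nat \<Rightarrow> nat" where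
  "single n v = (\<lambda>i. if i = n then v else 0)"

text \<open>
  The distance of two points on the curve that the \<open>n\<close>-th coordinate traces in the target.
\<close>
definition jump :: "nat \<Rightarrow> nat \<Rightarrow> nat \<Rightarrow> real" where
  "jump n u v = image_gauge (single n u) (single n v) n (Suc n)"

lemma image_gauge_block: "image_gauge a b n (Suc n) = jump n (a n) (b n)"
  unfolding jump_def by (rule interval_gaugeD(1)[OF interval_gauge_image]) (auto simp: single_def less_Suc_eq)

lemma single_grid: "v \<le> 2 ^ n \<Longrightarrow> single n v \<in> grid"
  unfolding single_def grid_def by auto

lemma jump_triangle: "jump n u w \<le> jump n u v + jump n v w"
  unfolding jump_def image_gauge_def by (rule tnorm_triangle) auto

text \<open>
  The step from 0 to 1 in one coordinate has length 2 in the source, so its image cannot be short.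
\<close>
lemma full_jump_lower: "\<exists>\<delta>>0. \<exists>n0. \<forall>n\<ge>n0. \<delta> \<le> jump n (2 ^ n) 0"
proof -
  obtain \<delta> n0 where d: "\<delta> > 0" and small: "\<And>a b n m. a \<in> grid \<Longrightarrow> b \<in> grid \<Longrightarrow> n0 \<le> n \<Longrightarrow>
     image_gauge a b n m < \<delta> \<Longrightarrow> source_gauge a b n m \<le> 1"
    using small_image_small_source by blast
  have "\<delta> \<le> jump n (2 ^ n) 0" if "n0 \<le> n" for n
  proof (rule ccontr)
    assume "\<not> ?thesis"
    then have "source_gauge (single n (2 ^ n)) (single n 0) n (Suc n) \<le> 1"
      using that by (intro small single_grid) (auto simp: jump_def)
    moreover have "N (\<Sum>i\<in>{n..<Suc n}. grid_diff (single n (2 ^ n)) (single n 0) i *\<^sub>R y i)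
       \<le> source_gauge (single n (2 ^ n)) (single n 0) n (Suc n)"
      by (rule max_section_ge) auto
    ultimately show False using norm_y[of n] by (simp add: grid_diff_def single_def)
  qed
  then show ?thesis using d by blast
qed

text \<open>
  Of \<open>2 ^ e\<close> consecutive steps from 0 to 1 at least one moves the image by the \<open>2 ^ e\<close>-th part of the
  total distance.
\<close>
lemma partial_jump_lower:
  "\<exists>\<delta>>0. \<exists>n0. \<forall>n\<ge>n0. \<forall>e\<le>n. \<exists>v. v + 2 ^ (n - e) \<le> 2 ^ n \<and> \<delta> / 2 ^ e \<le> jump n (v + 2 ^ (n - e)) v"
proof -
  obtain \<delta> n0 where d: "\<delta> > 0" and full: "\<And>n. n \<ge> n0 \<Longrightarrow> \<delta> \<le> jump n (2 ^ n) 0"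
    using full_jump_lower by blast
  have "\<exists>v. v + 2 ^ (n - e) \<le> 2 ^ n \<and> \<delta> / 2 ^ e \<le> jump n (v + 2 ^ (n - e)) v"
    if n: "n \<ge> n0" and e: "e \<le> n" for n e
  proof (rule ccontr)
    assume no: "\<not> ?thesis"
    have pw: "2 ^ e * 2 ^ (n - e) = (2::nat) ^ n" using e by (simp add: power_add[symmetric])
    have "jump n (t * 2 ^ (n - e)) 0 \<le> t * (\<delta> / 2 ^ e) \<and> (0 < t \<longrightarrow> jump n (t * 2 ^ (n - e)) 0 < t * (\<delta> / 2 ^ e))"
      if "t \<le> 2 ^ e" for t
      using that
    proof (induction t)
      case 0
      then show ?case using interval_gaugeD(4)[OF interval_gauge_image] by (simp add: jump_def)
    next
      case (Suc t)
      have "Suc t * 2 ^ (n - e) \<le> 2 ^ e * 2 ^ (n - e)" using Suc.prems by (intro mult_right_mono) auto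
      then have "t * 2 ^ (n - e) + 2 ^ (n - e) \<le> 2 ^ n" unfolding pw by (simp add: add.commute)
      then have "jump n (t * 2 ^ (n - e) + 2 ^ (n - e)) (t * 2 ^ (n - e)) < \<delta> / 2 ^ e"
        using no by (meson not_le_imp_less)
      then have "jump n (Suc t * 2 ^ (n - e)) 0 < \<delta> / 2 ^ e + t * (\<delta> / 2 ^ e)"
        using jump_triangle[of n "Suc t * 2 ^ (n - e)" 0 "t * 2 ^ (n - e)"] Suc
        by (simp add: add.commute)
      then show ?case by (simp add: algebra_simps add_divide_distrib)
    qed
    from this[of "2 ^ e"] have "jump n (2 ^ n) 0 < \<delta>" by (simp add: pw)
    then show False using full[OF n] by simp
  qed
  then show ?thesis using d by blast
qed

text \<open>
  If the step of length \<open>2\<^sup>-\<^sup>e\<close> were too long in the image for infinitely many coordinates, then moving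
  \<open>2 ^ e\<close> of them simultaneously would be a step of length at most 2 in the source, but by the lower
  \<open>\<ell>\<^sub>1\<close> estimate it would move the image further than \<open>bounded_source_bounded_image\<close> permits.
\<close>
lemma jump_upper: "\<exists>C>0. \<forall>e. \<exists>n0. \<forall>n\<ge>n0. e \<le> n \<and> jump n (2 ^ (n - e)) 0 \<le> C / 2 ^ e"
proof -
  obtain C \<mu> n0 where C: "C > 0" and bd: "\<And>a b n m. a \<in> grid \<Longrightarrow> b \<in> grid \<Longrightarrow> n0 \<le> n \<Longrightarrow>
     (\<And>i. n \<le> i \<Longrightarrow> i < m \<Longrightarrow> b i \<le> a i \<and> 2 ^ \<mu> dvd a i - b i) \<Longrightarrow>
     source_gauge a b n m \<le> 2 \<Longrightarrow> image_gauge a b n m \<le> C"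
    using bounded_source_bounded_image by blast
  have "\<exists>n0. \<forall>n\<ge>n0. e \<le> n \<and> jump n (2 ^ (n - e)) 0 \<le> (C / \<theta>) / 2 ^ e" for e
  proof (rule ccontr)
    assume no: "\<not> ?thesis"
    \<comment> \<open>three requirements: far enough out, Schreier admissibility of \<open>2 ^ e\<close> blocks, divisibility of \<open>2 ^ (n - e)\<close> by \<open>2 ^ \<mu>\<close>\<close>
    define K where "K = max n0 (max (2 ^ e) (e + \<mu>))"
    define B where "B = {n. K \<le> n \<and> (C / \<theta>) / 2 ^ e < jump n (2 ^ (n - e)) 0}"
    have "\<exists>n\<ge>k. n \<in> B" for k
    proof -
      obtain n where n: "max K k \<le> n" "\<not> (e \<le> n \<and> jump n (2 ^ (n - e)) 0 \<le> (C / \<theta>) / 2 ^ e)"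
        using no by blast
      then show ?thesis unfolding B_def K_def by (intro exI[of _ n]) auto
    qed
    then have inf: "infinite B" by (meson infinite_nat_iff_unbounded_le)
    define s where "s = enumerate B"
    have s: "strict_mono s" "\<And>i. s i \<in> B"
      unfolding s_def using strict_mono_enumerate[OF inf] enumerate_in_set[OF inf] by auto
    define F where "F = s ` {..<2 ^ e}"
    have F: "finite F" "card F = 2 ^ e" "F \<subseteq> B"
      unfolding F_def using s strict_mono_imp_inj_on[OF s(1)] by (auto simp: card_image inj_on_subset)
    define a where "a i = (if i \<in> F then 2 ^ (i - e) else 0 :: nat)" for i
    define m where "m = s (2 ^ e)"
    have Fm: "K \<le> i \<and> i < m" if "i \<in> F" for i
      using that F(3) strict_mono_less[OF s(1)] unfolding F_def m_def B_def by auto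
    have gr: "a \<in> grid" "(\<lambda>_. 0) \<in> grid" unfolding grid_def a_def by auto
    have "source_gauge a (\<lambda>_. 0) K m \<le> (\<Sum>i\<in>{K..<m}. 2 * \<bar>grid_diff a (\<lambda>_. 0) i\<bar>)"
      by (rule max_section_le_sum)
    also have "\<dots> = (\<Sum>i\<in>F. 2 * (1 / 2 ^ e))"
    proof (rule sum.mono_neutral_cong_right)
      fix i assume i: "i \<in> F"
      then have "e \<le> i" using Fm unfolding K_def by fastforce
      then have "(2::real) ^ (i - e) / 2 ^ i = 1 / 2 ^ e"
        by (simp add: power_diff)
      then show "2 * \<bar>grid_diff a (\<lambda>_. 0) i\<bar> = 2 * (1 / 2 ^ e)"
        using i unfolding grid_diff_def a_def by simp
    qed (use Fm in \<open>auto simp: grid_diff_def a_def\<close>)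
    also have "\<dots> = 2" using F(2) by simp
    finally have two: "source_gauge a (\<lambda>_. 0) K m \<le> 2" .
    have le: "image_gauge a (\<lambda>_. 0) K m \<le> C"
    proof (rule bd[OF gr _ _ two])
      fix i assume "K \<le> i" "i < m"
      then show "0 \<le> a i \<and> 2 ^ \<mu> dvd a i - 0"
        unfolding a_def K_def by (auto intro!: le_imp_power_dvd)
    qed (simp add: K_def)
    let ?w = "\<lambda>k. h a k - h (\<lambda>_. 0) k"
    have big: "(C / \<theta>) / 2 ^ e < tnorm \<theta> ?w {M (s i)..<M (Suc (s i))}" if "i < 2 ^ e" for i
    proof -
      have "tnorm \<theta> ?w {M (s i)..<M (Suc (s i))} = jump (s i) (a (s i)) 0"
        using image_gauge_block[of a "\<lambda>_. 0" "s i"] unfolding image_gauge_def by simp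
      also have "a (s i) = 2 ^ (s i - e)" using that unfolding a_def F_def by auto
      finally show ?thesis using s(2)[of i] unfolding B_def by simp
    qed
    have "(\<Sum>i<(2::nat) ^ e. (C / \<theta>) / 2 ^ e) < (\<Sum>i<(2::nat) ^ e. tnorm \<theta> ?w {M (s i)..<M (Suc (s i))})"
      using big by (intro sum_strict_mono) (auto simp: lessThan_empty_iff)
    then have "C < \<theta> * (\<Sum>i<(2::nat) ^ e. tnorm \<theta> ?w {M (s i)..<M (Suc (s i))})"
      using theta_pos by (simp add: field_simps)
    also have "\<dots> \<le> tnorm \<theta> ?w (\<Union>i<2 ^ e. {M (s i)..<M (Suc (s i))})"
    proof (rule tnorm_lower[where p="\<lambda>i. M (s i)"])
      show "\<forall>i<2 ^ e. M (s i) \<le> M (s (Suc i))"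
        using strict_mono_less[OF s(1)] by (intro allI impI M_le) (simp add: less_imp_le)
      have "2 ^ e \<le> s 0" using s(2)[of 0] unfolding B_def K_def by simp
      then show "2 ^ e \<le> M (s 0)" using strict_mono_imp_increasing[OF M, of "s 0"] by simp
      show "{M (s i)..<M (Suc (s i))} \<subseteq> {M (s i)..<M (s (Suc i))}" for i
        using M_le[of "Suc (s i)" "s (Suc i)"] strict_mono_less[OF s(1), of i "Suc i"] by auto
    qed
    also have "\<dots> \<le> image_gauge a (\<lambda>_. 0) K m"
      unfolding image_gauge_def
    proof (rule tnorm_mono)
      have "{M (s i)..<M (Suc (s i))} \<subseteq> {M K..<M m}" if "i < 2 ^ e" for i
      proof -
        have "K \<le> s i" "s i < m" using Fm[of "s i"] that unfolding F_def by auto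
        then show ?thesis using M_le[of K "s i"] M_le[of "Suc (s i)" m] by auto
      qed
      then show "(\<Union>i<2 ^ e. {M (s i)..<M (Suc (s i))}) \<subseteq> {M K..<M m}" by blast
    qed auto
    finally show False using le by simp
  qed
  moreover have "C / \<theta> > 0" using C theta_pos by simp
  ultimately show ?thesis by blast
qed

end

text \<open>
  One vector of the source, a multiple of a special average, is measured through both reductions.  Its
  coordinate differences may be realised with different base points: for \<open>T\<^sub>a\<close> the base points are
  those at which the jump is large, for \<open>T\<^sub>b\<close> the base point is 0.
\<close>
lemma no_two_local_reductions:
  assumes A: "local_reduction S N y a M ha" and B: "local_reduction S N y b M hb" and ba: "b < a"
  shows False
proof -
  interpret A: local_reduction S N y a M ha by (rule A)
  interpret B: local_reduction S N y b M hb by (rule B)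
  obtain Ca \<mu> n1 where Ca: "Ca > 0" and bd: "\<And>u v n m. u \<in> grid \<Longrightarrow> v \<in> grid \<Longrightarrow> n1 \<le> n \<Longrightarrow>
     (\<And>i. n \<le> i \<Longrightarrow> i < m \<Longrightarrow> v i \<le> u i \<and> 2 ^ \<mu> dvd u i - v i) \<Longrightarrow>
     A.source_gauge u v n m \<le> 2 \<Longrightarrow> A.image_gauge u v n m \<le> Ca"
    using A.bounded_source_bounded_image by blast
  obtain \<delta>a n2 where da: "\<delta>a > 0" and jl: "\<And>n e. n2 \<le> n \<Longrightarrow> e \<le> n \<Longrightarrow>
     \<exists>v. v + 2 ^ (n - e) \<le> 2 ^ n \<and> \<delta>a / 2 ^ e \<le> A.jump n (v + 2 ^ (n - e)) v"
    using A.partial_jump_lower by blast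
  obtain Cb where Cb: "Cb > 0" and "\<forall>e. \<exists>n0. \<forall>n\<ge>n0. e \<le> n \<and> B.jump n (2 ^ (n - e)) 0 \<le> Cb / 2 ^ e"
    using B.jump_upper by blast
  from choice[OF this(2)] obtain n3 where ju: "\<And>n e. n3 e \<le> n \<Longrightarrow> e \<le> n \<and> B.jump n (2 ^ (n - e)) 0 \<le> Cb / 2 ^ e"
    by blast
  obtain \<delta>b n4 where db: "\<delta>b > 0" and small: "\<And>u v n m. u \<in> grid \<Longrightarrow> v \<in> grid \<Longrightarrow> n4 \<le> n \<Longrightarrow>
     B.image_gauge u v n m < \<delta>b \<Longrightarrow> A.source_gauge u v n m \<le> 1"
    using B.small_image_small_source by blast
  note ab = A.theta_pos A.theta_le B.theta_pos B.theta_le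
  \<comment> \<open>the bound for the image in the second space that results from the choice of \<open>\<kappa>\<close> below\<close>
  have "(\<lambda>j. (4 * Cb / b) * (b ^ j + (Ca / \<delta>a) * (b / a) ^ j)) \<longlonglongrightarrow> (4 * Cb / b) * (0 + (Ca / \<delta>a) * 0)"
    using ab ba by (intro tendsto_intros LIMSEQ_realpow_zero) auto
  then have "\<forall>\<^sub>F j in sequentially. (4 * Cb / b) * (b ^ j + (Ca / \<delta>a) * (b / a) ^ j) < \<delta>b"
    using db by (intro order_tendstoD(2)) auto
  then obtain j0 where "\<And>j. j \<ge> j0 \<Longrightarrow> (4 * Cb / b) * (b ^ j + (Ca / \<delta>a) * (b / a) ^ j) < \<delta>b"
    unfolding eventually_sequentially by blast
  then obtain j where j: "0 < j" "(4 * Cb / b) * (b ^ j + (Ca / \<delta>a) * (b / a) ^ j) < \<delta>b"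
    by (metis le_add1 le_add2 add_pos_nonneg zero_less_one less_le_trans)
  \<comment> \<open>\<open>2 ^ \<kappa>\<close> has to exceed \<open>Ca / (\<delta>a * a ^ j)\<close>, but not by more than a factor; the summand 1 ensures \<open>\<kappa> \<noteq> 0\<close>\<close>
  define x where "x = 1 + Ca / (\<delta>a * a ^ j)"
  have x1: "1 < x" unfolding x_def using Ca da ab by simp
  have "\<exists>k. x < 2 ^ k" using real_arch_pow[of 2 x] by auto
  define \<kappa> where "\<kappa> = (LEAST k. x < 2 ^ k)"
  have k1: "x < 2 ^ \<kappa>" unfolding \<kappa>_def by (rule LeastI_ex) fact
  then have kpos: "\<kappa> \<noteq> 0" using x1 by (intro notI) simp
  then have "\<not> x < 2 ^ (\<kappa> - 1)" unfolding \<kappa>_def by (intro not_less_Least) simp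
  then have k2: "2 ^ \<kappa> \<le> 2 * x" using kpos by (cases \<kappa>) auto
  have kA: "Ca < a ^ j * (\<delta>a * 2 ^ \<kappa>)"
  proof -
    have "Ca / (\<delta>a * a ^ j) < 2 ^ \<kappa>" using k1 unfolding x_def by simp
    then show ?thesis using da ab by (simp add: field_simps)
  qed
  have kB: "2 * b ^ j / b * (Cb * 2 ^ \<kappa>) < \<delta>b"
  proof -
    have "2 * b ^ j / b * (Cb * 2 ^ \<kappa>) \<le> 2 * b ^ j / b * (Cb * (2 * x))"
      using k2 ab Cb by (intro mult_left_mono) auto
    also have "\<dots> = (4 * Cb / b) * (b ^ j + (Ca / \<delta>a) * (b / a) ^ j)"
      unfolding x_def using ab da by (simp add: field_simps power_divide)
    finally show ?thesis using j(2) by simp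
  qed
  define R where "R = max (max n1 n2) n4"
  obtain F e where F: "finite F" "F \<noteq> {}"
      "\<And>n. n \<in> F \<Longrightarrow> R \<le> n \<and> \<kappa> \<le> e n \<and> max (e n + \<mu>) (n3 (e n - \<kappa>)) \<le> n"
    and low: "lower_average a M (a ^ j) F e"
    and up: "\<And>w C. 0 \<le> C \<Longrightarrow> (\<forall>n\<in>F. tnorm b w {M n..<M (Suc n)} \<le> C / 2 ^ e n) \<Longrightarrow>
      tnorm b w (blocks M F) \<le> 2 * b ^ j / b * C"
    using special_average_exists[OF A.tsirelson_axioms B.tsirelson_axioms A.M j(1),
        of R \<kappa> "\<lambda>e. max (e + \<mu>) (n3 (e - \<kappa>))"] by blast
  \<comment> \<open>multiplying the weights \<open>1 / 2 ^ e n\<close> by \<open>2 ^ \<kappa>\<close>\<close>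
  define E where "E n = e n - \<kappa>" for n
  have pwE: "1 / 2 ^ E n = 2 ^ \<kappa> / (2::real) ^ e n" if "n \<in> F" for n
    using F(3)[OF that] unfolding E_def by (simp add: power_diff)
  have "\<exists>v. v + 2 ^ (n - E n) \<le> 2 ^ n \<and> \<delta>a / 2 ^ E n \<le> A.jump n (v + 2 ^ (n - E n)) v" if "n \<in> F" for n
    using F(3)[OF that] unfolding E_def R_def by (intro jl) auto
  then obtain v where v: "\<And>n. n \<in> F \<Longrightarrow> v n + 2 ^ (n - E n) \<le> 2 ^ n \<and>
      \<delta>a / 2 ^ E n \<le> A.jump n (v n + 2 ^ (n - E n)) (v n)" by metis
  define f where "f i = (if i \<in> F then v i + 2 ^ (i - E i) else 0)" for i
  define g where "g i = (if i \<in> F then v i else 0)" for i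
  define f' where "f' i = (if i \<in> F then 2 ^ (i - E i) else 0 :: nat)" for i
  define m where "m = Suc (Max F)"
  have Fm: "F \<subseteq> {R..<m}" using F(3) Max_ge[OF F(1)] unfolding m_def by (auto simp: less_Suc_eq_le)
  have bsub: "blocks M F \<subseteq> {M R..<M m}" by (rule blocks_subset_interval[OF A.M Fm])
  have gr: "f \<in> grid" "g \<in> grid" "f' \<in> grid" "(\<lambda>_. 0) \<in> grid"
    unfolding grid_def f_def g_def f'_def using v by (auto intro: add_leD1 add_leD2)
  have same: "grid_diff f g = grid_diff f' (\<lambda>_. 0)"
    unfolding grid_diff_def f_def g_def f'_def by auto
  have "\<not> A.source_gauge f g R m \<le> 2"
  proof
    assume "A.source_gauge f g R m \<le> 2"
    then have "A.image_gauge f g R m \<le> Ca"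
    proof (rule bd[OF gr(1,2), rotated -1])
      fix i assume "R \<le> i" "i < m"
      show "g i \<le> f i \<and> 2 ^ \<mu> dvd f i - g i"
        using F(3)[of i] unfolding f_def g_def E_def by (auto intro!: le_imp_power_dvd)
    qed (simp add: R_def)
    moreover have "a ^ j * (\<delta>a * 2 ^ \<kappa>) \<le> tnorm a (\<lambda>k. ha f k - ha g k) (blocks M F)"
    proof -
      have "\<delta>a * 2 ^ \<kappa> / 2 ^ e n \<le> tnorm a (\<lambda>k. ha f k - ha g k) {M n..<M (Suc n)}" if n: "n \<in> F" for n
      proof -
        have "\<delta>a * 2 ^ \<kappa> / 2 ^ e n = \<delta>a * (1 / 2 ^ E n)" unfolding pwE[OF n] by simp
        also have "\<dots> \<le> A.jump n (f n) (g n)" using v[OF n] n unfolding f_def g_def by simp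
        finally show ?thesis using A.image_gauge_block[of f g n] unfolding A.image_gauge_def by simp
      qed
      then show ?thesis using low da unfolding lower_average_def by simp
    qed
    moreover have "tnorm a (\<lambda>k. ha f k - ha g k) (blocks M F) \<le> A.image_gauge f g R m"
      unfolding A.image_gauge_def by (rule A.tnorm_mono) (use bsub in auto)
    ultimately show False using kA by simp
  qed
  moreover have "A.source_gauge f' (\<lambda>_. 0) R m \<le> 1"
  proof (rule small[OF gr(3,4)])
    let ?w = "\<lambda>k. hb f' k - hb (\<lambda>_. 0) k"
    have "tnorm b ?w {M n..<M (Suc n)} \<le> Cb * 2 ^ \<kappa> / 2 ^ e n" if n: "n \<in> F" for n
    proof -
      have "tnorm b ?w {M n..<M (Suc n)} = B.jump n (2 ^ (n - E n)) 0"
        using B.image_gauge_block[of f' "\<lambda>_. 0" n] n unfolding B.image_gauge_def f'_def by simp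
      also have "\<dots> \<le> Cb / 2 ^ E n" using ju[of "E n" n] F(3)[OF n] unfolding E_def by simp
      also have "\<dots> = Cb * (1 / 2 ^ E n)" by simp
      finally show ?thesis unfolding pwE[OF n] by simp
    qed
    then have "tnorm b ?w (blocks M F) \<le> 2 * b ^ j / b * (Cb * 2 ^ \<kappa>)"
      using Cb by (intro up) auto
    moreover have "tnorm b ?w ({M R..<M m} - blocks M F) = 0"
    proof (rule B.tnorm_zero)
      fix k assume k: "k \<in> {M R..<M m} - blocks M F"
      obtain i where i: "M i \<le> k" "k < M (Suc i)"
        using block_index[OF A.M, of R k m] k by auto
      then have "i \<notin> F" using k unfolding blocks_def by auto
      with i show "?w k = 0" using B.local[of f' i "\<lambda>_. 0" k] unfolding f'_def by simp
    qed
    moreover have "B.image_gauge f' (\<lambda>_. 0) R m \<le> tnorm b ?w (blocks M F) + tnorm b ?w ({M R..<M m} - blocks M F)"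
      using B.tnorm_Un[of "blocks M F" "{M R..<M m} - blocks M F" ?w] finite_blocks[OF F(1)] bsub
      unfolding B.image_gauge_def by (simp add: Un_absorb1)
    ultimately show "B.image_gauge f' (\<lambda>_. 0) R m < \<delta>b" using kB by simp
  qed (simp add: R_def)
  ultimately show False unfolding same by simp
qed

section \<open>Baire category on sequences of natural numbers\<close>

definition cylinder :: "(nat \<Rightarrow> nat) \<Rightarrow> nat \<Rightarrow> (nat \<Rightarrow> nat) set" where
  "cylinder z l = {z'. \<forall>i<l. z' i = z i}"

definition cylinder_open :: "(nat \<Rightarrow> nat) set \<Rightarrow> bool" where
  "cylinder_open U \<longleftrightarrow> (\<forall>z\<in>U. \<exists>l. cylinder z l \<subseteq> U)"

definition dense_open :: "(nat \<Rightarrow> nat) set \<Rightarrow> bool" where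
  "dense_open D \<longleftrightarrow> cylinder_open D \<and> (\<forall>z l. cylinder z l \<inter> D \<noteq> {})"

definition comeager :: "((nat \<Rightarrow> nat) \<Rightarrow> bool) \<Rightarrow> bool" where
  "comeager P \<longleftrightarrow> (\<exists>D :: nat \<Rightarrow> (nat \<Rightarrow> nat) set. (\<forall>k. dense_open (D k)) \<and> (\<forall>z. (\<forall>k. z \<in> D k) \<longrightarrow> P z))"

definition graft :: "(nat \<Rightarrow> nat) \<Rightarrow> nat \<Rightarrow> (nat \<Rightarrow> nat) \<Rightarrow> nat \<Rightarrow> nat" where
  "graft \<sigma> l z = (\<lambda>i. if i < l then \<sigma> i else z i)"

lemma cylinder_self: "z \<in> cylinder z l"
  unfolding cylinder_def by simp

lemma cylinder_mono: "l \<le> l' \<Longrightarrow> cylinder z l' \<subseteq> cylinder z l"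
  unfolding cylinder_def by auto

lemma cylinder_eq: "z' \<in> cylinder z l \<Longrightarrow> cylinder z' l = cylinder z l"
  unfolding cylinder_def by auto

lemma baire_category:
  fixes D :: "nat \<Rightarrow> (nat \<Rightarrow> nat) set"
  assumes D: "\<And>k. dense_open (D k)"
  shows "\<exists>w\<in>cylinder z l. \<forall>k. w \<in> D k"
proof -
  define next_ok where "next_ok z l k t \<longleftrightarrow>
    l < snd t \<and> fst t \<in> cylinder z l \<and> cylinder (fst t) (snd t) \<subseteq> D k" for z l k and t :: "(nat \<Rightarrow> nat) \<times> nat"
  have "\<exists>t. next_ok z l k t" for z l k
  proof -
    obtain z' where z': "z' \<in> cylinder z l" "z' \<in> D k"
      using D[of k] unfolding dense_open_def by blast
    then obtain l0 where l0: "cylinder z' l0 \<subseteq> D k"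
      using D[of k] unfolding dense_open_def cylinder_open_def by blast
    have "cylinder z' (max (Suc l) l0) \<subseteq> D k" using l0 cylinder_mono[of l0 "max (Suc l) l0" z'] by auto
    then have "next_ok z l k (z', max (Suc l) l0)" using z' unfolding next_ok_def by auto
    then show ?thesis by blast
  qed
  then obtain tf where tf: "\<And>z l k. next_ok z l k (tf z l k)" by metis
  define zf where "zf z l k = fst (tf z l k)" for z l k
  define lf where "lf z l k = snd (tf z l k)" for z l k
  have F: "l < lf z l k" "zf z l k \<in> cylinder z l" "cylinder (zf z l k) (lf z l k) \<subseteq> D k" for z l k
    using tf[of z l k] unfolding next_ok_def zf_def lf_def by auto
  define st where "st = rec_nat (z, l) (\<lambda>k (z, l). (zf z l k, lf z l k))"
  define zs where "zs k = fst (st k)" for k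
  define ls where "ls k = snd (st k)" for k
  have st0: "zs 0 = z" "ls 0 = l" unfolding zs_def ls_def st_def by simp_all
  have stS: "zs (Suc k) = zf (zs k) (ls k) k" "ls (Suc k) = lf (zs k) (ls k) k" for k
    unfolding zs_def ls_def st_def by (simp_all add: case_prod_unfold)
  have lk: "k \<le> ls k" for k
  proof (induction k)
    case (Suc k)
    then show ?case using F(1)[of "ls k" "zs k" k] stS by simp
  qed simp
  have agree: "zs k' \<in> cylinder (zs k) (ls k) \<and> ls k \<le> ls k'" if "k \<le> k'" for k k'
    using that
  proof (induction k' rule: dec_induct)
    case (step n)
    have "zs (Suc n) \<in> cylinder (zs n) (ls n)" "ls n \<le> ls (Suc n)"
      using F(2)[of "zs n" "ls n" n] F(1)[of "ls n" "zs n" n] stS by auto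
    then show ?case using step unfolding cylinder_def by auto
  qed (simp add: cylinder_self)
  define w where "w i = zs (Suc i) i" for i
  have w: "w \<in> cylinder (zs k) (ls k)" for k
    unfolding cylinder_def
  proof (intro CollectI allI impI)
    fix i assume i: "i < ls k"
    show "w i = zs k i"
    proof (cases "k \<le> Suc i")
      case True
      then show ?thesis using agree[OF True] i unfolding w_def cylinder_def by simp
    next
      case False
      then show ?thesis using agree[of "Suc i" k] lk[of "Suc i"] unfolding w_def cylinder_def by simp
    qed
  qed
  have "w \<in> D k" for k using w[of "Suc k"] F(3)[where k=k] stS[of k] by auto
  moreover have "w \<in> cylinder z l" using w[of 0] st0 by simp
  ultimately show ?thesis by blast
qed

lemma comeager_nonempty: "comeager P \<Longrightarrow> \<exists>w\<in>cylinder z l. P w"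
  unfolding comeager_def using baire_category by blast

lemma comeager_mono: "comeager P \<Longrightarrow> (\<And>z. P z \<Longrightarrow> Q z) \<Longrightarrow> comeager Q"
  unfolding comeager_def by blast

lemma comeager_dense_open: "dense_open D \<Longrightarrow> comeager (\<lambda>z. z \<in> D)"
  unfolding comeager_def by (rule exI[of _ "\<lambda>_. D"]) simp

lemma comeager_all:
  fixes P :: "'i::countable \<Rightarrow> (nat \<Rightarrow> nat) \<Rightarrow> bool"
  assumes "\<And>i. comeager (P i)"
  shows "comeager (\<lambda>z. \<forall>i. P i z)"
proof -
  have "\<forall>i. \<exists>D :: nat \<Rightarrow> (nat \<Rightarrow> nat) set. (\<forall>k. dense_open (D k)) \<and> (\<forall>z. (\<forall>k. z \<in> D k) \<longrightarrow> P i z)"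
    using assms unfolding comeager_def by blast
  from choice[OF this] obtain D :: "'i \<Rightarrow> nat \<Rightarrow> (nat \<Rightarrow> nat) set"
    where D: "\<And>i k. dense_open (D i k)" "\<And>i z. (\<And>k. z \<in> D i k) \<Longrightarrow> P i z" by blast
  define E where "E m = D (fst (from_nat m :: 'i \<times> nat)) (snd (from_nat m :: 'i \<times> nat))" for m
  have "\<forall>i. P i z" if z: "\<forall>m. z \<in> E m" for z
  proof
    fix i
    show "P i z"
    proof (rule D(2))
      fix k show "z \<in> D i k" using z[rule_format, of "to_nat (i, k)"] unfolding E_def by simp
    qed
  qed
  then show ?thesis unfolding comeager_def using D(1) by (intro exI[of _ E]) (simp add: E_def)
qed

lemma comeager_conj:
  assumes "comeager P" "comeager Q"
  shows "comeager (\<lambda>z. P z \<and> Q z)"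
proof -
  have "comeager (\<lambda>z. if b then P z else Q z)" for b
    using assms by (cases b) simp_all
  then have "comeager (\<lambda>z. \<forall>b. if b then P z else Q z)" by (rule comeager_all)
  then show ?thesis by (rule comeager_mono) (simp add: all_bool_eq)
qed

lemma dense_open_graft:
  assumes D: "dense_open D"
  shows "dense_open {z. graft \<sigma> l z \<in> D}"
  unfolding dense_open_def cylinder_open_def
proof (intro conjI ballI allI)
  fix z assume "z \<in> {z. graft \<sigma> l z \<in> D}"
  then obtain p where p: "cylinder (graft \<sigma> l z) p \<subseteq> D"
    using D unfolding dense_open_def cylinder_open_def by auto
  have "cylinder z p \<subseteq> {z. graft \<sigma> l z \<in> D}"
  proof
    fix z' assume "z' \<in> cylinder z p"
    then have "graft \<sigma> l z' \<in> cylinder (graft \<sigma> l z) p"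
      unfolding cylinder_def graft_def by auto
    then show "z' \<in> {z. graft \<sigma> l z \<in> D}" using p by blast
  qed
  then show "\<exists>p. cylinder z p \<subseteq> {z. graft \<sigma> l z \<in> D}" by blast
next
  fix z p
  obtain u where u: "u \<in> cylinder (graft \<sigma> l z) (max p l)" "u \<in> D"
    using D unfolding dense_open_def by blast
  have "graft \<sigma> l (graft z l u) = u"
    using u(1) unfolding cylinder_def graft_def by auto
  moreover have "graft z l u \<in> cylinder z p"
    using u(1) unfolding cylinder_def graft_def by auto
  ultimately show "cylinder z p \<inter> {z. graft \<sigma> l z \<in> D} \<noteq> {}" using u(2) by auto
qed

text \<open>
  Overwriting the first \<open>l\<close> entries is a continuous open map, so preimages of dense open sets are dense
  and open.  As only finitely many entries of \<open>\<sigma>\<close> matter, there are countably many such maps, and the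
  comeager set can be shrunk to one that is invariant under all of them.
\<close>
lemma comeager_graft_closed:
  assumes "comeager P"
  shows "\<exists>E :: nat \<Rightarrow> (nat \<Rightarrow> nat) set. (\<forall>n. dense_open (E n)) \<and> (\<forall>z. (\<forall>n. z \<in> E n) \<longrightarrow> P z) \<and>
    (\<forall>z \<sigma> l. (\<forall>n. z \<in> E n) \<longrightarrow> (\<forall>n. graft \<sigma> l z \<in> E n))"
proof -
  obtain D :: "nat \<Rightarrow> (nat \<Rightarrow> nat) set" where D: "\<And>k. dense_open (D k)" "\<And>z. (\<And>k. z \<in> D k) \<Longrightarrow> P z"
    using assms unfolding comeager_def by blast
  define E where "E m = (case from_nat m of (s :: nat list, k) \<Rightarrow> {z. graft ((!) s) (length s) z \<in> D k})" for m
  have E: "(\<forall>m. z \<in> E m) \<longleftrightarrow> (\<forall>s k. graft ((!) s) (length s) z \<in> D k)" for z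
  proof
    assume *: "\<forall>m. z \<in> E m"
    show "\<forall>s k. graft ((!) s) (length s) z \<in> D k"
    proof (intro allI)
      fix s k show "graft ((!) s) (length s) z \<in> D k"
        using *[rule_format, of "to_nat (s, k)"] unfolding E_def by simp
    qed
  qed (auto simp: E_def split: prod.splits)
  show ?thesis
  proof (intro exI[of _ E] conjI allI impI)
    fix n show "dense_open (E n)"
      unfolding E_def by (auto split: prod.splits intro: dense_open_graft D(1))
  next
    fix z assume "\<forall>n. z \<in> E n"
    then have "z \<in> D k" for k using E[of z] by (force simp: graft_def dest: spec[of _ "[]"])
    then show "P z" by (rule D(2))
  next
    fix z \<sigma> l n assume z: "\<forall>n. z \<in> E n"
    have "\<forall>s k. graft ((!) s) (length s) (graft \<sigma> l z) \<in> D k"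
    proof (intro allI)
      fix s k
      define s' where "s' = map (graft ((!) s) (length s) \<sigma>) [0..<max l (length s)]"
      have "graft ((!) s) (length s) (graft \<sigma> l z) = graft ((!) s') (length s') z"
        unfolding s'_def graft_def by (auto simp: fun_eq_iff)
      moreover have "graft ((!) s') (length s') z \<in> D k" using z E[of z] by blast
      ultimately show "graft ((!) s) (length s) (graft \<sigma> l z) \<in> D k" by simp
    qed
    then show "graft \<sigma> l z \<in> E n" using E[of "graft \<sigma> l z"] by blast
  qed
qed

definition baire_property :: "(nat \<Rightarrow> nat) set \<Rightarrow> bool" where
  "baire_property A \<longleftrightarrow> (\<exists>U. cylinder_open U \<and> comeager (\<lambda>z. z \<in> A \<longleftrightarrow> z \<in> U))"

lemma baire_property_open: "cylinder_open U \<Longrightarrow> baire_property U"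
  unfolding baire_property_def comeager_def dense_open_def cylinder_open_def
  by (rule exI[of _ U]) (auto intro!: exI[of _ "\<lambda>_. UNIV"] simp: cylinder_def)

text \<open>
  An open set and its exterior together are dense and open, so up to a meager set the complement is the
  exterior.
\<close>
lemma baire_property_Compl:
  assumes "baire_property A"
  shows "baire_property (- A)"
proof -
  obtain U where U: "cylinder_open U" "comeager (\<lambda>z. z \<in> A \<longleftrightarrow> z \<in> U)"
    using assms unfolding baire_property_def by blast
  define V where "V = {z. \<exists>l. cylinder z l \<inter> U = {}}"
  have V: "cylinder_open V"
    unfolding cylinder_open_def
  proof
    fix z assume "z \<in> V"
    then obtain l where l: "cylinder z l \<inter> U = {}" unfolding V_def by blast
    then have "cylinder z l \<subseteq> V" unfolding V_def using cylinder_eq by blast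
    then show "\<exists>l. cylinder z l \<subseteq> V" by blast
  qed
  have "dense_open (U \<union> V)"
    unfolding dense_open_def
  proof (intro conjI allI)
    show "cylinder_open (U \<union> V)" using U(1) V unfolding cylinder_open_def by blast
    show "cylinder z l \<inter> (U \<union> V) \<noteq> {}" for z l
      using cylinder_self[of z l] unfolding V_def by blast
  qed
  then have "comeager (\<lambda>z. (z \<in> A \<longleftrightarrow> z \<in> U) \<and> z \<in> U \<union> V)"
    by (intro comeager_conj U comeager_dense_open)
  then have "comeager (\<lambda>z. z \<in> - A \<longleftrightarrow> z \<in> V)"
    by (rule comeager_mono) (auto simp: V_def intro: cylinder_self)
  then show ?thesis unfolding baire_property_def using V by blast
qed

lemma baire_property_UN:
  assumes "\<And>i::nat. baire_property (A i)"
  shows "baire_property (\<Union>i. A i)"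
proof -
  have "\<forall>i. \<exists>U. cylinder_open U \<and> comeager (\<lambda>z. z \<in> A i \<longleftrightarrow> z \<in> U)"
    using assms unfolding baire_property_def by blast
  from choice[OF this] obtain U where U: "\<And>i. cylinder_open (U i)" "\<And>i. comeager (\<lambda>z. z \<in> A i \<longleftrightarrow> z \<in> U i)" by blast
  have "comeager (\<lambda>z. \<forall>i. z \<in> A i \<longleftrightarrow> z \<in> U i)" by (rule comeager_all) (rule U)
  then have "comeager (\<lambda>z. z \<in> (\<Union>i. A i) \<longleftrightarrow> z \<in> (\<Union>i. U i))"
    by (rule comeager_mono) auto
  moreover have "cylinder_open (\<Union>i. U i)"
    unfolding cylinder_open_def
  proof
    fix z assume "z \<in> (\<Union>i. U i)"
    then obtain i where "z \<in> U i" by blast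
    then obtain l where "cylinder z l \<subseteq> U i" using U(1)[of i] unfolding cylinder_open_def by blast
    then show "\<exists>l. cylinder z l \<subseteq> (\<Union>i. U i)" by blast
  qed
  ultimately show ?thesis unfolding baire_property_def by blast
qed

lemma baire_property_borel:
  fixes g :: "(nat \<Rightarrow> nat) \<Rightarrow> 'a::topological_space"
  assumes g: "\<And>U. open U \<Longrightarrow> cylinder_open (g -` U)" and A: "A \<in> sets borel"
  shows "baire_property (g -` A)"
proof -
  have "A \<in> sigma_sets UNIV {S. open S}" using A unfolding borel_def by simp
  then show ?thesis
  proof (induction rule: sigma_sets.induct)
    case Empty
    then show ?case by (intro baire_property_open) (simp add: cylinder_open_def)
  next
    case (Compl a)
    then show ?case using baire_property_Compl[of "g -` a"] by (simp add: vimage_Compl Compl_eq_Diff_UNIV[symmetric])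
  next
    case (Union a)
    then show ?case by (simp add: vimage_UN baire_property_UN)
  qed (auto intro: baire_property_open g)
qed

text \<open>
  Preimages of rational half lines are open up to meager sets.  Off the union of these countably many
  meager sets the functions are continuous.
\<close>
lemma comeager_continuity:
  fixes F :: "'i::countable \<Rightarrow> (nat \<Rightarrow> nat) \<Rightarrow> real"
  assumes "\<And>m q. baire_property {z. F m z < q}" "\<And>m q. baire_property {z. q < F m z}"
  shows "\<exists>P. comeager P \<and>
    (\<forall>m z \<epsilon>. P z \<longrightarrow> 0 < \<epsilon> \<longrightarrow> (\<exists>l. \<forall>z'\<in>cylinder z l. P z' \<longrightarrow> \<bar>F m z' - F m z\<bar> < \<epsilon>))"
proof -
  have "\<forall>i. \<exists>U. cylinder_open U \<and> comeager (\<lambda>z. F (fst i) z < of_rat (snd i) \<longleftrightarrow> z \<in> U)"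
    using assms(1) unfolding baire_property_def by simp
  from choice[OF this] obtain U where U: "\<And>i. cylinder_open (U i)"
    "\<And>i. comeager (\<lambda>z. F (fst i) z < of_rat (snd i) \<longleftrightarrow> z \<in> U i)" by blast
  have "\<forall>i. \<exists>V. cylinder_open V \<and> comeager (\<lambda>z. of_rat (snd i) < F (fst i) z \<longleftrightarrow> z \<in> V)"
    using assms(2) unfolding baire_property_def by simp
  from choice[OF this] obtain V where V: "\<And>i. cylinder_open (V i)"
    "\<And>i. comeager (\<lambda>z. of_rat (snd i) < F (fst i) z \<longleftrightarrow> z \<in> V i)" by blast
  define P where "P z \<longleftrightarrow> (\<forall>i. (F (fst i) z < of_rat (snd i) \<longleftrightarrow> z \<in> U i) \<and> (of_rat (snd i) < F (fst i) z \<longleftrightarrow> z \<in> V i))" for z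
  have "comeager P"
    unfolding P_def by (intro comeager_all comeager_conj U V)
  moreover have "\<exists>l. \<forall>z'\<in>cylinder z l. P z' \<longrightarrow> \<bar>F m z' - F m z\<bar> < \<epsilon>" if z: "P z" and e: "0 < \<epsilon>" for m z \<epsilon>
  proof -
    obtain q where q: "F m z < of_rat q" "of_rat q < F m z + \<epsilon>" using of_rat_dense[of "F m z" "F m z + \<epsilon>"] e by auto
    obtain r where r: "F m z - \<epsilon> < of_rat r" "of_rat r < F m z" using of_rat_dense[of "F m z - \<epsilon>" "F m z"] e by auto
    have "z \<in> U (m, q)" "z \<in> V (m, r)" using z q(1) r(2) unfolding P_def by (metis fst_conv snd_conv)+
    then obtain l l' where l: "cylinder z l \<subseteq> U (m, q)" "cylinder z l' \<subseteq> V (m, r)"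
      using U(1) V(1) unfolding cylinder_open_def by metis
    have "\<bar>F m z' - F m z\<bar> < \<epsilon>" if z': "z' \<in> cylinder z (max l l')" "P z'" for z'
    proof -
      have "z' \<in> U (m, q)" "z' \<in> V (m, r)"
        using l z'(1) cylinder_mono[of l "max l l'" z] cylinder_mono[of l' "max l l'" z] by auto
      then have "F m z' < of_rat q" "of_rat r < F m z'" using z'(2) unfolding P_def by (metis fst_conv snd_conv)+
      then show ?thesis using q r by linarith
    qed
    then show ?thesis by blast
  qed
  ultimately show ?thesis by (intro exI[of _ P] conjI allI impI)
qed

lemma finite_uniform_bound:
  assumes "finite I" "\<And>i. i \<in> I \<Longrightarrow> \<exists>l::nat. P i l" "\<And>i l l'. P i l \<Longrightarrow> l \<le> l' \<Longrightarrow> P i l'"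
  shows "\<exists>l. \<forall>i\<in>I. P i l"
  using assms(1,2)
proof (induction I rule: finite_induct)
  case (insert i I)
  then obtain l where l: "\<forall>i\<in>I. P i l" by blast
  obtain l' where l': "P i l'" using insert by blast
  have "\<forall>j\<in>insert i I. P j (max l l')" using l l' assms(3) by (metis insertE max.cobounded1 max.cobounded2)
  then show ?case by blast
qed simp

section \<open>Localisation of a reduction\<close>

text \<open>
  Two maps \<open>f b\<close> whose restrictions to the comeager set \<open>\<Inter>n. E n\<close> are continuous and which send sequences that differ
  in finitely many entries to equivalent sequences.  Both are treated at once in order to obtain common
  blocks.
\<close>
locale generic_map =
  fixes E :: "nat \<Rightarrow> (nat \<Rightarrow> nat) set" and \<theta> :: "bool \<Rightarrow> real"
    and f :: "bool \<Rightarrow> (nat \<Rightarrow> nat) \<Rightarrow> nat \<Rightarrow> real"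
  assumes tsirelson: "\<And>b. tsirelson (\<theta> b)"
    and dense: "\<And>n. dense_open (E n)"
    and graft_closed: "\<And>z \<sigma> l n. (\<And>n. z \<in> E n) \<Longrightarrow> graft \<sigma> l z \<in> E n"
    and continuous: "\<And>b k z \<epsilon>. (\<And>n. z \<in> E n) \<Longrightarrow> 0 < \<epsilon> \<Longrightarrow>
      \<exists>l. \<forall>z'\<in>cylinder z l. (\<forall>n. z' \<in> E n) \<longrightarrow> \<bar>f b z' k - f b z k\<bar> < \<epsilon>"
    and tail_invariant: "\<And>b z \<sigma> \<sigma>' l.
      tsirelson.conv (\<theta> b) (\<lambda>k. f b (graft \<sigma> l z) k - f b (graft \<sigma>' l z) k)"
begin

definition G :: "(nat \<Rightarrow> nat) set" where
  "G = (\<Inter>n. E n)"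

lemma G_graft: "z \<in> G \<Longrightarrow> graft \<sigma> l z \<in> G"
proof -
  assume "z \<in> G"
  then have z: "z \<in> E n" for n unfolding G_def by simp
  have "graft \<sigma> l z \<in> E n" for n by (rule graft_closed) (rule z)
  then show ?thesis unfolding G_def by simp
qed

definition gap :: "bool \<Rightarrow> (nat \<Rightarrow> nat) \<Rightarrow> (nat \<Rightarrow> nat) \<Rightarrow> nat set \<Rightarrow> real" where
  "gap b z z' A = tnorm (\<theta> b) (\<lambda>k. f b z k - f b z' k) A"

lemma gap_triangle: "gap b z z'' A \<le> gap b z z' A + gap b z' z'' A"
  unfolding gap_def by (rule tsirelson.tnorm_triangle[OF tsirelson]) simp

lemma gap_sym: "gap b z z' A = gap b z' z A"
  unfolding gap_def by (rule tsirelson.tnorm_cong[OF tsirelson]) simp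

lemma gap_mono: "finite B \<Longrightarrow> A \<subseteq> B \<Longrightarrow> gap b z z' A \<le> gap b z z' B"
  unfolding gap_def by (rule tsirelson.tnorm_mono[OF tsirelson]) auto

lemma gap_continuous:
  assumes z: "z \<in> G" and A: "finite A" and e: "0 < \<epsilon>"
  shows "\<exists>l. \<forall>z'\<in>cylinder z l \<inter> G. gap b (graft \<sigma> p z') (graft \<sigma> p z) A \<le> \<epsilon>"
proof -
  define \<eta> where "\<eta> = \<epsilon> / (real (card A) + 1)"
  have eta: "0 < \<eta>" unfolding \<eta>_def using e by (simp add: add_nonneg_pos)
  have zs: "\<And>n. graft \<sigma> p z \<in> E n" using G_graft[OF z] unfolding G_def by blast
  have "\<exists>l. \<forall>k\<in>A. \<forall>z'\<in>cylinder (graft \<sigma> p z) l. (\<forall>n. z' \<in> E n) \<longrightarrow> \<bar>f b z' k - f b (graft \<sigma> p z) k\<bar> < \<eta>"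
  proof (rule finite_uniform_bound[OF A])
    fix k assume "k \<in> A"
    show "\<exists>l. \<forall>z'\<in>cylinder (graft \<sigma> p z) l. (\<forall>n. z' \<in> E n) \<longrightarrow> \<bar>f b z' k - f b (graft \<sigma> p z) k\<bar> < \<eta>"
      by (rule continuous[OF zs eta])
  next
    fix k l l' :: nat
    assume "\<forall>z'\<in>cylinder (graft \<sigma> p z) l. (\<forall>n. z' \<in> E n) \<longrightarrow> \<bar>f b z' k - f b (graft \<sigma> p z) k\<bar> < \<eta>" "l \<le> l'"
    then show "\<forall>z'\<in>cylinder (graft \<sigma> p z) l'. (\<forall>n. z' \<in> E n) \<longrightarrow> \<bar>f b z' k - f b (graft \<sigma> p z) k\<bar> < \<eta>"
      using cylinder_mono by blast
  qed
  then obtain l where l0: "\<forall>k\<in>A. \<forall>z'\<in>cylinder (graft \<sigma> p z) l. (\<forall>n. z' \<in> E n) \<longrightarrow>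
      \<bar>f b z' k - f b (graft \<sigma> p z) k\<bar> < \<eta>" by (elim exE)
  have l: "\<bar>f b z' k - f b (graft \<sigma> p z) k\<bar> < \<eta>"
    if "k \<in> A" "z' \<in> cylinder (graft \<sigma> p z) l" "z' \<in> G" for k z'
    using l0 that unfolding G_def by simp
  have "gap b (graft \<sigma> p z') (graft \<sigma> p z) A \<le> \<epsilon>" if z': "z' \<in> cylinder z l \<inter> G" for z'
  proof -
    have "graft \<sigma> p z' \<in> cylinder (graft \<sigma> p z) l" "graft \<sigma> p z' \<in> G"
      using z' G_graft unfolding cylinder_def graft_def by auto
    then have *: "\<bar>f b (graft \<sigma> p z') k - f b (graft \<sigma> p z) k\<bar> \<le> \<eta>" if "k \<in> A" for k
      using l[OF that] by (simp add: less_imp_le)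
    have "gap b (graft \<sigma> p z') (graft \<sigma> p z) A \<le> (\<Sum>k\<in>A. \<bar>f b (graft \<sigma> p z') k - f b (graft \<sigma> p z) k\<bar>)"
      unfolding gap_def
      by (rule tsirelson.tnorm_least[OF tsirelson]) (rule tsirelson.pairing_le_sum[OF tsirelson])
    also have "\<dots> \<le> (\<Sum>k\<in>A. \<eta>)" using * by (rule sum_mono)
    also have "\<dots> = real (card A) * \<eta>" by simp
    also have "\<dots> \<le> (real (card A) + 1) * \<eta>" using eta by (intro mult_right_mono) auto
    also have "\<dots> = \<epsilon>" unfolding \<eta>_def by (simp add: add_nonneg_eq_0_iff)
    finally show ?thesis .
  qed
  then show ?thesis by blast
qed

lemma tail_gap:
  assumes "0 < \<epsilon>"
  shows "\<exists>M. \<forall>m. gap b (graft \<sigma> l z) (graft \<sigma>' l z) {M..<m} \<le> \<epsilon>"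
  unfolding gap_def
  by (rule tsirelson.conv_def[OF tsirelson, THEN iffD1, OF tail_invariant, THEN spec, THEN mp, OF assms])

text \<open>
  Entries from \<open>l\<close> on are 0, which makes the set finite.
\<close>
definition words :: "nat \<Rightarrow> nat \<Rightarrow> (nat \<Rightarrow> nat) set" where
  "words B l = {\<sigma>. \<forall>i. (i \<in> {..<l} \<longrightarrow> \<sigma> i \<in> {..B}) \<and> (i \<notin> {..<l} \<longrightarrow> \<sigma> i = 0)}"

lemma finite_words: "finite (words B l)"
  unfolding words_def by (rule finite_set_of_finite_funs) simp_all

text \<open>
  For each point there is an \<open>M\<close> beyond which the images of its finitely many modifications agree up to
  \<open>\<epsilon>\<close>.  The set of points for which a given \<open>M\<close> works is closed relative to \<open>G\<close>, so by Baire category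
  one \<open>M\<close> works on a whole cylinder.
\<close>
lemma uniform_tail_control:
  assumes e: "0 < \<epsilon>"
  shows "\<exists>M>M0. \<exists>z\<in>G. \<exists>l1. \<forall>z'\<in>cylinder z l1 \<inter> G. \<forall>\<sigma>\<in>words B l. \<forall>\<sigma>'\<in>words B l. \<forall>b m.
     gap b (graft \<sigma> l z') (graft \<sigma>' l z') {M..<m} \<le> \<epsilon>"
proof (rule ccontr)
  assume no: "\<not> ?thesis"
  define C where "C M = {z. \<forall>\<sigma>\<in>words B l. \<forall>\<sigma>'\<in>words B l. \<forall>b m.
     gap b (graft \<sigma> l z) (graft \<sigma>' l z) {M..<m} \<le> \<epsilon>}" for M
  have some: "\<exists>M>M0. z \<in> C M" for z
  proof -
    let ?gap = "\<lambda>t. gap (snd (snd t)) (graft (fst t) l z) (graft (fst (snd t)) l z)"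
    have "\<exists>M. \<forall>t\<in>words B l \<times> words B l \<times> UNIV. \<forall>m.
        ?gap t {M..<m} \<le> \<epsilon>"
    proof (rule finite_uniform_bound)
      show "finite (words B l \<times> words B l \<times> (UNIV :: bool set))" using finite_words by simp
      fix t :: "(nat \<Rightarrow> nat) \<times> (nat \<Rightarrow> nat) \<times> bool"
      show "\<exists>M. \<forall>m. ?gap t {M..<m} \<le> \<epsilon>"
        by (rule tail_gap[OF e])
      fix M M' :: nat
      assume *: "\<forall>m. ?gap t {M..<m} \<le> \<epsilon>" "M \<le> M'"
      show "\<forall>m. ?gap t {M'..<m} \<le> \<epsilon>"
      proof
        fix m
        have "?gap t {M'..<m}
          \<le> ?gap t {M..<m}"
          using *(2) by (intro gap_mono) auto
        then show "?gap t {M'..<m} \<le> \<epsilon>"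
          using *(1) order_trans by blast
      qed
    qed
    then obtain M where M: "\<And>\<sigma> \<sigma>' b m. \<sigma> \<in> words B l \<Longrightarrow> \<sigma>' \<in> words B l \<Longrightarrow>
        gap b (graft \<sigma> l z) (graft \<sigma>' l z) {M..<m} \<le> \<epsilon>" by force
    have "z \<in> C (max M (Suc M0))"
      unfolding C_def
    proof (intro CollectI ballI allI)
      fix \<sigma> \<sigma>' b m assume s: "\<sigma> \<in> words B l" "\<sigma>' \<in> words B l"
      have "gap b (graft \<sigma> l z) (graft \<sigma>' l z) {max M (Suc M0)..<m} \<le> gap b (graft \<sigma> l z) (graft \<sigma>' l z) {M..<m}"
        by (intro gap_mono) auto
      then show "gap b (graft \<sigma> l z) (graft \<sigma>' l z) {max M (Suc M0)..<m} \<le> \<epsilon>"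
        using M[OF s] order_trans by blast
    qed
    then show ?thesis by (intro exI[of _ "max M (Suc M0)"]) auto
  qed
  have closed: "\<exists>p. \<forall>z'\<in>cylinder z p \<inter> G. z' \<notin> C M" if z: "z \<in> G" "z \<notin> C M" for z M
  proof -
    obtain \<sigma> \<sigma>' b m where s: "\<sigma> \<in> words B l" "\<sigma>' \<in> words B l"
      and big: "\<epsilon> < gap b (graft \<sigma> l z) (graft \<sigma>' l z) {M..<m}"
      using z(2) unfolding C_def by (auto simp: not_le)
    define \<eta> where "\<eta> = (gap b (graft \<sigma> l z) (graft \<sigma>' l z) {M..<m} - \<epsilon>) / 3"
    have eta: "0 < \<eta>" unfolding \<eta>_def using big by simp
    obtain p1 where p1: "\<forall>z'\<in>cylinder z p1 \<inter> G. gap b (graft \<sigma> l z') (graft \<sigma> l z) {M..<m} \<le> \<eta>"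
      using gap_continuous[OF z(1) _ eta, of "{M..<m}" b \<sigma> l] by auto
    obtain p2 where p2: "\<forall>z'\<in>cylinder z p2 \<inter> G. gap b (graft \<sigma>' l z') (graft \<sigma>' l z) {M..<m} \<le> \<eta>"
      using gap_continuous[OF z(1) _ eta, of "{M..<m}" b \<sigma>' l] by auto
    have "z' \<notin> C M" if z': "z' \<in> cylinder z (max p1 p2) \<inter> G" for z'
    proof -
      have 1: "gap b (graft \<sigma> l z') (graft \<sigma> l z) {M..<m} \<le> \<eta>"
        using z' p1 cylinder_mono[of p1 "max p1 p2" z] by auto
      have 2: "gap b (graft \<sigma>' l z') (graft \<sigma>' l z) {M..<m} \<le> \<eta>"
        using z' p2 cylinder_mono[of p2 "max p1 p2" z] by auto
      have "gap b (graft \<sigma> l z) (graft \<sigma>' l z) {M..<m} \<le>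
          gap b (graft \<sigma> l z') (graft \<sigma> l z) {M..<m} + (gap b (graft \<sigma> l z') (graft \<sigma>' l z') {M..<m}
            + gap b (graft \<sigma>' l z') (graft \<sigma>' l z) {M..<m})"
        using gap_triangle[of b "graft \<sigma> l z" "graft \<sigma>' l z" "{M..<m}" "graft \<sigma> l z'"]
          gap_triangle[of b "graft \<sigma> l z'" "graft \<sigma>' l z" "{M..<m}" "graft \<sigma>' l z'"]
          gap_sym[of b "graft \<sigma> l z" "graft \<sigma> l z'"] by simp
      then have "\<epsilon> < gap b (graft \<sigma> l z') (graft \<sigma>' l z') {M..<m}"
        using 1 2 eta unfolding \<eta>_def by (simp add: field_simps)
      then show ?thesis using s unfolding C_def by (auto simp: not_le)
    qed
    then show ?thesis by blast
  qed
  \<comment> \<open>the exterior of \<open>C M\<close> relative to \<open>G\<close>; if no cylinder works, all of these are dense\<close>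
  define U where "U M = {z. \<exists>p. \<forall>z'\<in>cylinder z p \<inter> G. z' \<notin> C M}" for M
  have "dense_open (U M)" if M: "M0 < M" for M
    unfolding dense_open_def cylinder_open_def
  proof (intro conjI ballI allI)
    fix z assume "z \<in> U M"
    then obtain p where p: "\<forall>z'\<in>cylinder z p \<inter> G. z' \<notin> C M" unfolding U_def by blast
    have "cylinder z p \<subseteq> U M"
    proof
      fix z' assume "z' \<in> cylinder z p"
      then have "\<forall>z''\<in>cylinder z' p \<inter> G. z'' \<notin> C M" using p cylinder_eq by blast
      then show "z' \<in> U M" unfolding U_def by blast
    qed
    then show "\<exists>p. cylinder z p \<subseteq> U M" by blast
  next
    fix z p
    obtain z0 where z0: "z0 \<in> cylinder z p" "z0 \<in> G"
      using baire_category[of E, OF dense] unfolding G_def by blast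
    have "\<not> (\<forall>z'\<in>cylinder z0 p \<inter> G. z' \<in> C M)"
      using no M z0(2) unfolding C_def by blast
    then obtain z' where z': "z' \<in> cylinder z0 p" "z' \<in> G" "z' \<notin> C M" by blast
    have "z' \<in> U M" unfolding U_def using closed[OF z'(2,3)] by blast
    moreover have "z' \<in> cylinder z p" using z'(1) cylinder_eq[OF z0(1)] by simp
    ultimately show "cylinder z p \<inter> U M \<noteq> {}" by blast
  qed
  then have "comeager (\<lambda>z. (\<forall>n. z \<in> E n) \<and> (\<forall>n. z \<in> U (Suc M0 + n)))"
    by (intro comeager_conj comeager_all comeager_dense_open dense) simp
  from comeager_nonempty[OF this] obtain z where z: "\<forall>n. z \<in> E n" "\<forall>n. z \<in> U (Suc M0 + n)" by blast
  obtain M where M: "M0 < M" "z \<in> C M" using some by blast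
  have "z \<in> U M" using z(2)[rule_format, of "M - Suc M0"] M(1) by simp
  moreover have "z \<in> G" using z(1) unfolding G_def by simp
  ultimately show False using M(2) cylinder_self unfolding U_def by blast
qed

definition bounded_below :: "nat \<Rightarrow> nat \<Rightarrow> (nat \<Rightarrow> nat) \<Rightarrow> bool" where
  "bounded_below B l \<sigma> \<longleftrightarrow> (\<forall>i<l. \<sigma> i \<le> B)"

text \<open>
  What one stage of the construction achieves: if the entries from \<open>l\<close> to \<open>l'\<close> are those of \<open>z\<close>, then
  the entries before \<open>l\<close>, as long as \<open>B\<close> bounds them, hardly influence the image from \<open>M\<close> on, the
  entries from \<open>l'\<close> on hardly influence the image before \<open>M\<close>, and the dense open set \<open>E n\<close> has been entered.
\<close>
definition controls :: "nat \<Rightarrow> nat \<Rightarrow> nat \<Rightarrow> real \<Rightarrow> nat \<Rightarrow> (nat \<Rightarrow> nat) \<Rightarrow> nat \<Rightarrow> nat \<Rightarrow> bool" where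
  "controls l B M0 \<epsilon> n z l' M \<longleftrightarrow> z \<in> G \<and> l \<le> l' \<and> M0 < M \<and>
    (\<forall>\<sigma> \<sigma>'. bounded_below B l \<sigma> \<longrightarrow> bounded_below B l \<sigma>' \<longrightarrow>
      cylinder (graft \<sigma> l z) l' \<subseteq> E n \<and>
      (\<forall>z'\<in>G. \<forall>z''\<in>G. (\<forall>i. l \<le> i \<longrightarrow> i < l' \<longrightarrow> z' i = z i \<and> z'' i = z i) \<longrightarrow>
        (\<forall>b. (\<forall>m. gap b (graft \<sigma> l z') (graft \<sigma>' l z') {M..<m} \<le> \<epsilon>) \<and>
          gap b (graft \<sigma> l z') (graft \<sigma> l z'') {..<M} \<le> \<epsilon>)))"

lemma controls_exists:
  assumes e: "0 < \<epsilon>"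
  shows "\<exists>z l' M. controls l B M0 \<epsilon> n z l' M"
proof -
  obtain M z l1 where M: "M0 < M" and z: "z \<in> G"
    and ctl: "\<forall>z'\<in>cylinder z l1 \<inter> G. \<forall>\<sigma>\<in>words B l. \<forall>\<sigma>'\<in>words B l. \<forall>b m.
     gap b (graft \<sigma> l z') (graft \<sigma>' l z') {M..<m} \<le> \<epsilon>"
    using uniform_tail_control[OF e, of M0 B l] by (elim exE conjE bexE)
  have tail: "gap b (graft \<sigma> l z') (graft \<sigma>' l z') {M..<m} \<le> \<epsilon>"
    if "z' \<in> cylinder z l1" "z' \<in> G" "\<sigma> \<in> words B l" "\<sigma>' \<in> words B l" for z' \<sigma> \<sigma>' b m
    using ctl that by simp
  have "\<exists>p. \<forall>\<sigma>\<in>words B l. cylinder (graft \<sigma> l z) p \<subseteq> E n"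
  proof (rule finite_uniform_bound[OF finite_words])
    fix \<sigma> assume "\<sigma> \<in> words B l"
    have "graft \<sigma> l z \<in> E n" using G_graft[OF z] unfolding G_def by blast
    then show "\<exists>p. cylinder (graft \<sigma> l z) p \<subseteq> E n"
      using dense[of n] unfolding dense_open_def cylinder_open_def by blast
  next
    fix \<sigma> p p' assume "cylinder (graft \<sigma> l z) p \<subseteq> E n" "p \<le> p'"
    then show "cylinder (graft \<sigma> l z) p' \<subseteq> E n" using cylinder_mono[of p p'] by (meson order_trans)
  qed
  then obtain p1 where p1: "\<And>\<sigma>. \<sigma> \<in> words B l \<Longrightarrow> cylinder (graft \<sigma> l z) p1 \<subseteq> E n" by blast
  have "\<exists>p. \<forall>t\<in>words B l \<times> UNIV. \<forall>z'\<in>cylinder z p \<inter> G.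
      gap (snd t) (graft (fst t) l z') (graft (fst t) l z) {..<M} \<le> \<epsilon> / 2"
  proof (rule finite_uniform_bound)
    show "finite (words B l \<times> (UNIV :: bool set))" using finite_words by simp
    fix t :: "(nat \<Rightarrow> nat) \<times> bool"
    show "\<exists>p. \<forall>z'\<in>cylinder z p \<inter> G. gap (snd t) (graft (fst t) l z') (graft (fst t) l z) {..<M} \<le> \<epsilon> / 2"
      by (rule gap_continuous[OF z]) (use e in auto)
    fix p p' :: nat
    assume "\<forall>z'\<in>cylinder z p \<inter> G. gap (snd t) (graft (fst t) l z') (graft (fst t) l z) {..<M} \<le> \<epsilon> / 2" "p \<le> p'"
    then show "\<forall>z'\<in>cylinder z p' \<inter> G. gap (snd t) (graft (fst t) l z') (graft (fst t) l z) {..<M} \<le> \<epsilon> / 2"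
      using cylinder_mono[of p p' z] by blast
  qed
  then obtain p2 where head: "\<forall>t\<in>words B l \<times> UNIV. \<forall>z'\<in>cylinder z p2 \<inter> G.
      gap (snd t) (graft (fst t) l z') (graft (fst t) l z) {..<M} \<le> \<epsilon> / 2" by (elim exE)
  have p2: "gap b (graft \<sigma> l z') (graft \<sigma> l z) {..<M} \<le> \<epsilon> / 2"
    if "\<sigma> \<in> words B l" "z' \<in> cylinder z p2" "z' \<in> G" for \<sigma> b z'
    using head[rule_format, of "(\<sigma>, b)" z'] that by simp
  define l' where "l' = max l (max l1 (max p1 p2))"
  have p1_le: "p1 \<le> l'" unfolding l'_def by simp
  define norm_word where "norm_word \<sigma> = graft \<sigma> l (\<lambda>_. 0)" for \<sigma> :: "nat \<Rightarrow> nat"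
  have nw: "norm_word \<sigma> \<in> words B l" if "bounded_below B l \<sigma>" for \<sigma>
    using that unfolding norm_word_def words_def bounded_below_def graft_def by auto
  have sp: "graft (norm_word \<sigma>) l w = graft \<sigma> l w" for \<sigma> w
    unfolding norm_word_def graft_def by auto
  have cyl: "graft z l w \<in> cylinder z p" if "\<And>i. l \<le> i \<Longrightarrow> i < l' \<Longrightarrow> w i = z i" "p \<le> l'" for w p
    using that unfolding cylinder_def graft_def by auto
  have ss: "graft \<sigma> l (graft z l w) = graft \<sigma> l w" for \<sigma> w
    unfolding graft_def by auto
  have "controls l B M0 \<epsilon> n z l' M"
    unfolding controls_def
  proof (intro conjI allI impI ballI)
    show "z \<in> G" "l \<le> l'" "M0 < M" using z M unfolding l'_def by auto
    fix \<sigma> \<sigma>' assume b: "bounded_below B l \<sigma>" "bounded_below B l \<sigma>'"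
    show "cylinder (graft \<sigma> l z) l' \<subseteq> E n"
      using p1[OF nw[OF b(1)]] cylinder_mono[OF p1_le, of "graft \<sigma> l z"] unfolding sp by blast
    fix z' z'' assume w: "z' \<in> G" "z'' \<in> G" "\<forall>i. l \<le> i \<longrightarrow> i < l' \<longrightarrow> z' i = z i \<and> z'' i = z i"
    have in_cyl: "graft z l z' \<in> cylinder z p" "graft z l z'' \<in> cylinder z p" if "p \<le> l'" for p
      using cyl[OF _ that] w(3) by auto
    fix bb :: bool
    show "gap bb (graft \<sigma> l z') (graft \<sigma>' l z') {M..<m} \<le> \<epsilon>" for m
      using tail[OF in_cyl(1) G_graft[OF w(1)] nw[OF b(1)] nw[OF b(2)], of bb m]
      unfolding sp ss l'_def by simp
    have h: "gap bb (graft \<sigma> l v) (graft \<sigma> l z) {..<M} \<le> \<epsilon> / 2"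
      if "graft z l v \<in> cylinder z p2" "v \<in> G" for v
      using p2[OF nw[OF b(1)] that(1) G_graft[OF that(2)], of bb] unfolding sp ss by simp
    have "p2 \<le> l'" unfolding l'_def by simp
    then have "gap bb (graft \<sigma> l z') (graft \<sigma> l z) {..<M} \<le> \<epsilon> / 2" "gap bb (graft \<sigma> l z'') (graft \<sigma> l z) {..<M} \<le> \<epsilon> / 2"
      using h in_cyl w by blast+
    then show "gap bb (graft \<sigma> l z') (graft \<sigma> l z'') {..<M} \<le> \<epsilon>"
      using gap_triangle[of bb "graft \<sigma> l z'" "graft \<sigma> l z''" "{..<M}" "graft \<sigma> l z"]
        gap_sym[of bb "graft \<sigma> l z''" "graft \<sigma> l z" "{..<M}"] by simp
  qed
  then show ?thesis by blast
qed

text \<open>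
  Stages of \<open>controls\<close> are concatenated, leaving one free entry \<open>n j\<close> after the \<open>j\<close>-th stage; \<open>p a\<close> is
  the sequence that has the prescribed constants elsewhere and a multiple of \<open>a j\<close> at \<open>n j\<close>.  On the
  block from \<open>M j\<close> to \<open>M (Suc j)\<close> the image of \<open>p a\<close> hardly depends on the earlier free entries, by stage
  \<open>j\<close>, nor on the later ones, by stage \<open>Suc j\<close>.  So up to a summable error it depends on \<open>a j\<close> only, and
  \<open>h\<close> puts all other free entries to 0.
\<close>
lemma localisation:
  "\<exists>n M p h. strict_mono n \<and> strict_mono M \<and>
    (\<forall>a j. p a (n j) = a j * 2 ^ (n j - j)) \<and> (\<forall>a a' i. i \<notin> range n \<longrightarrow> p a i = p a' i) \<and>
    (\<forall>b a a' j k. a j = a' j \<longrightarrow> M j \<le> k \<longrightarrow> k < M (Suc j) \<longrightarrow> h b a k = h b a' k) \<and>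
    (\<forall>b a. a \<in> grid \<longrightarrow> tsirelson.conv (\<theta> b) (\<lambda>k. f b (p a) k - h b a k))"
proof -
  define good where "good j l B M0 t \<longleftrightarrow> controls l B M0 ((1/2) ^ j) j (fst t) (fst (snd t)) (snd (snd t))"
    for j l B M0 and t :: "(nat \<Rightarrow> nat) \<times> nat \<times> nat"
  have "\<exists>t. good j l B M0 t" for j l B M0
    using controls_exists[of "(1/2) ^ j" l B M0 j] unfolding good_def by auto
  then obtain ct where "\<And>j l B M0. good j l B M0 (ct j l B M0)" by metis
  then have ct: "controls l B M0 ((1/2) ^ j) j
      (fst (ct j l B M0)) (fst (snd (ct j l B M0))) (snd (snd (ct j l B M0)))" for j l B M0
    unfolding good_def .
  \<comment> \<open>a stage starts at \<open>l\<close>, with a bound \<open>B\<close> on all entries before \<open>l\<close> and a lower bound \<open>M0\<close> for the next block\<close>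
  define nextst where "nextst j s = (case s of (l, B, M0) \<Rightarrow> case ct j l B M0 of (z, l', M) \<Rightarrow>
      (Suc l', Max (insert B (insert (2 ^ l') (z ` {..<l'}))), M))" for j s
  define st where "st = rec_nat (0, 0, 0) nextst"
  define L where "L j = fst (st j)" for j
  define Bd where "Bd j = fst (snd (st j))" for j
  define M0 where "M0 j = snd (snd (st j))" for j
  define Z where "Z j = fst (ct j (L j) (Bd j) (M0 j))" for j
  define n where "n j = fst (snd (ct j (L j) (Bd j) (M0 j)))" for j
  define M where "M j = snd (snd (ct j (L j) (Bd j) (M0 j)))" for j
  have stS: "st (Suc j) = nextst j (st j)" for j unfolding st_def by simp
  have L0: "L 0 = 0" unfolding L_def st_def by simp
  have S: "L (Suc j) = Suc (n j)" "Bd (Suc j) = Max (insert (Bd j) (insert (2 ^ n j) (Z j ` {..<n j})))"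
    "M0 (Suc j) = M j" for j
    unfolding L_def Bd_def M0_def n_def Z_def M_def stS nextst_def by (simp_all add: case_prod_unfold)
  have ctl: "controls (L j) (Bd j) (M0 j) ((1/2) ^ j) j (Z j) (n j) (M j)" for j
    unfolding Z_def n_def M_def by (rule ct)
  have ZG: "Z j \<in> G" and Ln: "L j \<le> n j" and MM: "M0 j < M j" for j
    using ctl[of j] unfolding controls_def by auto
  have n_sm: "strict_mono n"
  proof (rule strict_mono_Suc_iff[THEN iffD2], rule allI)
    fix j show "n j < n (Suc j)" using Ln[of "Suc j"] S(1)[of j] by simp
  qed
  have M_sm: "strict_mono M"
  proof (rule strict_mono_Suc_iff[THEN iffD2], rule)
    fix j show "M j < M (Suc j)" using MM[of "Suc j"] S(3)[of j] by simp
  qed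
  have nj: "j \<le> n j" for j by (rule strict_mono_imp_increasing[OF n_sm])
  define ix where "ix i = (LEAST j. i \<le> n j)" for i
  have ix: "ix i = j" if "L j \<le> i" "i \<le> n j" for i j
    unfolding ix_def
  proof (rule Least_equality)
    fix j' assume j': "i \<le> n j'"
    show "j \<le> j'"
    proof (rule ccontr)
      assume "\<not> j \<le> j'"
      then obtain j0 where j0: "j = Suc j0" "j' \<le> j0" by (cases j) auto
      then have "n j' \<le> n j0" using strict_mono_less_eq[OF n_sm] by simp
      then show False using that(1) j' S(1)[of j0] j0 by simp
    qed
  qed (rule that(2))
  have ex: "\<exists>j. L j \<le> i \<and> i \<le> n j" for i
  proof -
    have "i \<le> n (ix i)" unfolding ix_def by (rule LeastI[of _ i]) (rule nj)
    moreover have "L (ix i) \<le> i"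
    proof (cases "ix i")
      case 0
      then show ?thesis using L0 by simp
    next
      case (Suc j)
      have "\<not> i \<le> n j" using Suc not_less_Least[of j "\<lambda>j. i \<le> n j"] unfolding ix_def by simp
      then show ?thesis using S(1)[of j] Suc by simp
    qed
    ultimately show ?thesis by blast
  qed
  define p where "p a i = (if i = n (ix i) then a (ix i) * 2 ^ (n (ix i) - ix i) else Z (ix i) i)" for a :: "nat \<Rightarrow> nat" and i
  have p_free: "p a (n j) = a j * 2 ^ (n j - j)" for a j
    using ix[of j "n j"] Ln[of j] unfolding p_def by simp
  have p_const: "p a i = Z j i" if "L j \<le> i" "i < n j" for a i j
    using ix[of j i] that unfolding p_def by simp
  have p_bound: "bounded_below (Bd j) (L j) (p a)" if a: "a \<in> grid" for a j
    unfolding bounded_below_def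
  proof (induction j)
    case 0
    show ?case using L0 by simp
  next
    case (Suc j)
    show ?case
    proof (intro allI impI)
      fix i assume i: "i < L (Suc j)"
      have fin: "finite (insert (Bd j) (insert (2 ^ n j) (Z j ` {..<n j})))" by simp
      consider "i < L j" | "L j \<le> i" "i < n j" | "i = n j" using i S(1)[of j] by linarith
      then show "p a i \<le> Bd (Suc j)"
      proof cases
        case 1
        then have "p a i \<le> Bd j" using Suc by simp
        also have "\<dots> \<le> Bd (Suc j)" unfolding S(2) by (rule Max_ge[OF fin]) simp
        finally show ?thesis .
      next
        case 2
        then show ?thesis unfolding S(2) p_const[OF 2] by (intro Max_ge[OF fin]) simp
      next
        case 3
        have "a j * 2 ^ (n j - j) \<le> 2 ^ j * 2 ^ (n j - j)" using a unfolding grid_def by simp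
        also have "\<dots> = 2 ^ n j" using nj[of j] by (simp add: power_add[symmetric])
        also have "\<dots> \<le> Bd (Suc j)" unfolding S(2) by (rule Max_ge[OF fin]) simp
        finally show ?thesis unfolding 3 p_free .
      qed
    qed
  qed
  have pG: "p a \<in> G" if a: "a \<in> grid" for a
    unfolding G_def
  proof
    fix j
    have "p a \<in> cylinder (graft (p a) (L j) (Z j)) (n j)"
      using p_const[of j _ a] unfolding cylinder_def graft_def by auto
    also have "\<dots> \<subseteq> E j" using ctl[of j] p_bound[OF a] unfolding controls_def by blast
    finally show "p a \<in> E j" .
  qed
  have above: "gap b (p a) (p a') {M j..<m} \<le> (1/2) ^ j"
    if a: "a \<in> grid" "a' \<in> grid" "\<And>t. j \<le> t \<Longrightarrow> a t = a' t" for a a' b j m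
  proof -
    have Lmono: "L t \<le> L t'" if "t \<le> t'" for t t'
    proof -
      have "L i \<le> L (Suc i)" for i using Ln[of i] S(1)[of i] by simp
      then show ?thesis using that by (rule lift_Suc_mono_le)
    qed
    have eq: "p a i = p a' i" if i: "L j \<le> i" for i
    proof -
      obtain t where t: "L t \<le> i" "i \<le> n t" using ex by blast
      have "j \<le> t"
      proof (rule ccontr)
        assume "\<not> j \<le> t"
        then have "L (Suc t) \<le> L j" by (intro Lmono) simp
        then show False using t(2) i S(1)[of t] by simp
      qed
      then show ?thesis using a(3)[of t] unfolding p_def ix[OF t] by simp
    qed
    have "graft (p a) (L j) (p a) = p a" "graft (p a') (L j) (p a) = p a'"
      using eq unfolding graft_def by auto
    moreover have "gap b (graft (p a) (L j) (p a)) (graft (p a') (L j) (p a)) {M j..<m} \<le> (1/2) ^ j"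
      using ctl[of j] p_bound[OF a(1), of j] p_bound[OF a(2), of j] pG[OF a(1)] p_const[of j _ a]
      unfolding controls_def by blast
    ultimately show ?thesis by simp
  qed
  have below: "gap b (p a) (p a') {..<M j} \<le> (1/2) ^ j"
    if a: "a \<in> grid" "a' \<in> grid" "\<And>t. t < j \<Longrightarrow> a t = a' t" for a a' b j
  proof -
    have eq: "p a i = p a' i" if i: "i < L j" for i
    proof -
      obtain t where t: "L t \<le> i" "i \<le> n t" using ex by blast
      have "t < j"
      proof (rule ccontr)
        assume "\<not> t < j"
        have "L i \<le> L (Suc i)" for i using Ln[of i] S(1)[of i] by simp
        then have "L j \<le> L t" by (rule lift_Suc_mono_le) (use \<open>\<not> t < j\<close> in simp)
        then show False using t(1) i by simp
      qed
      then show ?thesis using a(3)[of t] unfolding p_def ix[OF t] by simp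
    qed
    have "graft (p a) (L j) (p a) = p a" "graft (p a) (L j) (p a') = p a'"
      using eq unfolding graft_def by auto
    moreover have "gap b (graft (p a) (L j) (p a)) (graft (p a) (L j) (p a')) {..<M j} \<le> (1/2) ^ j"
      using ctl[of j] p_bound[OF a(1), of j] pG[OF a(1)] pG[OF a(2)] p_const[of j]
      unfolding controls_def by blast
    ultimately show ?thesis by simp
  qed
  define bx where "bx k = (LEAST j. k < M (Suc j))" for k
  note bx = Least_interval_index[OF M_sm, folded bx_def]
  define only where "only a j = (\<lambda>i. if i = j then a j else 0)" for a :: "nat \<Rightarrow> nat" and j :: nat
  define h where "h b a k = f b (p (only a (bx k))) k" for b a k
  have h_local: "h b a k = h b a' k" if "a j = a' j" "M j \<le> k" "k < M (Suc j)" for b a a' j k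
  proof -
    have "only a j = only a' j" using that(1) unfolding only_def by auto
    then show ?thesis unfolding h_def bx[OF that(2,3)] by simp
  qed
  have block: "tnorm (\<theta> b) (\<lambda>k. f b (p a) k - h b a k) {M j..<M (Suc j)} \<le> 2 * (1/2) ^ j"
    if a: "a \<in> grid" for b a j
  proof -
    \<comment> \<open>first the free entries before stage \<open>j\<close> are put to 0, then those after it\<close>
    define a1 where "a1 t = (if t < j then 0 else a t)" for t
    have gr: "a1 \<in> grid" "only a j \<in> grid" using a unfolding grid_def a1_def only_def by auto
    have "tnorm (\<theta> b) (\<lambda>k. f b (p a) k - h b a k) {M j..<M (Suc j)} = gap b (p a) (p (only a j)) {M j..<M (Suc j)}"
      unfolding gap_def by (rule tsirelson.tnorm_cong[OF tsirelson]) (auto simp: h_def bx)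
    also have "\<dots> \<le> gap b (p a) (p a1) {M j..<M (Suc j)} + gap b (p a1) (p (only a j)) {M j..<M (Suc j)}"
      by (rule gap_triangle)
    also have "gap b (p a) (p a1) {M j..<M (Suc j)} \<le> (1/2) ^ j"
      by (rule above[OF a gr(1)]) (simp add: a1_def)
    also have "gap b (p a1) (p (only a j)) {M j..<M (Suc j)} \<le> gap b (p a1) (p (only a j)) {..<M (Suc j)}"
      by (rule gap_mono) auto
    also have "\<dots> \<le> (1/2) ^ Suc j"
      by (rule below[OF gr]) (auto simp: a1_def only_def less_Suc_eq)
    also have "\<dots> \<le> (1/2) ^ j" by (rule power_decreasing) auto
    finally show ?thesis by simp
  qed
  have conv: "tsirelson.conv (\<theta> b) (\<lambda>k. f b (p a) k - h b a k)" if a: "a \<in> grid" for b a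
    unfolding tsirelson.conv_def[OF tsirelson]
  proof (intro allI impI)
    let ?w = "\<lambda>k. f b (p a) k - h b a k"
    fix \<epsilon> :: real assume e: "0 < \<epsilon>"
    have sum: "tnorm (\<theta> b) ?w {M j..<M (j + d)} \<le> 4 * (1/2) ^ j - 4 * (1/2) ^ (j + d)" for j d
    proof (induction d)
      case 0
      show ?case using tsirelson.tnorm_zero[OF tsirelson, of "{}"] by simp
    next
      case (Suc d)
      have "M j \<le> M (j + d)" "M (j + d) \<le> M (Suc (j + d))"
        using strict_mono_less_eq[OF M_sm] by simp_all
      then have "{M j..<M (j + Suc d)} = {M j..<M (j + d)} \<union> {M (j + d)..<M (Suc (j + d))}" by auto
      then have "tnorm (\<theta> b) ?w {M j..<M (j + Suc d)} \<le> tnorm (\<theta> b) ?w {M j..<M (j + d)}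
          + tnorm (\<theta> b) ?w {M (j + d)..<M (Suc (j + d))}"
        using tsirelson.tnorm_Un[OF tsirelson] by simp
      then show ?case using Suc block[OF a, of b "j + d"] by simp
    qed
    obtain j where j: "(1/2::real) ^ j < \<epsilon> / 4" using real_arch_pow_inv[of "\<epsilon> / 4" "1/2"] e by auto
    have "tnorm (\<theta> b) ?w {M j..<m} \<le> \<epsilon>" for m
    proof -
      have "m \<le> M (j + m)" using strict_mono_imp_increasing[OF M_sm, of "j + m"] by simp
      then have "tnorm (\<theta> b) ?w {M j..<m} \<le> tnorm (\<theta> b) ?w {M j..<M (j + m)}"
        by (intro tsirelson.tnorm_mono[OF tsirelson]) auto
      then show ?thesis using sum[of j m] j zero_le_power[of "1/2::real" "j + m"] by linarith
    qed
    then show "\<exists>M. \<forall>m. tnorm (\<theta> b) ?w {M..<m} \<le> \<epsilon>" by blast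
  qed
  have outside: "p a i = p a' i" if "i \<notin> range n" for a a' i
    using that unfolding p_def by auto
  show ?thesis
  proof (rule exI[of _ n], rule exI[of _ M], rule exI[of _ p], rule exI[of _ h], intro conjI allI impI)
    show "strict_mono n" "strict_mono M" by (rule n_sm, rule M_sm)
    show "p a (n j) = a j * 2 ^ (n j - j)" for a j by (rule p_free)
    show "p a i = p a' i" if "i \<notin> range n" for a a' i by (rule outside[OF that])
    show "h b a k = h b a' k" if "a j = a' j" "M j \<le> k" "k < M (Suc j)" for b a a' j k
      by (rule h_local[where j = j]) (rule that)+
    show "tsirelson.conv (\<theta> b) (\<lambda>k. f b (p a) k - h b a k)" if "a \<in> grid" for b a
      by (rule conv[OF that])
  qed
qed

end

section \<open>Incompatible Schauder relations\<close>

lemma sum_off_range: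
  fixes D :: "nat \<Rightarrow> 'v::comm_monoid_add" and n :: "nat \<Rightarrow> nat"
  assumes n: "strict_mono n" and D: "\<And>i. i \<notin> range n \<Longrightarrow> D i = 0"
  shows "(\<Sum>i\<in>{n r..<n s}. D i) = (\<Sum>j\<in>{r..<s}. D (n j))"
proof -
  have "(\<Sum>i\<in>{n r..<n s}. D i) = (\<Sum>i\<in>n ` {r..<s}. D i)"
  proof (rule sum.mono_neutral_right)
    show "n ` {r..<s} \<subseteq> {n r..<n s}"
      using strict_mono_less_eq[OF n] strict_mono_less[OF n] by auto
    show "\<forall>i\<in>{n r..<n s} - n ` {r..<s}. D i = 0"
    proof
      fix i assume i: "i \<in> {n r..<n s} - n ` {r..<s}"
      have "i \<notin> range n"
      proof
        assume "i \<in> range n"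
        then obtain j where j: "i = n j" by blast
        then have "r \<le> j" "j < s"
          using i strict_mono_less_eq[OF n] strict_mono_less[OF n] by auto
        then show False using i j by auto
      qed
      then show "D i = 0" by (rule D)
    qed
  qed simp
  also have "\<dots> = (\<Sum>j\<in>{r..<s}. D (n j))"
    using strict_mono_imp_inj_on[OF n] by (subst sum.reindex) (auto intro: inj_on_subset)
  finally show ?thesis .
qed

text \<open>
  Every section of the whole sequence has the same sum as a section of the subsequence and conversely,
  and the starting points of the two sections tend to infinity together.
\<close>
lemma cauchy_off_range:
  fixes D :: "nat \<Rightarrow> 'v::comm_monoid_add" and N :: "'v \<Rightarrow> real" and n :: "nat \<Rightarrow> nat"
  assumes n: "strict_mono n" and D: "\<And>i. i \<notin> range n \<Longrightarrow> D i = 0"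
  shows "(\<forall>\<epsilon>>0. \<exists>M. \<forall>r s. M \<le> r \<longrightarrow> r \<le> s \<longrightarrow> N (\<Sum>i\<in>{r..<s}. D i) \<le> \<epsilon>) \<longleftrightarrow>
    (\<forall>\<epsilon>>0. \<exists>M. \<forall>r s. M \<le> r \<longrightarrow> r \<le> s \<longrightarrow> N (\<Sum>j\<in>{r..<s}. D (n j)) \<le> \<epsilon>)" (is "?L \<longleftrightarrow> ?R")
proof
  assume L: ?L
  show ?R
  proof (intro allI impI)
    fix \<epsilon> :: real assume "0 < \<epsilon>"
    then obtain M where M: "\<And>r s. M \<le> r \<Longrightarrow> r \<le> s \<Longrightarrow> N (\<Sum>i\<in>{r..<s}. D i) \<le> \<epsilon>"
      using L by blast
    have "N (\<Sum>j\<in>{r..<s}. D (n j)) \<le> \<epsilon>" if "M \<le> r" "r \<le> s" for r s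
    proof -
      have "M \<le> n r" using strict_mono_imp_increasing[OF n, of r] that by simp
      moreover have "n r \<le> n s" using that strict_mono_less_eq[OF n] by simp
      ultimately show ?thesis using M[of "n r" "n s"] sum_off_range[OF n D] by simp
    qed
    then show "\<exists>M. \<forall>r s. M \<le> r \<longrightarrow> r \<le> s \<longrightarrow> N (\<Sum>j\<in>{r..<s}. D (n j)) \<le> \<epsilon>" by blast
  qed
next
  assume R: ?R
  define u where "u i = (LEAST j. i \<le> n j)" for i
  have u1: "i \<le> n (u i)" for i
    unfolding u_def by (rule LeastI[of _ i]) (rule strict_mono_imp_increasing[OF n])
  have u2: "n j < i" if "j < u i" for i j
    using not_less_Least[of j "\<lambda>j. i \<le> n j"] that unfolding u_def by simp
  have u_mono: "u i \<le> u i'" if "i \<le> i'" for i i'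
    unfolding u_def by (rule Least_le) (use u1[of i'] that in \<open>simp add: u_def\<close>)
  have u_n: "u (n j) = j" for j
  proof (rule antisym)
    show "u (n j) \<le> j" unfolding u_def by (rule Least_le) simp
    show "j \<le> u (n j)" using u1[of "n j"] strict_mono_less_eq[OF n] by simp
  qed
  have gap: "D i = 0" if "r \<le> i" "i < n (u r)" for r i
  proof (rule D, rule)
    assume "i \<in> range n"
    then obtain j where j: "i = n j" by blast
    then have "j < u r" using that strict_mono_less[OF n] by simp
    then show False using u2[of j r] that j by simp
  qed
  have sums: "(\<Sum>i\<in>{r..<s}. D i) = (\<Sum>j\<in>{u r..<u s}. D (n j))" if "r \<le> s" for r s
  proof -
    have s: "(\<Sum>i\<in>{r..<n (u s)}. D i) = (\<Sum>i\<in>{r..<s}. D i)"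
      using u1[of s] gap[of s] by (intro sum.mono_neutral_right) auto
    have "n (u r) \<le> n (u s)" using u_mono[OF that] strict_mono_less_eq[OF n] by simp
    then have r: "(\<Sum>i\<in>{r..<n (u s)}. D i) = (\<Sum>i\<in>{n (u r)..<n (u s)}. D i)"
      using u1[of r] gap[of r] by (intro sum.mono_neutral_right) auto
    show ?thesis using s r sum_off_range[OF n D] by simp
  qed
  show ?L
  proof (intro allI impI)
    fix \<epsilon> :: real assume "0 < \<epsilon>"
    then obtain M where M: "\<And>r s. M \<le> r \<Longrightarrow> r \<le> s \<Longrightarrow> N (\<Sum>j\<in>{r..<s}. D (n j)) \<le> \<epsilon>"
      using R by blast
    have "N (\<Sum>i\<in>{r..<s}. D i) \<le> \<epsilon>" if "n M \<le> r" "r \<le> s" for r s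
      unfolding sums[OF that(2)] using M u_mono[OF that(1)] u_mono[OF that(2)] unfolding u_n by simp
    then show "\<exists>M. \<forall>r s. M \<le> r \<longrightarrow> r \<le> s \<longrightarrow> N (\<Sum>i\<in>{r..<s}. D i) \<le> \<epsilon>" by blast
  qed
qed

text \<open>
  Otherwise the expansion of 0 would not be unique.
\<close>
lemma basic_sequence_nonzero:
  assumes B: "banach_space_on S N" and x: "basic_sequence_on S N x"
  shows "x i \<noteq> 0"
proof
  assume x0: "x i = 0"
  have S: "subspace S" and N: "norm_on S N" using B unfolding banach_space_on_def by auto
  have N0: "N 0 = 0" using norm_onD(2)[OF N subspace_0[OF S]] by simp
  have "0 \<in> closed_span_on S N (range x)"
    unfolding closed_span_on_def using subspace_0[OF S] N0 by (auto intro!: bexI[OF _ span_zero])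
  then have uniq: "\<exists>!a. series_converges_to N x a 0"
    using x unfolding basic_sequence_on_def schauder_basis_on_def by blast
  have "series_converges_to N x (\<lambda>_. 0) 0" "series_converges_to N x (\<lambda>k. if k = i then 1 else 0) 0"
  proof -
    have "(\<Sum>k<n. (if k = i then 1 else 0) *\<^sub>R x k) = 0" for n
      using x0 by (intro sum.neutral) auto
    then show "series_converges_to N x (\<lambda>k. if k = i then 1 else 0) 0"
      unfolding series_converges_to_def using N0 by simp
    show "series_converges_to N x (\<lambda>_. 0) 0"
      unfolding series_converges_to_def using N0 by simp
  qed
  then have "(\<lambda>_. 0) = (\<lambda>k. if k = i then 1 else (0::real))" using uniq by blast
  then show False by (metis zero_neq_one)
qed

text \<open>
  A map that acts coordinatewise is continuous, since a basic open set restricts finitely many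
  coordinates.
\<close>
lemma cylinder_open_vimage:
  fixes \<phi> :: "(nat \<Rightarrow> nat) \<Rightarrow> nat \<Rightarrow> real"
  assumes \<phi>: "\<And>z z' i. z i = z' i \<Longrightarrow> \<phi> z i = \<phi> z' i" and U: "open U"
  shows "cylinder_open (\<phi> -` U)"
  unfolding cylinder_open_def
proof
  fix z assume z: "z \<in> \<phi> -` U"
  have "openin (product_topology (\<lambda>_. euclidean) UNIV) U"
    using U unfolding open_fun_def .
  from product_topology_open_contains_basis[OF this, of "\<phi> z"] z
  obtain X where X: "\<phi> z \<in> Pi\<^sub>E UNIV X" "finite {i. X i \<noteq> UNIV}" "Pi\<^sub>E UNIV X \<subseteq> U"
    by auto
  from X(2) obtain l where "{i. X i \<noteq> UNIV} \<subseteq> {..<l}"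
    unfolding finite_nat_iff_bounded by (elim exE)
  then have l: "X i = UNIV" if "\<not> i < l" for i using that by blast
  have "cylinder z l \<subseteq> \<phi> -` U"
  proof
    fix z' assume z': "z' \<in> cylinder z l"
    have "\<phi> z' i \<in> X i" for i
    proof (cases "i < l")
      case True
      then have "\<phi> z' i = \<phi> z i" using z' by (intro \<phi>) (simp add: cylinder_def)
      then show ?thesis using X(1) by (simp add: PiE_iff)
    next
      case False
      then show ?thesis using l by simp
    qed
    then have "\<phi> z' \<in> Pi\<^sub>E UNIV X" by (simp add: PiE_iff)
    then show "z' \<in> \<phi> -` U" using X(3) by blast
  qed
  then show "\<exists>l. cylinder z l \<subseteq> \<phi> -` U" by blast
qed

text \<open>
  The sequence \<open>x\<close> is rescaled to norm 2 and the reductions are composed with the map \<open>\<phi>\<close> that reads a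
  sequence of natural numbers as a sequence of dyadic coefficients.  The localised maps then reduce the
  relation of the subsequence \<open>y\<close>: the constants prescribed off the subsequence cancel in differences.
\<close>
lemma common_local_reductions:
  fixes S :: "'v::real_vector set" and \<theta> :: "bool \<Rightarrow> real"
  assumes B: "banach_space_on S N" and x: "basic_sequence_on S N x"
    and ts: "\<And>b. tsirelson (\<theta> b)"
    and red: "\<And>b. borel_reducible (schauder_rel S N x) (tsirelson_rel (\<theta> b))"
  shows "\<exists>y M h. \<forall>b. local_reduction S N y (\<theta> b) M (h b)"
proof -
  have S: "subspace S" and N: "norm_on S N" using B unfolding banach_space_on_def by auto
  have xS: "range x \<subseteq> S" using x unfolding basic_sequence_on_def by simp
  have Nx: "0 < N (x i)" for i
    using norm_onD(1,2)[OF N, of "x i"] basic_sequence_nonzero[OF B x, of i] xS by (auto simp: less_le)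
  have "\<forall>b. \<exists>\<Theta>. \<Theta> \<in> borel_measurable borel \<and>
      (\<forall>u v. (u, v) \<in> schauder_rel S N x \<longleftrightarrow> (\<Theta> u, \<Theta> v) \<in> tsirelson_rel (\<theta> b))"
    using red unfolding borel_reducible_def by blast
  from choice[OF this] obtain \<Theta> where \<Theta>: "\<And>b. \<Theta> b \<in> borel_measurable borel"
    "\<And>b u v. (u, v) \<in> schauder_rel S N x \<longleftrightarrow> (\<Theta> b u, \<Theta> b v) \<in> tsirelson_rel (\<theta> b)" by blast
  define c where "c i = 2 / N (x i)" for i
  define \<phi> where "\<phi> z = (\<lambda>i. real (z i) / 2 ^ i * c i)" for z :: "nat \<Rightarrow> nat"
  define f where "f b z = \<Theta> b (\<phi> z)" for b z
  have f: "tsirelson.conv (\<theta> b) (\<lambda>k. f b z k - f b z' k) \<longleftrightarrow> \<phi> z - \<phi> z' \<in> coef S N x" for b z z'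
    using \<Theta>(2)[of "\<phi> z" "\<phi> z'" b]
    unfolding schauder_rel_def tsirelson_rel_def f_def by (simp add: fun_diff_def)
  have borel: "baire_property {z. f b z k \<in> A}" if A: "open A" for b k and A :: "real set"
  proof -
    have "open ((\<lambda>w :: nat \<Rightarrow> real. w k) -` A)"
      using continuous_on_product_coordinates A by (intro open_vimage) auto
    then have "\<Theta> b -` ((\<lambda>w. w k) -` A) \<in> sets borel"
      using measurable_sets[OF \<Theta>(1)[of b], of "(\<lambda>w. w k) -` A"] by simp
    then have "baire_property (\<phi> -` (\<Theta> b -` ((\<lambda>w. w k) -` A)))"
      by (intro baire_property_borel cylinder_open_vimage) (simp_all add: \<phi>_def)
    then show ?thesis by (simp add: vimage_def f_def)
  qed
  have "\<exists>P. comeager P \<and> (\<forall>m z \<epsilon>. P z \<longrightarrow> 0 < \<epsilon> \<longrightarrow>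
      (\<exists>l. \<forall>z'\<in>cylinder z l. P z' \<longrightarrow> \<bar>f (fst m) z' (snd m) - f (fst m) z (snd m)\<bar> < \<epsilon>))"
  proof (rule comeager_continuity[of "\<lambda>m z. f (fst m) z (snd m)"])
    show "baire_property {z. f (fst m) z (snd m) < q}" for m q
      using borel[of "{..<q}" "fst m" "snd m"] by simp
    show "baire_property {z. q < f (fst m) z (snd m)}" for m q
      using borel[of "{q<..}" "fst m" "snd m"] by simp
  qed
  then obtain P where P: "comeager P" and cont: "\<forall>m z \<epsilon>. P z \<longrightarrow> 0 < \<epsilon> \<longrightarrow>
      (\<exists>l. \<forall>z'\<in>cylinder z l. P z' \<longrightarrow> \<bar>f (fst m) z' (snd m) - f (fst m) z (snd m)\<bar> < \<epsilon>)"
    by (elim exE conjE)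
  obtain E :: "nat \<Rightarrow> (nat \<Rightarrow> nat) set" where E: "\<forall>n. dense_open (E n)" "\<forall>z. (\<forall>n. z \<in> E n) \<longrightarrow> P z"
    "\<forall>z \<sigma> l. (\<forall>n. z \<in> E n) \<longrightarrow> (\<forall>n. graft \<sigma> l z \<in> E n)"
    using comeager_graft_closed[OF P] by (elim exE conjE)
  interpret generic_map E \<theta> f
  proof
    show "dense_open (E n)" for n using E(1) by simp
    show "graft \<sigma> l z \<in> E n" if "\<And>n. z \<in> E n" for z \<sigma> l n using E(3) that by simp
    show "\<exists>l. \<forall>z'\<in>cylinder z l. (\<forall>n. z' \<in> E n) \<longrightarrow> \<bar>f b z' k - f b z k\<bar> < \<epsilon>"
      if "\<And>n. z \<in> E n" "0 < \<epsilon>" for b k z \<epsilon>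
    proof -
      have "P z" using E(2) that(1) by simp
      with cont that(2) have "\<exists>l. \<forall>z'\<in>cylinder z l. P z' \<longrightarrow>
          \<bar>f (fst (b, k)) z' (snd (b, k)) - f (fst (b, k)) z (snd (b, k))\<bar> < \<epsilon>" by blast
      then obtain l where "\<forall>z'\<in>cylinder z l. P z' \<longrightarrow> \<bar>f b z' k - f b z k\<bar> < \<epsilon>" by auto
      then show ?thesis using E(2) by (intro exI[of _ l]) simp
    qed
    show "tsirelson.conv (\<theta> b) (\<lambda>k. f b (graft \<sigma> l z) k - f b (graft \<sigma>' l z) k)" for b z \<sigma> \<sigma>' l
      unfolding f coef_iff_cauchy[OF B xS]
    proof (intro allI impI exI[of _ l])
      fix \<epsilon> :: real and n m assume "0 < \<epsilon>" "l \<le> n" "n \<le> m"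
      then have "(\<Sum>i = n..<m. (\<phi> (graft \<sigma> l z) - \<phi> (graft \<sigma>' l z)) i *\<^sub>R x i) = 0"
        by (intro sum.neutral) (simp add: \<phi>_def graft_def)
      then show "N (\<Sum>i = n..<m. (\<phi> (graft \<sigma> l z) - \<phi> (graft \<sigma>' l z)) i *\<^sub>R x i) \<le> \<epsilon>"
        using norm_onD(2)[OF N subspace_0[OF S]] \<open>0 < \<epsilon>\<close> by simp
    qed
  qed (rule tsirelson.theta_pos[OF ts] tsirelson.theta_le[OF ts])+
  obtain n M :: "nat \<Rightarrow> nat" and p h where n: "strict_mono n" and M: "strict_mono M"
    and p: "\<forall>a j. p a (n j) = a j * 2 ^ (n j - j)" "\<forall>a a' i. i \<notin> range n \<longrightarrow> p a i = p a' i"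
    and h: "\<forall>b a a' j k. a j = a' j \<longrightarrow> M j \<le> k \<longrightarrow> k < M (Suc j) \<longrightarrow> h b a k = h b a' k"
    and ph: "\<forall>b a. a \<in> grid \<longrightarrow> tsirelson.conv (\<theta> b) (\<lambda>k. f b (p a) k - h b a k)"
    using localisation by (elim exE conjE)
  define y where "y j = c (n j) *\<^sub>R x (n j)" for j
  interpret normed_sequence S N y
  proof
    show "y i \<in> S" for i unfolding y_def using xS S by (auto intro: subspace_scale)
    show "N (y i) = 2" for i
    proof -
      have "x (n i) \<in> S" using xS by blast
      then have "N (y i) = \<bar>c (n i)\<bar> * N (x (n i))" unfolding y_def by (rule norm_onD(3)[OF N])
      then show ?thesis using Nx[of "n i"] unfolding c_def by simp
    qed
  qed (rule S N)+
  have "local_reduction S N y (\<theta> b) M (h b)" for b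
  proof (intro local_reduction.intro ts local_reduction_axioms.intro M)
    show "normed_sequence S N y" by unfold_locales
    show "h b a k = h b a' k" if "a j = a' j" "M j \<le> k" "k < M (Suc j)" for a a' j k
      using h that by blast
    fix a a' assume a: "a \<in> grid" "a' \<in> grid"
    interpret t: tsirelson "\<theta> b" by (rule ts)
    define D where "D i = (\<phi> (p a) - \<phi> (p a')) i *\<^sub>R x i" for i
    have D0: "D i = 0" if "i \<notin> range n" for i
      using p(2)[rule_format, OF that, of a a'] unfolding D_def \<phi>_def by simp
    have Dn: "D (n j) = grid_diff a a' j *\<^sub>R y j" for j
    proof -
      have "j \<le> n j" by (rule strict_mono_imp_increasing[OF n])
      then have pw: "2 ^ (n j - j) / 2 ^ n j = 1 / (2::real) ^ j" by (simp add: power_diff)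
      have "(\<phi> (p a) - \<phi> (p a')) (n j) = (real (a j) - real (a' j)) * (2 ^ (n j - j) / 2 ^ n j) * c (n j)"
        unfolding \<phi>_def using p(1) by (simp add: algebra_simps diff_divide_distrib)
      then show ?thesis unfolding D_def y_def pw grid_diff_def by simp
    qed
    have "gauge_vanishes source_gauge a a' \<longleftrightarrow> \<phi> (p a) - \<phi> (p a') \<in> coef S N x"
      unfolding gauge_vanishes_max_section coef_iff_cauchy[OF B xS] D_def[symmetric] Dn[symmetric]
      by (rule cauchy_off_range[OF n, of D N, symmetric]) (rule D0)
    also have "\<dots> \<longleftrightarrow> t.conv (\<lambda>k. f b (p a) k - f b (p a') k)" using f by simp
    also have "\<dots> \<longleftrightarrow> t.conv (\<lambda>k. h b a k - h b a' k)"
    proof -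
      let ?d = "\<lambda>a k. f b (p a) k - h b a k"
      have dd: "t.conv (\<lambda>k. ?d a k - ?d a' k)"
        by (rule t.conv_linear[OF ph[rule_format, OF a(1)] ph[rule_format, OF a(2)]]) (rule abs_triangle_ineq4)
      show ?thesis
      proof
        assume "t.conv (\<lambda>k. f b (p a) k - f b (p a') k)"
        then show "t.conv (\<lambda>k. h b a k - h b a' k)" by (rule t.conv_linear[OF _ dd]) linarith
      next
        assume "t.conv (\<lambda>k. h b a k - h b a' k)"
        then show "t.conv (\<lambda>k. f b (p a) k - f b (p a') k)" by (rule t.conv_linear[OF _ dd]) linarith
      qed
    qed
    finally show "gauge_vanishes source_gauge a a' \<longleftrightarrow>
      t.conv (\<lambda>k. h b a k - h b a' k)" .
  qed
  then show ?thesis by blast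
qed

text \<open>
  \<open>no_two_local_reductions\<close> needs the larger parameter first, so the two parameters are indexed by
  \<open>True\<close> and \<open>False\<close> in this order.
\<close>
lemma tsirelson_rels_incompatible:
  assumes "tsirelson a" "tsirelson b" "a \<noteq> b" and F: "F \<in> schauder_relations"
    and "borel_reducible F (tsirelson_rel a)" "borel_reducible F (tsirelson_rel b)"
  shows False
proof -
  obtain S :: "(nat \<Rightarrow> real) set" and N x where x: "banach_space_on S N" "basic_sequence_on S N x"
    and F: "F = schauder_rel S N x"
    using F unfolding schauder_relations_def by blast
  define \<theta> where "\<theta> i = (if i then max a b else min a b)" for i
  have "\<exists>y M h. \<forall>i. local_reduction S N y (\<theta> i) M (h i)"
    by (rule common_local_reductions[OF x]) (use assms F in \<open>auto simp: \<theta>_def max_def min_def\<close>)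
  then obtain y M h where "\<And>i. local_reduction S N y (\<theta> i) M (h i)" by blast
  from no_two_local_reductions[OF this[of True] this[of False]] show False
    using \<open>a \<noteq> b\<close> unfolding \<theta>_def by (cases a b rule: linorder_cases) auto
qed

theorem corollary1p5:
  fixes \<B> :: "((nat \<Rightarrow> real) \<times> (nat \<Rightarrow> real)) set set"
  assumes "reducibility_basis \<B> schauder_relations"
  shows "\<B> \<approx> (UNIV :: nat set set)"
proof (rule lepoll_antisym)
  have sub: "\<B> \<subseteq> schauder_relations" and dom: "\<And>E. E \<in> schauder_relations \<Longrightarrow> \<exists>F\<in>\<B>. borel_reducible F E"
    using assms unfolding reducibility_basis_def by auto
  show "\<B> \<lesssim> (UNIV :: nat set set)"
    by (rule lepoll_trans[OF subset_imp_lepoll[OF sub] schauder_relations_lepoll])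
  obtain g :: "nat set \<Rightarrow> real" where g: "inj g" "range g \<subseteq> {0..<1}"
    using nat_sets_lepoll_reals01 unfolding lepoll_def by blast
  define \<theta> where "\<theta> s = (1 + g s) / 2" for s
  have \<theta>: "tsirelson (\<theta> s)" for s
  proof
    have "g s \<in> {0..<1}" using g(2) by blast
    then have "0 \<le> g s" "g s < 1" by auto
    then show "0 < \<theta> s" "\<theta> s \<le> 1" unfolding \<theta>_def by auto
  qed
  have "\<forall>s. \<exists>F. F \<in> \<B> \<and> borel_reducible F (tsirelson_rel (\<theta> s))"
    using dom tsirelson.tsirelson_rel_in_schauder_relations[OF \<theta>] by blast
  from choice[OF this] obtain \<Phi> where \<Phi>: "\<And>s. \<Phi> s \<in> \<B>" "\<And>s. borel_reducible (\<Phi> s) (tsirelson_rel (\<theta> s))" by blast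
  have "inj \<Phi>"
  proof (rule injI, rule ccontr)
    fix s t assume st: "\<Phi> s = \<Phi> t" "s \<noteq> t"
    have "\<theta> s \<noteq> \<theta> t" using g(1) st(2) unfolding \<theta>_def by (auto dest: injD)
    moreover have "\<Phi> s \<in> schauder_relations" using \<Phi>(1) sub by blast
    ultimately show False
      using tsirelson_rels_incompatible[OF \<theta> \<theta>] \<Phi>(2)[of s] \<Phi>(2)[of t] st(1) by metis
  qed
  then show "(UNIV :: nat set set) \<lesssim> \<B>"
    unfolding lepoll_def using \<Phi>(1) by blast
qed

end
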